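(* Let $d\ge 1$, $K=[-1/2,1/2]^d$, and for $R>1$ let $K_R=[-R,R]^d$. There are constants $c_d>0$, which may depend only on the dimension $d$, and $C>0$, independent of $R,T,\omega_0$ and $F$, such that the following holds. Let $\omega_0>0$, let $F\in\mathcal{H}_{\omega_0}$ with $\nabla F\in L^2(\mathbb{R}^d)$, and let $0<T<|R-1|^2$. Let $w_\infty$ and $v_{T,R}$ be as defined in the context. Then $$\| w_{\infty} - v_{T,R} \|_{L^2(K)} \leq \frac{1}{\omega_0^2} e^{-\omega_0^2 T} \| F \|_{L^2(\mathbb{R}^{d})} + C_{R,T,\omega_0}\, e^{-c_d \frac{|R-1|^2}{T} } \left( \| F \|_{L^2(\mathbb{R}^d)} + \| \nabla F \|_{L^2(\mathbb{R}^d)}\right),$$ where $$C_{R,T,\omega_0} = C\, \frac{R^{(d-1)/2}}{T^{d/2}} \left( T + T^2 \right) \left( \frac{1}{|R-1|\,\omega_0^2} + 1 \right).$$ Moreover, for the choice $T = \frac{|R-1|\sqrt{c_d}}{\omega_0}$ (subject to the same condition $T<|R-1|^2$), the estimate simplifies to $$\| w_{\infty} - v_{T,R} \|_{L^2(K)} \leq \left( \frac{1}{\omega_0^2} + C_{R,T,\omega_0} \right) e^{-\omega_0 \sqrt{c_d}\, |R-1|} \left( \| F \|_{L^2(\mathbb{R}^d)} + \| \nabla F \|_{L^2(\mathbb{R}^d)}\right).$$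
   Context: For $\omega_0>0$, $\mathcal{H}_{\omega_0}=\{f\in L^2(\mathbb{R}^d): \hat f(\boldsymbol{\omega})=0 \text{ for all } |\boldsymbol{\omega}|_2\le\omega_0\}$, where $\hat f$ is the Fourier transform, with angular-frequency convention, so that the heat semigroup $e^{t\Delta}$ on $\mathbb{R}^d$ corresponds to multiplication of $\hat f(\boldsymbol\omega)$ by $e^{-|\boldsymbol{\omega}|^2t}$. Let $w$ be the solution of the heat equation $\partial_t w-\Delta w=0$ on $(0,\infty)\times\mathbb{R}^d$ with $w(0,\cdot)=F$, given by convolution of $F$ with the heat kernel. The function $w_\infty$ is the solution of $-\Delta w_\infty=F$ in $\mathbb{R}^d$ given by $w_\infty(\mathbf{x})=\int_0^\infty w(t,\mathbf{x})\,dt$. Let $v_R$ solve the Dirichlet heat problem $\partial_t v_R-\Delta v_R=0$ in $(0,T)\times K_R$, $v_R(0,\cdot)=F|_{K_R}$, $v_R=0$ on $(0,T)\times\partial K_R$, and set $v_{T,R}(\mathbf{x})=\int_0^T v_R(t,\mathbf{x})\,dt$. Equivalently, $v_{T,R}$ solves $-\Delta v_{T,R}=F-e^{T\Delta}F$ in $K_R$ with $v_{T,R}=0$ on $\partial K_R$, where $e^{T\Delta}$ is the Dirichlet heat semigroup on $K_R$. *)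

theory Defs
  imports "HOL-Analysis.Analysis"
begin

text \<open>Elements of \<open>L\<^sup>2\<close> are given by Borel measurable representatives; complex vectors carry
  the Euclidean norm, so that the norm of a gradient is the usual one.\<close>

definition L2_on :: "'a::euclidean_space set \<Rightarrow> ('a \<Rightarrow> 'b::euclidean_space) \<Rightarrow> bool" where
  "L2_on S f \<longleftrightarrow> set_borel_measurable lborel S f \<and>
     set_integrable lborel S (\<lambda>x. (norm (f x))\<^sup>2)"

definition L2_norm :: "'a::euclidean_space set \<Rightarrow> ('a \<Rightarrow> 'b::euclidean_space) \<Rightarrow> real" where
  "L2_norm S f = sqrt (LINT x:S|lborel. (norm (f x))\<^sup>2)"

definition L2_tendsto ::
    "'a::euclidean_space set \<Rightarrow> (nat \<Rightarrow> 'a \<Rightarrow> 'b::euclidean_space) \<Rightarrow> ('a \<Rightarrow> 'b) \<Rightarrow> bool" where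
  "L2_tendsto S u f \<longleftrightarrow> (\<forall>n. L2_on S (\<lambda>x. u n x - f x)) \<and>
     (\<lambda>n. L2_norm S (\<lambda>x. u n x - f x)) \<longlonglongrightarrow> 0"

text \<open>The transform on \<open>L\<^sup>2\<close> is the mean-square limit of the transforms of the truncations to
  balls. It is only determined almost everywhere, so vanishing on a ball means vanishing almost
  everywhere there.\<close>

definition fourier_integral :: "(real^'n \<Rightarrow> complex) \<Rightarrow> real^'n \<Rightarrow> complex" where
  "fourier_integral f \<omega> = (LINT x|lborel. exp (- \<i> * complex_of_real (\<omega> \<bullet> x)) * f x)"

definition has_L2_fourier :: "(real^'n \<Rightarrow> complex) \<Rightarrow> (real^'n \<Rightarrow> complex) \<Rightarrow> bool" where
  "has_L2_fourier f g \<longleftrightarrow> L2_on UNIV f \<and> L2_on UNIV g \<and>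
     L2_tendsto UNIV (\<lambda>n. fourier_integral (\<lambda>x. indicator (cball 0 (real n)) x *\<^sub>R f x)) g"

definition spectral_gap_space :: "real \<Rightarrow> (real^'n \<Rightarrow> complex) set" where
  "spectral_gap_space \<omega>0 = {f. L2_on UNIV f \<and>
     (\<exists>g. has_L2_fourier f g \<and> (AE \<omega> in lborel. norm \<omega> \<le> \<omega>0 \<longrightarrow> g \<omega> = 0))}"

primrec C_k :: "nat \<Rightarrow> ('a::euclidean_space \<Rightarrow> complex) \<Rightarrow> bool" where
  "C_k 0 f \<longleftrightarrow> continuous_on UNIV f"
| "C_k (Suc k) f \<longleftrightarrow> (\<forall>x. f differentiable (at x)) \<and>
     (\<forall>b\<in>Basis. C_k k (\<lambda>x. frechet_derivative f (at x) b))"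

definition test_function :: "'a::euclidean_space set \<Rightarrow> ('a \<Rightarrow> complex) \<Rightarrow> bool" where
  "test_function U \<phi> \<longleftrightarrow> (\<forall>k. C_k k \<phi>) \<and>
     (\<exists>C. compact C \<and> C \<subseteq> U \<and> (\<forall>x. x \<notin> C \<longrightarrow> \<phi> x = 0))"

definition grad :: "(real^'n \<Rightarrow> complex) \<Rightarrow> real^'n \<Rightarrow> complex^'n" where
  "grad \<phi> x = (\<chi> i. frechet_derivative \<phi> (at x) (axis i 1))"

definition locally_integrable_on ::
    "('a::euclidean_space \<Rightarrow> 'b::euclidean_space) \<Rightarrow> 'a set \<Rightarrow> bool" where
  "locally_integrable_on f U \<longleftrightarrow> (\<forall>C. compact C \<and> C \<subseteq> U \<longrightarrow> set_integrable lborel C f)"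

definition has_weak_gradient ::
    "(real^'n) set \<Rightarrow> (real^'n \<Rightarrow> complex) \<Rightarrow> (real^'n \<Rightarrow> complex^'n) \<Rightarrow> bool" where
  "has_weak_gradient U u g \<longleftrightarrow> locally_integrable_on u U \<and> locally_integrable_on g U \<and>
     (\<forall>\<phi> i. test_function U \<phi> \<longrightarrow>
        (LINT x:U|lborel. u x * grad \<phi> x $ i) = - (LINT x:U|lborel. g x $ i * \<phi> x))"

text \<open>\<open>u\<close> lies in \<open>H\<^sub>0\<^sup>1(U)\<close>, the closure of the test functions in \<open>H\<^sup>1(U)\<close>, and has weak
  gradient \<open>g\<close>.\<close>

definition H01_with_gradient ::
    "(real^'n) set \<Rightarrow> (real^'n \<Rightarrow> complex) \<Rightarrow> (real^'n \<Rightarrow> complex^'n) \<Rightarrow> bool" where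
  "H01_with_gradient U u g \<longleftrightarrow> L2_on U u \<and> L2_on U g \<and> has_weak_gradient U u g \<and>
     (\<exists>\<phi>. (\<forall>n. test_function U (\<phi> n)) \<and>
          L2_tendsto U \<phi> u \<and> L2_tendsto U (\<lambda>n. grad (\<phi> n)) g)"

definition cube :: "real \<Rightarrow> (real^'n) set" where
  "cube r = cbox (\<chi> i. - r) (\<chi> i. r)"

definition heat_kernel :: "real \<Rightarrow> real^'n \<Rightarrow> real" where
  "heat_kernel t x = (4 * pi * t) powr (- real CARD('n) / 2) * exp (- (norm x)\<^sup>2 / (4 * t))"

definition heat_flow :: "(real^'n \<Rightarrow> complex) \<Rightarrow> real \<Rightarrow> real^'n \<Rightarrow> complex" where
  "heat_flow F t x = (LINT y|lborel. heat_kernel t (x - y) *\<^sub>R F y)"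

definition w_infinity :: "(real^'n \<Rightarrow> complex) \<Rightarrow> real^'n \<Rightarrow> complex" where
  "w_infinity F x = (LINT t:{0<..}|lborel. heat_flow F t x)"

text \<open>Weak solutions of \<open>\<partial>\<^sub>t v - \<Delta> v = 0\<close> in \<open>(0,T) \<times> U\<close>, \<open>v(0,\<cdot>) = F\<close> on \<open>U\<close>, \<open>v = 0\<close> on
  \<open>(0,T) \<times> \<partial>U\<close>, in the class \<open>L\<^sup>2(0,T; H\<^sub>0\<^sup>1(U))\<close>. The test functions are supported in
  \<open>(-\<infinity>,T) \<times> U\<close>, hence need not vanish at \<open>t = 0\<close>: this is what encodes the initial
  condition.\<close>

definition dirichlet_heat_solution ::
    "real \<Rightarrow> (real^'n) set \<Rightarrow> (real^'n \<Rightarrow> complex) \<Rightarrow> (real \<Rightarrow> real^'n \<Rightarrow> complex) \<Rightarrow> bool" where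
  "dirichlet_heat_solution T U F v \<longleftrightarrow>
     L2_on ({0<..<T} \<times> U) (\<lambda>(t, x). v t x) \<and>
     (\<exists>g :: real \<Rightarrow> real^'n \<Rightarrow> complex^'n.
        L2_on ({0<..<T} \<times> U) (\<lambda>(t, x). g t x) \<and>
        (AE t in lborel. t \<in> {0<..<T} \<longrightarrow> H01_with_gradient U (v t) (g t)) \<and>
        (\<forall>\<phi> :: real \<times> (real^'n) \<Rightarrow> complex. test_function ({..<T} \<times> U) \<phi> \<longrightarrow>
           (LINT p:{0<..<T} \<times> U|lborel.
              - v (fst p) (snd p) * frechet_derivative \<phi> (at p) (1, 0)
              + (\<Sum>i\<in>UNIV. g (fst p) (snd p) $ i * frechet_derivative \<phi> (at p) (0, axis i 1)))
           = (LINT x:U|lborel. F x * \<phi> (0, x))))"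

definition v_integrated :: "real \<Rightarrow> (real \<Rightarrow> real^'n \<Rightarrow> complex) \<Rightarrow> real^'n \<Rightarrow> complex" where
  "v_integrated T v x = (LINT t:{0<..<T}|lborel. v t x)"

definition resonance_const :: "real \<Rightarrow> nat \<Rightarrow> real \<Rightarrow> real \<Rightarrow> real \<Rightarrow> real" where
  "resonance_const C d R T \<omega>0 =
     C * (R powr ((real d - 1) / 2) / T powr (real d / 2)) * (T + T\<^sup>2) *
       (1 / (\<bar>R - 1\<bar> * \<omega>0\<^sup>2) + 1)"

end

theory Submission
  imports Defs "HOL-Probability.Probability" "HOL-Real_Asymp.Real_Asymp" "HOL-Computational_Algebra.Polynomial"
begin

text \<open>Write \<open>r = R - 1\<close>, \<open>U\<close> for the open cube \<open>(-R, R)\<^sup>d\<close>, \<open>w\<close> for the heat flow of \<open>F\<close> on the whole space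
  and \<open>v\<close> for the Dirichlet solution. The error splits as
  \<open>\<integral>\<^sub>T\<^sup>\<infinity> w dt + \<integral>\<^sub>0\<^sup>T (w - v) dt\<close>, and the two parts are small for different reasons.

  The tail is small because \<open>F\<close> has no low frequencies: \<open>heat_flow_spectral_decay\<close> gives
  \<open>\<parallel>w(t)\<parallel> \<le> exp (- \<omega>0\<^sup>2 t) \<parallel>F\<parallel>\<close>, and a Cauchy-Schwarz inequality in time with exponential weights
  integrates this to the constant \<open>exp (- \<omega>0\<^sup>2 T) / \<omega>0\<^sup>2\<close> (\<open>heat_flow_tail\<close>). The decay rests on the
  identity \<open>(2 \<pi>)\<^sup>d \<parallel>w(t)\<parallel>\<^sup>2 = \<integral> exp (- 2 t |\<omega>|\<^sup>2) |g(\<omega>)|\<^sup>2 d\<omega>\<close> for the Fourier transform \<open>g\<close> of an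
  integrable function \<open>F\<close>. It holds by Fubini's theorem, since both sides are the same quadratic form in \<open>F\<close> with kernel \<open>heat_kernel (2 t)\<close>
  (\<open>heat_flow_parseval\<close>). Truncation to balls and Fatou's lemma extend it to \<open>L\<^sup>2\<close> as an inequality.

  The second part is small because heat needs time of order \<open>r\<^sup>2\<close> to travel from the boundary of \<open>U\<close>
  to the unit cube. The solution \<open>v\<close> is given by the method of images: the Dirichlet heat kernel of
  \<open>(-R, R)\<close> is an alternating sum of Gaussians centred at the reflections of the source, the kernel of the
  cube is a product of such sums, and \<open>image_flow\<close> is the corresponding integral operator. On the
  unit cube all terms but the central one carry a factor \<open>exp (- c r\<^sup>2 / t)\<close>, so that \<open>w - v\<close> is
  bounded there pointwise by \<open>C t\<^sup>-\<^sup>d\<^sup>/\<^sup>2 R\<^sup>d\<^sup>/\<^sup>2 exp (- r\<^sup>2 / (8 t)) \<parallel>F\<parallel>\<close>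
  (\<open>image_flow_near_heat_flow\<close>). Part of the exponential is spent to replace \<open>t\<close> by \<open>T\<close>
  and to trade the surplus \<open>R\<^sup>1\<^sup>/\<^sup>2\<close> for a factor \<open>1 + T\<close>.

  It remains to see that a weak solution in the sense of the definition is the image flow
  (\<open>dirichlet_solution_eq_image_flow\<close>). Both have the same sine coefficients. For the image flow this is
  unfolding of the reflections, because a sine mode is an eigenfunction of the heat semigroup on the line.
  For a weak solution one tests with (function of time) times (sine mode): the mode is cut off near the
  boundary, where it vanishes to first order (\<open>weak_identity_sine_mode\<close>), the membership of \<open>v(t)\<close>
  in \<open>H\<^sub>0\<^sup>1\<close> moves the remaining derivative onto the mode (\<open>H01_tensor_mode\<close>), and the
  resulting scalar equation \<open>y' = - \<mu> y\<close> is solved in the weak sense (\<open>time_ode_weak\<close>). The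
  sine system is complete by the Stone-Weierstrass theorem (\<open>sine_system_complete\<close>).\<close>

section \<open>Gaussian integrals\<close>

text \<open>Lebesgue measure on Cartesian vectors is the product of one-dimensional Lebesgue measures indexed by the
  coordinates; this is what turns integrals of products of coordinate functions into products of integrals.\<close>

lemma lborel_vec_eq_distr:
  "(lborel :: (real^'n) measure) = distr (PiM UNIV (\<lambda>_. lborel)) borel (\<lambda>f. \<chi> i. f i)"
proof (rule lborel_eqI)
  interpret finite_product_sigma_finite "\<lambda>_::'n. lborel :: real measure" UNIV
    by standard auto
  have m: "(\<lambda>f. (\<chi> i. f i) :: real^'n) \<in> measurable (PiM UNIV (\<lambda>_. lborel)) borel"
    by (subst borel_measurable_euclidean_space) (auto simp: Basis_vec_def inner_axis)
  fix l u :: "real^'n"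
  assume le: "\<And>b. b \<in> Basis \<Longrightarrow> l \<bullet> b \<le> u \<bullet> b"
  have le': "l $ i \<le> u $ i" for i
    using le[of "axis i 1"] by (auto simp: inner_axis)
  have vi: "(\<lambda>f. (\<chi> i. f i) :: real^'n) -` box l u \<inter> space (PiM UNIV (\<lambda>_::'n. lborel))
      = (\<Pi>\<^sub>E i\<in>UNIV. {l$i<..<u$i})"
    by (auto simp: space_PiM mem_box_cart PiE_iff)
  have "emeasure (distr (PiM UNIV (\<lambda>_. lborel)) borel (\<lambda>f. \<chi> i. f i)) (box l u)
      = (\<Prod>i\<in>UNIV. emeasure lborel {l$i<..<u$i})"
    by (subst emeasure_distr[OF m]) (auto simp: vi emeasure_PiM)
  also have "\<dots> = ennreal (\<Prod>i\<in>UNIV. (u - l) $ i)"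
    using le' by (simp add: prod_ennreal)
  also have "(\<Prod>i\<in>UNIV. (u - l) $ i) = (\<Prod>b\<in>Basis. (u - l) \<bullet> b)"
  proof -
    have inj: "inj (\<lambda>i::'n. axis i (1::real))" by (auto simp: inj_on_def axis_eq_axis)
    have B: "(Basis :: (real^'n) set) = range (\<lambda>i. axis i 1)" by (auto simp: Basis_vec_def)
    show ?thesis unfolding B by (subst prod.reindex[OF inj]) (simp add: inner_axis)
  qed
  finally show "emeasure (distr (PiM UNIV (\<lambda>_. lborel)) borel (\<lambda>f. \<chi> i. f i)) (box l u)
     = (\<Prod>b\<in>Basis. (u - l) \<bullet> b)" .
qed simp

lemma measurable_vec_lambda_PiM:
  "(\<lambda>f. (\<chi> i. f i) :: real^'n) \<in> measurable (PiM UNIV (\<lambda>_. lborel)) borel"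
  by (subst borel_measurable_euclidean_space) (auto simp: Basis_vec_def inner_axis)

lemma measurable_vec_nth[measurable]: "(\<lambda>x::real^'n. x $ i) \<in> borel_measurable borel"
  by (intro borel_measurable_continuous_onI continuous_intros)

lemma
  fixes f :: "'n::finite \<Rightarrow> real \<Rightarrow> 'b::{real_normed_field, banach, second_countable_topology}"
  assumes int: "\<And>i. integrable lborel (f i)"
  shows integrable_prod_vec: "integrable lborel (\<lambda>x::real^'n. \<Prod>i\<in>UNIV. f i (x $ i))"
    and integral_prod_vec: "(LINT x|lborel. (\<Prod>i\<in>UNIV. f i ((x::real^'n) $ i))) = (\<Prod>i\<in>UNIV. (LINT a|lborel. f i a))"
proof -
  interpret product_sigma_finite "\<lambda>_::'n. lborel :: real measure"
    by standard
  have [measurable]: "f i \<in> borel_measurable borel" for i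
    using borel_measurable_integrable[OF int[of i]] by simp
  show "integrable lborel (\<lambda>x::real^'n. \<Prod>i\<in>UNIV. f i (x $ i))"
    by (subst lborel_vec_eq_distr, subst integrable_distr_eq[OF measurable_vec_lambda_PiM])
       (auto intro!: product_integrable_prod int)
  show "(LINT x|lborel. (\<Prod>i\<in>UNIV. f i ((x::real^'n) $ i))) = (\<Prod>i\<in>UNIV. (LINT a|lborel. f i a))"
    by (subst lborel_vec_eq_distr, subst integral_distr[OF measurable_vec_lambda_PiM])
       (auto intro!: product_integral_prod int)
qed

lemma nn_integral_prod_vec:
  fixes f :: "'n::finite \<Rightarrow> real \<Rightarrow> ennreal"
  assumes [measurable]: "\<And>i. f i \<in> borel_measurable borel"
  shows "(\<integral>\<^sup>+x. (\<Prod>i\<in>UNIV. f i ((x::real^'n) $ i)) \<partial>lborel) = (\<Prod>i\<in>UNIV. \<integral>\<^sup>+a. f i a \<partial>lborel)"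
proof -
  interpret product_sigma_finite "\<lambda>_::'n. lborel :: real measure"
    by standard
  show ?thesis
    by (subst lborel_vec_eq_distr, subst nn_integral_distr[OF measurable_vec_lambda_PiM])
       (auto intro!: product_nn_integral_prod)
qed

definition heat_kernel1 :: "real \<Rightarrow> real \<Rightarrow> real" where
  "heat_kernel1 t a = exp (- a\<^sup>2 / (4 * t)) / sqrt (4 * pi * t)"

lemma heat_kernel1_normal: "t > 0 \<Longrightarrow> heat_kernel1 t (a - b) = normal_density b (sqrt (2 * t)) a"
  by (simp add: heat_kernel1_def normal_density_def field_simps)

lemma heat_kernel_prod:
  fixes x :: "real^'n"
  assumes "t > 0"
  shows "heat_kernel t x = (\<Prod>i\<in>UNIV. heat_kernel1 t (x $ i))"
proof -
  have "(norm x)\<^sup>2 = (\<Sum>i\<in>UNIV. (x$i)\<^sup>2)"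
    unfolding power2_norm_eq_inner inner_vec_def by (simp add: power2_eq_square)
  moreover have "(4 * pi * t) powr (- real CARD('n) / 2) = 1 / sqrt (4 * pi * t) ^ CARD('n)"
    using assms by (simp add: powr_half_sqrt[symmetric] powr_realpow[symmetric] powr_powr powr_minus_divide flip: powr_realpow)
  ultimately show ?thesis
    by (simp add: heat_kernel_def heat_kernel1_def prod_dividef exp_sum[symmetric] sum_divide_distrib sum_negf)
qed

text \<open>A rescaling of the characteristic function of the standard normal distribution.\<close>

lemma gaussian_fourier1:
  assumes s: "s > 0"
  shows "integrable lborel (\<lambda>a. complex_of_real (exp (- s * a\<^sup>2)) * exp (\<i> * complex_of_real (b * a)))"
    and "(LINT a|lborel. complex_of_real (exp (- s * a\<^sup>2)) * exp (\<i> * complex_of_real (b * a)))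
       = complex_of_real (sqrt (pi / s) * exp (- b\<^sup>2 / (4 * s)))"
proof -
  (* Substituting a = c x turns exp (- s a^2) into the standard normal density up to a factor. *)
  define c where "c = 1 / sqrt (2 * s)"
  let ?f = "\<lambda>a. complex_of_real (exp (- s * a\<^sup>2)) * exp (\<i> * complex_of_real (b * a))"
  have c: "c > 0" "c\<^sup>2 = 1 / (2 * s)" using s by (auto simp: c_def power_divide)
  have eq: "?f (0 + c * x) = complex_of_real (sqrt (2 * pi)) * (std_normal_density x *\<^sub>R exp (\<i> * complex_of_real ((b * c) * x)))" for x
  proof -
    have "s * (c * x)\<^sup>2 = x\<^sup>2 / 2" using s c by (simp add: power_mult_distrib)
    then show ?thesis by (simp add: std_normal_density_def scaleR_conv_of_real ac_simps)
  qed
  have i: "integrable lborel (\<lambda>x. std_normal_density x *\<^sub>R exp (\<i> * complex_of_real ((b * c) * x)))"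
    by (rule Bochner_Integration.integrable_bound[OF integrable_normal_density[where \<mu>=0 and \<sigma>=1]]) auto
  show "integrable lborel ?f"
    by (subst lborel_integrable_real_affine_iff[symmetric, of c _ 0])
      (use c in \<open>auto simp only: eq intro!: integrable_mult_right i\<close>)
  have ch: "(LINT x|lborel. std_normal_density x *\<^sub>R exp (\<i> * complex_of_real ((b * c) * x))) = complex_of_real (exp (- ((b * c)\<^sup>2) / 2))"
    using fun_cong[OF char_std_normal_distribution, of "b * c"] unfolding char_def
    by (subst (asm) integral_density) auto
  have "(LINT a|lborel. ?f a) = c *\<^sub>R (LINT x|lborel. ?f (0 + c * x))"
    using lborel_integral_real_affine[of c ?f 0] c by simp
  also have "\<dots> = c *\<^sub>R (complex_of_real (sqrt (2 * pi)) * complex_of_real (exp (- ((b * c)\<^sup>2) / 2)))"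
    by (simp only: eq integral_mult_right_zero ch)
  also have "\<dots> = complex_of_real ((c * sqrt (2 * pi)) * exp (- ((b * c)\<^sup>2) / 2))"
    by (simp add: scaleR_conv_of_real)
  also have "c * sqrt (2 * pi) = sqrt (pi / s)"
    using s by (simp add: c_def real_sqrt_divide[symmetric] real_sqrt_mult[symmetric])
  also have "- ((b * c)\<^sup>2) / 2 = - b\<^sup>2 / (4 * s)"
    using c by (simp add: power_mult_distrib)
  finally show "(LINT a|lborel. ?f a) = complex_of_real (sqrt (pi / s) * exp (- b\<^sup>2 / (4 * s)))" .
qed

lemma heat_kernel1_integral:
  assumes "t > 0"
  shows "integrable lborel (\<lambda>a. heat_kernel1 t (a - b))" "(LINT a|lborel. heat_kernel1 t (a - b)) = 1"
    "0 \<le> heat_kernel1 t a"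
  using assms by (simp_all add: heat_kernel1_normal) (simp add: heat_kernel1_def)

text \<open>A shifted sine of frequency \<open>k\<close> is an eigenfunction of the heat semigroup on the line: the
  imaginary part of the Gaussian Fourier integral.\<close>

lemma heat_kernel1_sin:
  assumes t: "t > 0"
  shows "integrable lborel (\<lambda>a. heat_kernel1 t (a - b) * sin (k * a + c))"
    and "(LINT a|lborel. heat_kernel1 t (a - b) * sin (k * a + c)) = exp (- k\<^sup>2 * t) * sin (k * b + c)"
proof -
  let ?g = "\<lambda>a. complex_of_real (exp (- (1/(4*t)) * a\<^sup>2)) * exp (\<i> * complex_of_real (k * a))"
  define w where "w = exp (\<i> * complex_of_real (k * b + c)) / complex_of_real (sqrt (4 * pi * t))"
  have Im_eq: "Im (w * ?g a) = heat_kernel1 t a * sin (k * (a + b) + c)" for a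
  proof -
    have "w * ?g a = complex_of_real (heat_kernel1 t a) * exp (\<i> * complex_of_real (k * (a + b) + c))"
      by (simp add: w_def heat_kernel1_def exp_add[symmetric] algebra_simps)
    then show ?thesis by (simp add: Im_exp)
  qed
  note g = gaussian_fourier1[of "1/(4*t)" k]
  have i: "integrable lborel (\<lambda>a. heat_kernel1 t a * sin (k * (a + b) + c))"
    unfolding Im_eq[symmetric] using g t by (intro integrable_Im integrable_mult_right) auto
  show "integrable lborel (\<lambda>a. heat_kernel1 t (a - b) * sin (k * a + c))"
    using lborel_integrable_real_affine[OF i, of 1 "-b"] by (simp add: algebra_simps)
  have "(LINT a|lborel. heat_kernel1 t (a - b) * sin (k * a + c)) = (LINT a|lborel. heat_kernel1 t a * sin (k * (a + b) + c))"
    using lborel_integral_real_affine[of 1 "\<lambda>a. heat_kernel1 t a * sin (k * (a + b) + c)" "-b"] by (simp add: algebra_simps)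
  also have "\<dots> = Im (LINT a|lborel. w * ?g a)"
    unfolding Im_eq[symmetric] using g t by (intro integral_Im integrable_mult_right) auto
  also have "\<dots> = Im (w * complex_of_real (sqrt (pi / (1/(4*t))) * exp (- k\<^sup>2 / (4 * (1/(4*t))))))"
    using g t by (subst integral_mult_right_zero) auto
  also have "w * complex_of_real (sqrt (pi / (1/(4*t))) * exp (- k\<^sup>2 / (4 * (1/(4*t))))) = 
     complex_of_real (exp (- k\<^sup>2 * t)) * exp (\<i> * complex_of_real (k * b + c))"
    using t by (simp add: w_def field_simps)
  finally show "(LINT a|lborel. heat_kernel1 t (a - b) * sin (k * a + c)) = exp (- k\<^sup>2 * t) * sin (k * b + c)"
    by (simp add: Im_exp)
qed

lemma heat_kernel_nonneg: "0 \<le> heat_kernel t x"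
  by (simp add: heat_kernel_def)

lemma heat_kernel_commute: "heat_kernel t (x - y) = heat_kernel t (y - x)"
  by (simp add: heat_kernel_def norm_minus_commute)

lemma heat_kernel_measurable[measurable (raw)]:
  fixes g :: "'a \<Rightarrow> real^'n"
  assumes [measurable]: "f \<in> borel_measurable M" "g \<in> borel_measurable M"
  shows "(\<lambda>x. heat_kernel (f x) (g x)) \<in> borel_measurable M"
  unfolding heat_kernel_def by measurable

lemma heat_kernel_integral:
  fixes y :: "real^'n"
  assumes "t > 0"
  shows "integrable lborel (\<lambda>x. heat_kernel t (x - y))" "(LINT x|lborel. heat_kernel t (x - y)) = 1"
    "(\<integral>\<^sup>+x. heat_kernel t (x - y) \<partial>lborel) = 1" "(\<integral>\<^sup>+x. heat_kernel t (y - x) \<partial>lborel) = 1"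
proof -
  show i: "integrable lborel (\<lambda>x. heat_kernel t (x - y))" 
    using integrable_prod_vec[of "\<lambda>i a. heat_kernel1 t (a - y $ i)"] heat_kernel1_integral[OF assms]
    by (simp add: heat_kernel_prod[OF assms])
  show j: "(LINT x|lborel. heat_kernel t (x - y)) = 1"
    using integral_prod_vec[of "\<lambda>i a. heat_kernel1 t (a - y $ i)"] heat_kernel1_integral[OF assms]
    by (simp add: heat_kernel_prod[OF assms])
  show "(\<integral>\<^sup>+x. heat_kernel t (x - y) \<partial>lborel) = 1"
    using i j by (simp add: nn_integral_eq_integral heat_kernel_nonneg)
  then show "(\<integral>\<^sup>+x. heat_kernel t (y - x) \<partial>lborel) = 1"
    by (simp add: heat_kernel_commute)
qed

lemma heat_kernel_le:
  fixes x :: "real^'n"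
  shows "t > 0 \<Longrightarrow> heat_kernel t x \<le> (4 * pi * t) powr (- real CARD('n) / 2)"
  unfolding heat_kernel_def by (rule mult_left_le) auto

text \<open>Completing the square, by the parallelogram law. Integration over \<open>x\<close> yields the semigroup
  property of the heat kernel.\<close>

lemma heat_kernel_mult:
  fixes x y z :: "real^'n"
  assumes t: "t > 0"
  shows "heat_kernel t (x - y) * heat_kernel t (x - z) =
     heat_kernel (2 * t) (y - z) * heat_kernel (t / 2) (x - (1/2) *\<^sub>R (y + z))"
proof -
  have p: "(norm (x - y))\<^sup>2 + (norm (x - z))\<^sup>2 = 2 * (norm (x - (1/2) *\<^sub>R (y + z)))\<^sup>2 + (norm (y - z))\<^sup>2 / 2"
  proof -
    define m d where "m = x - (1/2) *\<^sub>R (y + z)" and "d = (1/2) *\<^sub>R (y - z)"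
    have e: "x - y = m - d" "x - z = m + d"
      by (simp_all add: m_def d_def algebra_simps scaleR_left_distrib[symmetric])
    have "(norm d)\<^sup>2 = (norm (y - z))\<^sup>2 / 4" by (simp add: d_def power_divide)
    moreover have "(norm (m - d))\<^sup>2 + (norm (m + d))\<^sup>2 = 2 * (norm m)\<^sup>2 + 2 * (norm d)\<^sup>2"
      by (simp add: power2_norm_eq_inner inner_diff_left inner_diff_right inner_add_left inner_add_right)
    ultimately show ?thesis unfolding e m_def[symmetric] by linarith
  qed
  have "- (norm (x - y))\<^sup>2 / (4 * t) + - (norm (x - z))\<^sup>2 / (4 * t) = - ((norm (x - y))\<^sup>2 + (norm (x - z))\<^sup>2) / (4*t)"
    by (simp add: add_divide_distrib diff_divide_distrib)
  also have "\<dots> = - (norm (y - z))\<^sup>2 / (4 * (2 * t)) + - (norm (x - (1/2) *\<^sub>R (y + z)))\<^sup>2 / (4 * (t/2))"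
    unfolding p using t by (simp add: field_simps)
  finally have e: "exp (- (norm (x - y))\<^sup>2 / (4 * t)) * exp (- (norm (x - z))\<^sup>2 / (4 * t))
      = exp (- (norm (y - z))\<^sup>2 / (4 * (2 * t))) * exp (- (norm (x - (1/2) *\<^sub>R (y + z)))\<^sup>2 / (4 * (t/2)))"
    by (simp add: exp_add[symmetric])
  define q where "q = - real CARD('n) / 2"
  have w: "(4 * pi * (2 * t)) powr q * (4 * pi * (t/2)) powr q = (4 * pi * t) powr q * (4 * pi * t) powr q"
    using t by (simp add: powr_mult[symmetric])
  have "(4 * pi * t) powr q * E1 * ((4 * pi * t) powr q * E2) = (4 * pi * (2 * t)) powr q * E3 * ((4 * pi * (t/2)) powr q * E4)"
    if "E1 * E2 = E3 * E4" for E1 E2 E3 E4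
  proof -
    have "(4 * pi * t) powr q * E1 * ((4 * pi * t) powr q * E2) = ((4 * pi * t) powr q * (4 * pi * t) powr q) * (E1 * E2)"
      by (simp only: ac_simps)
    also have "\<dots> = (4 * pi * (2 * t)) powr q * E3 * ((4 * pi * (t/2)) powr q * E4)"
      unfolding w[symmetric] that by (simp only: ac_simps)
    finally show ?thesis .
  qed
  then show ?thesis
    unfolding heat_kernel_def q_def[symmetric] using e by blast
qed

lemma gaussian_fourier:
  fixes z :: "real^'n"
  assumes s: "s > 0"
  shows "integrable lborel (\<lambda>\<omega>. complex_of_real (exp (- s * (norm \<omega>)\<^sup>2)) * exp (\<i> * complex_of_real (\<omega> \<bullet> z)))" (is ?A)
    and "(LINT \<omega>|lborel. complex_of_real (exp (- s * (norm \<omega>)\<^sup>2)) * exp (\<i> * complex_of_real (\<omega> \<bullet> z)))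
       = complex_of_real ((2 * pi) ^ CARD('n) * heat_kernel s z)" (is ?B)
proof -
  have e: "complex_of_real (exp (- s * (norm \<omega>)\<^sup>2)) * exp (\<i> * complex_of_real (\<omega> \<bullet> z))
    = (\<Prod>i\<in>UNIV. complex_of_real (exp (- s * (\<omega>$i)\<^sup>2)) * exp (\<i> * complex_of_real (z $ i * \<omega> $ i)))" for \<omega> :: "real^'n"
  proof -
    have "(norm \<omega>)\<^sup>2 = (\<Sum>i\<in>UNIV. (\<omega>$i)\<^sup>2)"
      unfolding power2_norm_eq_inner inner_vec_def by (simp add: power2_eq_square)
    then show ?thesis
      by (simp add: inner_vec_def prod.distrib sum_distrib_left exp_sum[symmetric] mult.commute sum_negf 
        flip: of_real_prod)
  qed
  show ?A unfolding e by (intro integrable_prod_vec gaussian_fourier1 s)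
  have "heat_kernel1 s a * (2 * pi) = sqrt (pi / s) * exp (- a\<^sup>2 / (4 * s))" for a
  proof -
    have "(2 * pi) / sqrt (4 * pi * s) = sqrt (pi / s)"
    proof (rule real_sqrt_unique[symmetric])
      show "((2 * pi) / sqrt (4 * pi * s))\<^sup>2 = pi / s"
        using s by (simp add: power_divide power_mult_distrib field_simps power2_eq_square)
    qed (use s in auto)
    moreover have "heat_kernel1 s a * (2 * pi) = (2 * pi) / sqrt (4 * pi * s) * exp (- a\<^sup>2 / (4 * s))"
      by (simp add: heat_kernel1_def)
    ultimately show ?thesis by simp
  qed
  then have k: "sqrt (pi / s) * exp (- a\<^sup>2 / (4 * s)) = (2 * pi) * heat_kernel1 s a" for a
    by (metis mult.commute)
  have "(LINT \<omega>|lborel. (\<Prod>i\<in>UNIV. complex_of_real (exp (- s * (\<omega>$i)\<^sup>2)) * exp (\<i> * complex_of_real (z $ i * \<omega> $ i))))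
      = (\<Prod>i\<in>UNIV. (LINT a|lborel. complex_of_real (exp (- s * a\<^sup>2)) * exp (\<i> * complex_of_real (z $ i * a))))"
    by (rule integral_prod_vec) (rule gaussian_fourier1(1)[OF s])
  also have "\<dots> = complex_of_real ((2 * pi) ^ CARD('n) * heat_kernel s z)"
    unfolding gaussian_fourier1(2)[OF s] k heat_kernel_prod[OF s] by (simp add: prod.distrib)
  finally show ?B unfolding e .
qed

section \<open>A Parseval identity for the heat flow\<close>

lemma
  fixes a :: "'a::euclidean_space \<Rightarrow> 'c::{real_normed_field, banach, second_countable_topology}"
    and b :: "'b::euclidean_space \<Rightarrow> 'c"
  assumes a: "integrable lborel a" and b: "integrable lborel b"
  shows integrable_pair_mult: "integrable (lborel \<Otimes>\<^sub>M lborel) (\<lambda>p. a (fst p) * b (snd p))"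
    and integral_pair_mult: "(LINT p|(lborel \<Otimes>\<^sub>M lborel). a (fst p) * b (snd p)) = (LINT y|lborel. a y) * (LINT z|lborel. b z)"
proof -
  have [measurable]: "a \<in> borel_measurable borel" "b \<in> borel_measurable borel"
    using a b by (auto dest!: borel_measurable_integrable)
  show i: "integrable (lborel \<Otimes>\<^sub>M lborel) (\<lambda>p. a (fst p) * b (snd p))"
    using a b by (intro lborel_pair.Fubini_integrable) (auto simp: norm_mult)
  show "(LINT p|(lborel \<Otimes>\<^sub>M lborel). a (fst p) * b (snd p)) = (LINT y|lborel. a y) * (LINT z|lborel. b z)"
    by (subst lborel_pair.integral_fst'[OF i, symmetric]) simp
qed

text \<open>The squared norm of \<open>\<lambda>\<omega>. \<integral> k \<omega> y f(y) dy\<close> depends on \<open>k\<close> only through the Gram kernel \<open>G\<close> of its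
  columns. Two kernels with the same Gram kernel therefore give functions of the same norm, which replaces
  Plancherel's theorem below.\<close>

lemma gram_integral:
  fixes k :: "'a::euclidean_space \<Rightarrow> 'a \<Rightarrow> complex" and f :: "'a \<Rightarrow> complex"
  assumes km: "(\<lambda>p. k (fst p) (snd p)) \<in> borel_measurable borel"
    and f: "integrable lborel f"
    and bd: "\<And>\<omega> y. norm (k \<omega> y) \<le> M"
    and ki: "\<And>y. integrable lborel (\<lambda>\<omega>. (norm (k \<omega> y))\<^sup>2)" "\<And>y. (LINT \<omega>|lborel. (norm (k \<omega> y))\<^sup>2) \<le> B"
    and G: "\<And>y z. (LINT \<omega>|lborel. k \<omega> y * cnj (k \<omega> z)) = G y z"
  shows "integrable lborel (\<lambda>\<omega>. (norm (LINT y|lborel. k \<omega> y * f y))\<^sup>2)"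
    and "complex_of_real (LINT \<omega>|lborel. (norm (LINT y|lborel. k \<omega> y * f y))\<^sup>2)
       = (LINT p|lborel. f (fst p) * cnj (f (snd p)) * G (fst p) (snd p))"
proof -
  have [measurable]: "f \<in> borel_measurable borel"
    using f by (auto dest!: borel_measurable_integrable)
  have km': "(\<lambda>x. k (u x) (v x)) \<in> borel_measurable N" if [measurable]: "u \<in> borel_measurable N" "v \<in> borel_measurable N"
    for u v :: "'x \<Rightarrow> 'a" and N
    using measurable_compose[OF _ km, of "\<lambda>x. (u x, v x)" N] that by simp
  note km'[measurable (raw)]
  let ?P = "\<lambda>p \<omega>. (k \<omega> (fst p) * f (fst p)) * cnj (k \<omega> (snd p) * f (snd p))"
  have ms: "(\<lambda>q::('a \<times> 'a) \<times> 'a. fst (fst q)) \<in> borel_measurable borel"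
    "(\<lambda>q::('a \<times> 'a) \<times> 'a. snd (fst q)) \<in> borel_measurable borel"
    "(\<lambda>q::('a \<times> 'a) \<times> 'a. snd q) \<in> borel_measurable borel"
    "(\<lambda>q::'a \<times> 'a. fst q) \<in> borel_measurable borel" "(\<lambda>q::'a \<times> 'a. snd q) \<in> borel_measurable borel"
    by (intro borel_measurable_continuous_onI continuous_intros)+
  have fm: "f \<in> borel_measurable borel" and cm: "cnj \<in> borel_measurable borel"
    by (measurable, intro borel_measurable_continuous_onI continuous_intros)
  have [measurable]: "(\<lambda>\<omega>. k \<omega> y) \<in> borel_measurable borel" "(\<lambda>y. k \<omega> y) \<in> borel_measurable borel" for \<omega> y
    by (rule km'; simp)+
  note cm[measurable]
  have P0: "(\<lambda>q. ?P (fst q) (snd q)) \<in> borel_measurable borel"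
    by (intro borel_measurable_times km' ms measurable_compose[OF _ fm] measurable_compose[OF _ cm])
  have P: "(\<lambda>q. ?P (fst q) (snd q)) \<in> borel_measurable (lborel \<Otimes>\<^sub>M lborel)"
    using P0 by (simp add: lborel_prod)
  (* Pointwise products of columns are dominated by sums of squares, so the triple integral converges absolutely. *)
  have kk: "norm (k \<omega> y) * norm (k \<omega> z) \<le> (norm (k \<omega> y))\<^sup>2 + (norm (k \<omega> z))\<^sup>2" for \<omega> y z
    using sum_squares_bound[of "norm (k \<omega> y)" "norm (k \<omega> z)"]
      mult_nonneg_nonneg[OF norm_ge_zero norm_ge_zero, of "k \<omega> y" "k \<omega> z"] by linarith
  have kki: "integrable lborel (\<lambda>\<omega>. norm (k \<omega> y) * norm (k \<omega> z))" for y z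
    by (rule Bochner_Integration.integrable_bound[OF Bochner_Integration.integrable_add[OF ki(1)[of y] ki(1)[of z]]])
      (auto simp: kk)
  have kkB: "(LINT \<omega>|lborel. norm (k \<omega> y) * norm (k \<omega> z)) \<le> 2 * B" for y z
  proof -
    have "(LINT \<omega>|lborel. norm (k \<omega> y) * norm (k \<omega> z)) \<le> (LINT \<omega>|lborel. (norm (k \<omega> y))\<^sup>2 + (norm (k \<omega> z))\<^sup>2)"
      by (intro integral_mono kki Bochner_Integration.integrable_add ki(1) kk)
    also have "\<dots> \<le> 2 * B" using ki(2)[of y] ki(2)[of z] ki(1) by simp
    finally show ?thesis .
  qed
  have ff: "integrable lborel (\<lambda>p. norm (f (fst p)) * norm (f (snd p)))"
    using integrable_pair_mult[of "\<lambda>y. norm (f y)" "\<lambda>y. norm (f y)"] f by (simp add: lborel_prod)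
  have int: "integrable (lborel \<Otimes>\<^sub>M lborel) (\<lambda>q. ?P (fst q) (snd q))"
  proof (rule lborel_pair.Fubini_integrable[OF P])
    have n: "norm (?P p \<omega>) = (norm (k \<omega> (fst p)) * norm (k \<omega> (snd p))) * (norm (f (fst p)) * norm (f (snd p)))" for p \<omega>
      by (simp add: norm_mult)
    show "integrable lborel (\<lambda>x. LINT y|lborel. norm (?P (fst (x, y)) (snd (x, y))))"
      unfolding fst_conv snd_conv n integral_mult_left_zero
    proof (rule Bochner_Integration.integrable_bound[OF integrable_mult_right[OF ff, of "2*B"]])
      show "AE x in lborel. norm ((LINT \<omega>|lborel. norm (k \<omega> (fst x)) * norm (k \<omega> (snd x))) * (norm (f (fst x)) * norm (f (snd x))))
          \<le> norm (2 * B * (norm (f (fst x)) * norm (f (snd x))))"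
        by (auto simp: abs_mult intro!: AE_I2 mult_right_mono order_trans[OF kkB])
      have "(\<lambda>x. LINT \<omega>|lborel. norm (k \<omega> (fst x)) * norm (k \<omega> (snd x))) \<in> borel_measurable (lborel::('a \<times> 'a) measure)"
        by (rule lborel.borel_measurable_lebesgue_integral)
          (simp add: lborel_prod case_prod_beta', intro borel_measurable_times measurable_compose[OF _ borel_measurable_norm] km' ms)
      then show "(\<lambda>x. (LINT \<omega>|lborel. norm (k \<omega> (fst x)) * norm (k \<omega> (snd x))) * (norm (f (fst x)) * norm (f (snd x))))
          \<in> borel_measurable lborel"
        using borel_measurable_integrable[OF ff] by (rule borel_measurable_times)
    qed
    show "AE x in lborel. integrable lborel (\<lambda>y. ?P (fst (x, y)) (snd (x, y)))"
    proof (rule AE_I2)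
      fix x :: "'a \<times> 'a"
      show "integrable lborel (\<lambda>y. ?P (fst (x, y)) (snd (x, y)))"
        by (rule Bochner_Integration.integrable_bound[OF integrable_mult_left[OF kki[of "fst x" "snd x"], of "norm (f (fst x)) * norm (f (snd x))"]])
          (auto simp: norm_mult ac_simps)
    qed
  qed
  have kf: "integrable lborel (\<lambda>y. k \<omega> y * f y)" for \<omega>
    by (rule Bochner_Integration.integrable_bound[OF integrable_mult_right[OF f, of "of_real M"]])
      (auto simp: norm_mult intro!: mult_right_mono order_trans[OF bd])
  have inner: "(LINT p|lborel. ?P p \<omega>) = complex_of_real ((norm (LINT y|lborel. k \<omega> y * f y))\<^sup>2)" for \<omega>
    using integral_pair_mult[OF kf[of \<omega>] integrable_cnj[OF kf[of \<omega>]]]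
    by (simp only: lborel_prod complex_norm_square integral_bounded_linear[OF bounded_linear_cnj kf])
  have sw: "integrable (lborel \<Otimes>\<^sub>M lborel) (\<lambda>q. ?P (snd q) (fst q))"
    using lborel_pair.integrable_product_swap[OF int] by (simp add: case_prod_beta')
  have "integrable lborel (\<lambda>\<omega>. complex_of_real ((norm (LINT y|lborel. k \<omega> y * f y))\<^sup>2))"
    using lborel_pair.integrable_fst'[OF sw] by (simp only: fst_conv snd_conv inner)
  then show "integrable lborel (\<lambda>\<omega>. (norm (LINT y|lborel. k \<omega> y * f y))\<^sup>2)"
    using integrable_Re by fastforce
  have "complex_of_real (LINT \<omega>|lborel. (norm (LINT y|lborel. k \<omega> y * f y))\<^sup>2) = (LINT \<omega>|lborel. (LINT p|lborel. ?P p \<omega>))"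
    unfolding inner by (rule integral_complex_of_real[symmetric])
  also have "\<dots> = (LINT p|lborel. (LINT \<omega>|lborel. ?P p \<omega>))"
    using lborel_pair.Fubini_integral[of "\<lambda>p \<omega>. ?P p \<omega>"] int by (simp add: case_prod_beta')
  also have "\<dots> = (LINT p|lborel. f (fst p) * cnj (f (snd p)) * G (fst p) (snd p))"
  proof -
    have "?P p \<omega> = (f (fst p) * cnj (f (snd p))) * (k \<omega> (fst p) * cnj (k \<omega> (snd p)))" for p \<omega> by simp
    then show ?thesis by (simp only: integral_mult_right_zero G)
  qed
  finally show "complex_of_real (LINT \<omega>|lborel. (norm (LINT y|lborel. k \<omega> y * f y))\<^sup>2)
       = (LINT p|lborel. f (fst p) * cnj (f (snd p)) * G (fst p) (snd p))" .
qed

text \<open>The kernels \<open>exp (- t |\<omega>|\<^sup>2 - \<i> \<omega> \<bullet> y)\<close> and \<open>(2 \<pi>)\<^sup>d\<^sup>/\<^sup>2 heat_kernel t (\<omega> - y)\<close> have the same Gram kernel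
  \<open>(2 \<pi>)\<^sup>d heat_kernel (2 t) (y - z)\<close>: the first by the Fourier transform of the Gaussian, the second by the semigroup
  property.\<close>

lemma heat_flow_parseval:
  fixes f :: "real^'n \<Rightarrow> complex"
  assumes f: "integrable lborel f" and t: "t > 0"
  shows "integrable lborel (\<lambda>x. (norm (heat_flow f t x))\<^sup>2)"
    and "integrable lborel (\<lambda>\<omega>. exp (- 2 * t * (norm \<omega>)\<^sup>2) * (norm (fourier_integral f \<omega>))\<^sup>2)"
    and "(2 * pi) ^ CARD('n) * (LINT x|lborel. (norm (heat_flow f t x))\<^sup>2)
        = (LINT \<omega>|lborel. exp (- 2 * t * (norm \<omega>)\<^sup>2) * (norm (fourier_integral f \<omega>))\<^sup>2)"
proof -
  define c where "c = (2 * pi) ^ CARD('n)"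
  have c: "c > 0" by (simp add: c_def)
  let ?k1 = "\<lambda>\<omega> y :: real^'n. complex_of_real (exp (- t * (norm \<omega>)\<^sup>2)) * exp (- \<i> * complex_of_real (\<omega> \<bullet> y))"
  let ?k2 = "\<lambda>\<omega> y :: real^'n. complex_of_real (sqrt c * heat_kernel t (\<omega> - y))"
  let ?G = "\<lambda>y z. complex_of_real (c * heat_kernel (2 * t) (y - z))"
  have k1n: "norm (?k1 \<omega> y) = exp (- t * (norm \<omega>)\<^sup>2)" for \<omega> y by (simp add: norm_mult)
  have i1: "integrable lborel (\<lambda>\<omega>::real^'n. (exp (- t * (norm \<omega>)\<^sup>2))\<^sup>2)"
    using integrable_Re[OF gaussian_fourier(1)[of "2 * t" 0]] t by (simp add: power2_eq_square exp_add[symmetric] field_simps)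
  have G1: "(LINT \<omega>|lborel. ?k1 \<omega> y * cnj (?k1 \<omega> z)) = ?G y z" for y z
  proof -
    have "?k1 \<omega> y * cnj (?k1 \<omega> z) = complex_of_real (exp (- (2 * t) * (norm \<omega>)\<^sup>2)) * exp (\<i> * complex_of_real (\<omega> \<bullet> (z - y)))" for \<omega>
    proof -
      have "cnj (exp (- \<i> * complex_of_real (\<omega> \<bullet> z))) = exp (\<i> * complex_of_real (\<omega> \<bullet> z))" by (simp add: exp_cnj)
      moreover have "exp (- t * (norm \<omega>)\<^sup>2) * exp (- t * (norm \<omega>)\<^sup>2) = exp (- (2 * t) * (norm \<omega>)\<^sup>2)"
        by (simp add: exp_add[symmetric])
      moreover have "exp (- \<i> * complex_of_real (\<omega> \<bullet> y)) * exp (\<i> * complex_of_real (\<omega> \<bullet> z)) = exp (\<i> * complex_of_real (\<omega> \<bullet> (z - y)))"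
        by (simp add: exp_add[symmetric] inner_diff_right algebra_simps)
      moreover have "?k1 \<omega> y * cnj (?k1 \<omega> z) = complex_of_real (exp (- t * (norm \<omega>)\<^sup>2) * exp (- t * (norm \<omega>)\<^sup>2))
          * (exp (- \<i> * complex_of_real (\<omega> \<bullet> y)) * cnj (exp (- \<i> * complex_of_real (\<omega> \<bullet> z))))"
        by (simp only: complex_cnj_mult complex_cnj_complex_of_real of_real_mult ac_simps)
      ultimately show ?thesis by (simp only:)
    qed
    then show ?thesis using gaussian_fourier(2)[of "2*t" "z - y"] t
      by (simp add: c_def heat_kernel_commute[of _ z y])
  qed
  have m1: "(\<lambda>p. ?k1 (fst p) (snd p)) \<in> borel_measurable borel"
    by (intro borel_measurable_continuous_onI continuous_intros)
  have 0: "norm (?k1 \<omega> y) \<le> 1" "integrable lborel (\<lambda>\<omega>. (norm (?k1 \<omega> y))\<^sup>2)"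
    "(LINT \<omega>|lborel. (norm (?k1 \<omega> y))\<^sup>2) \<le> (LINT \<omega>|lborel. (exp (- t * (norm (\<omega>::real^'n))\<^sup>2))\<^sup>2)" for \<omega> y
    unfolding k1n using i1 t by simp_all
  note r1 = gram_integral[where k = ?k1, OF m1 f 0 G1]
  have 1: "integrable lborel (\<lambda>\<omega>. (norm (LINT y|lborel. ?k1 \<omega> y * f y))\<^sup>2)"
    "complex_of_real (LINT \<omega>|lborel. (norm (LINT y|lborel. ?k1 \<omega> y * f y))\<^sup>2) = (LINT p|lborel. f (fst p) * cnj (f (snd p)) * ?G (fst p) (snd p))"
    by (fact r1)+
  have k1f: "(norm (LINT y|lborel. ?k1 \<omega> y * f y))\<^sup>2 = exp (- 2 * t * (norm \<omega>)\<^sup>2) * (norm (fourier_integral f \<omega>))\<^sup>2" for \<omega>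
    by (simp add: mult.assoc norm_mult power_mult_distrib fourier_integral_def)
      (simp add: power2_eq_square exp_add[symmetric])
  have G2: "(LINT \<omega>|lborel. ?k2 \<omega> y * cnj (?k2 \<omega> z)) = ?G y z" for y z
  proof -
    have "?k2 \<omega> y * cnj (?k2 \<omega> z) = complex_of_real (c * heat_kernel (2 * t) (y - z) * heat_kernel (t / 2) (\<omega> - (1/2) *\<^sub>R (y + z)))" for \<omega>
      using heat_kernel_mult[OF t, of \<omega> y z] c
      by (simp add: mult.assoc flip: of_real_mult) (simp add: algebra_simps)
    then show ?thesis using heat_kernel_integral(2)[of "t/2" "(1/2) *\<^sub>R (y + z)"] t by simp
  qed
  define M where "M = sqrt c * (4 * pi * t) powr (- real CARD('n) / 2)"
  have nk2: "norm (?k2 \<omega> y) = sqrt c * heat_kernel t (\<omega> - y)" for \<omega> y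
    unfolding norm_of_real using c by (simp add: heat_kernel_nonneg)
  have M: "norm (?k2 \<omega> y) \<le> M" for \<omega> y
    using heat_kernel_le[OF t, of "\<omega> - y"] c unfolding nk2 by (simp add: M_def)
  have k2n: "(norm (?k2 \<omega> y))\<^sup>2 = c * heat_kernel (2 * t) (0::real^'n) * heat_kernel (t / 2) (\<omega> - y)" for \<omega> y
  proof -
    have "(norm (?k2 \<omega> y))\<^sup>2 = c * (heat_kernel t (\<omega> - y) * heat_kernel t (\<omega> - y))"
      unfolding nk2 using c by (simp add: power_mult_distrib power2_eq_square)
    also have "\<dots> = c * heat_kernel (2 * t) (0::real^'n) * heat_kernel (t / 2) (\<omega> - y)"
      unfolding heat_kernel_mult[OF t, of \<omega> y y] by (simp flip: scaleR_2)
    finally show ?thesis .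
  qed
  have m2: "(\<lambda>p. ?k2 (fst p) (snd p)) \<in> borel_measurable borel"
    unfolding heat_kernel_def by (intro borel_measurable_continuous_onI continuous_intros) (use t in auto)
  have 0: "integrable lborel (\<lambda>\<omega>. (norm (?k2 \<omega> y))\<^sup>2)"
    "(LINT \<omega>|lborel. (norm (?k2 \<omega> y))\<^sup>2) \<le> c * heat_kernel (2 * t) (0::real^'n)" for y
    unfolding k2n using heat_kernel_integral[of "t/2" y] t by simp_all
  note r2 = gram_integral[where k = ?k2, OF m2 f M 0 G2]
  have 2: "integrable lborel (\<lambda>\<omega>. (norm (LINT y|lborel. ?k2 \<omega> y * f y))\<^sup>2)"
    "complex_of_real (LINT \<omega>|lborel. (norm (LINT y|lborel. ?k2 \<omega> y * f y))\<^sup>2) = (LINT p|lborel. f (fst p) * cnj (f (snd p)) * ?G (fst p) (snd p))"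
    by (fact r2)+
  have k2f: "(norm (LINT y|lborel. ?k2 \<omega> y * f y))\<^sup>2 = c * (norm (heat_flow f t \<omega>))\<^sup>2" for \<omega>
    using c by (simp add: mult.assoc norm_mult power_mult_distrib heat_flow_def scaleR_conv_of_real)
  show "integrable lborel (\<lambda>x. (norm (heat_flow f t x))\<^sup>2)"
    using integrable_mult_right[OF 2(1)[unfolded k2f], of "1/c"] c by simp
  show "integrable lborel (\<lambda>\<omega>. exp (- 2 * t * (norm \<omega>)\<^sup>2) * (norm (fourier_integral f \<omega>))\<^sup>2)"
    using 1(1) unfolding k1f .
  show "(2 * pi) ^ CARD('n) * (LINT x|lborel. (norm (heat_flow f t x))\<^sup>2)
        = (LINT \<omega>|lborel. exp (- 2 * t * (norm \<omega>)\<^sup>2) * (norm (fourier_integral f \<omega>))\<^sup>2)"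
    using trans[OF 1(2) 2(2)[symmetric]] unfolding k1f k2f of_real_eq_iff by (simp add: c_def)
qed

section \<open>Exponential decay under a spectral gap\<close>

lemma L2_on_UNIV_measurable: "L2_on UNIV f \<Longrightarrow> f \<in> borel_measurable borel"
  by (simp add: L2_on_def set_borel_measurable_def)

lemma L2_on_UNIV_integrable: "L2_on UNIV f \<Longrightarrow> integrable lborel (\<lambda>x. (norm (f x))\<^sup>2)"
  by (simp add: L2_on_def set_integrable_def)

text \<open>On sets of finite measure, square integrable functions are integrable, because \<open>a \<le> 1 + a\<^sup>2\<close>.\<close>

lemma L2_on_set_integrable:
  fixes f :: "'a::euclidean_space \<Rightarrow> 'b::euclidean_space"
  assumes f: "L2_on S f" and S: "S \<in> sets borel" "emeasure lborel S < \<infinity>"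
  shows "set_integrable lborel S f"
  unfolding set_integrable_def
proof (rule Bochner_Integration.integrable_bound)
  show "integrable lborel (\<lambda>x. indicator S x + indicator S x *\<^sub>R (norm (f x))\<^sup>2)"
    using f S by (intro Bochner_Integration.integrable_add integrable_real_indicator) (auto simp: L2_on_def set_integrable_def)
  show "(\<lambda>x. indicator S x *\<^sub>R f x) \<in> borel_measurable lborel"
    using f by (simp add: L2_on_def set_borel_measurable_def)
  have "a \<le> 1 + a\<^sup>2" for a :: real
    using sum_squares_bound[of a 1] zero_le_power2[of a] unfolding power_one mult_1_right by linarith
  then show "AE x in lborel. norm (indicator S x *\<^sub>R f x) \<le> norm (indicator S x + indicator S x *\<^sub>R (norm (f x))\<^sup>2)"
    by (auto split: split_indicator)
qed

lemma L2_on_restrict: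
  fixes f :: "'a::euclidean_space \<Rightarrow> 'b::euclidean_space"
  assumes f: "L2_on UNIV f" and S: "S \<in> sets borel"
  shows "L2_on S f"
  unfolding L2_on_def set_borel_measurable_def set_integrable_def
  using integrable_mult_indicator[of S lborel, OF _ L2_on_UNIV_integrable[OF f]] S L2_on_UNIV_measurable[OF f] by simp

lemma L2_norm_nonneg: "0 \<le> L2_norm S f"
  by (simp add: L2_norm_def set_lebesgue_integral_def)

lemma L2_norm_sq_nn:
  assumes "L2_on S f"
  shows "(\<integral>\<^sup>+x\<in>S. ennreal ((norm (f x))\<^sup>2) \<partial>lborel) = ennreal ((L2_norm S f)\<^sup>2)"
proof -
  have "(\<integral>\<^sup>+x\<in>S. ennreal ((norm (f x))\<^sup>2) \<partial>lborel) = (\<integral>\<^sup>+x. ennreal (indicator S x *\<^sub>R (norm (f x))\<^sup>2) \<partial>lborel)"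
    by (intro nn_integral_cong) (auto split: split_indicator)
  also have "\<dots> = ennreal (LINT x|lborel. indicator S x *\<^sub>R (norm (f x))\<^sup>2)"
    using assms by (intro nn_integral_eq_integral) (auto simp: L2_on_def set_integrable_def)
  finally show ?thesis by (simp add: L2_norm_def set_lebesgue_integral_def)
qed

text \<open>Fatou's lemma in the form in which it is used: bounds on integrals pass to almost everywhere limits.\<close>

lemma fatou_bound:
  fixes g :: "nat \<Rightarrow> 'a \<Rightarrow> ennreal"
  assumes [measurable]: "\<And>m. g m \<in> borel_measurable M"
    and lim: "AE x in M. (\<lambda>m. g m x) \<longlonglongrightarrow> h x"
    and le: "\<And>m. (\<integral>\<^sup>+x. g m x \<partial>M) \<le> B m" and B: "B \<longlonglongrightarrow> A"
  shows "(\<integral>\<^sup>+x. h x \<partial>M) \<le> A"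
proof -
  have "(\<integral>\<^sup>+x. h x \<partial>M) = (\<integral>\<^sup>+x. liminf (\<lambda>m. g m x) \<partial>M)"
    using lim by (intro nn_integral_cong_AE) (auto elim!: eventually_mono simp: lim_imp_Liminf)
  also have "\<dots> \<le> liminf (\<lambda>m. \<integral>\<^sup>+x. g m x \<partial>M)"
    by (rule nn_integral_liminf) simp
  also have "\<dots> \<le> liminf B"
    by (intro Liminf_mono always_eventually allI le)
  also have "liminf B = A" using B by (simp add: lim_imp_Liminf)
  finally show ?thesis .
qed

text \<open>The triangle inequality for squares with a weight: letting the distance tend to zero first and \<open>e\<close> afterwards,
  bounds on weighted square integrals pass to mean-square limits with the sharp constant.\<close>

lemma norm_sq_weighted:
  fixes a b :: "'a::real_normed_vector"
  assumes e: "e > 0"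
  shows "(norm a)\<^sup>2 \<le> (1 + e) * (norm b)\<^sup>2 + (1 + 1/e) * (norm (a - b))\<^sup>2"
proof -
  let ?x = "norm b" and ?y = "norm (a - b)"
  have "norm a \<le> ?x + ?y" using norm_triangle_ineq[of b "a - b"] by simp
  then have "(norm a)\<^sup>2 \<le> (?x + ?y)\<^sup>2" by (intro power_mono) auto
  also have "\<dots> \<le> (1 + e) * ?x\<^sup>2 + (1 + 1/e) * ?y\<^sup>2"
  proof -
    have "0 \<le> (e * ?x - ?y)\<^sup>2 / e" using e by simp
    also have "\<dots> = (1 + e) * ?x\<^sup>2 + (1 + 1/e) * ?y\<^sup>2 - (?x + ?y)\<^sup>2"
      using e by (simp add: power2_eq_square field_simps)
    finally show ?thesis by simp
  qed
  finally show ?thesis .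
qed

lemma heat_flow_measurable:
  fixes F :: "real^'n \<Rightarrow> complex"
  assumes [measurable]: "F \<in> borel_measurable borel"
  shows "(\<lambda>p. heat_flow F (fst p) (snd p)) \<in> borel_measurable borel"
proof -
  have ms: "(\<lambda>q::(real \<times> (real^'n)) \<times> (real^'n). fst (fst q)) \<in> borel_measurable borel"
    "(\<lambda>q::(real \<times> (real^'n)) \<times> (real^'n). snd (fst q) - snd q) \<in> borel_measurable borel"
    "(\<lambda>q::(real \<times> (real^'n)) \<times> (real^'n). snd q) \<in> borel_measurable borel"
    by (intro borel_measurable_continuous_onI continuous_intros)+
  have "(\<lambda>p. LINT y|lborel. heat_kernel (fst p) (snd p - y) *\<^sub>R F y) \<in> borel_measurable (lborel :: (real \<times> (real^'n)) measure)"
    by (rule lborel.borel_measurable_lebesgue_integral)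
      (simp add: lborel_prod case_prod_beta', intro borel_measurable_scaleR heat_kernel_measurable ms measurable_compose[OF ms(3) assms])
  then show ?thesis by (simp add: heat_flow_def)
qed

lemma measurable_heat_flow_comp [measurable (raw)]:
  assumes "F \<in> borel_measurable borel" "f \<in> borel_measurable M" "g \<in> borel_measurable M"
  shows "(\<lambda>x. heat_flow F (f x) (g x)) \<in> borel_measurable M"
  using measurable_compose[OF borel_measurable_Pair[OF assms(2,3)] heat_flow_measurable[OF assms(1)]] by simp

lemma heat_kernel_sq_integrable:
  fixes x :: "real^'n"
  assumes t: "t > 0"
  shows "integrable lborel (\<lambda>y. (heat_kernel t (x - y))\<^sup>2)"
    "(LINT y|lborel. (heat_kernel t (x - y))\<^sup>2) = heat_kernel (2 * t) (0 :: real^'n)"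
proof -
  have e: "(heat_kernel t (x - y))\<^sup>2 = heat_kernel (2 * t) (0::real^'n) * heat_kernel (t / 2) (y - x)" for y
    unfolding power2_eq_square heat_kernel_commute[of t x y] heat_kernel_mult[OF t, of y x x] by (simp flip: scaleR_2)
  show "integrable lborel (\<lambda>y. (heat_kernel t (x - y))\<^sup>2)"
    "(LINT y|lborel. (heat_kernel t (x - y))\<^sup>2) = heat_kernel (2 * t) (0 :: real^'n)"
    unfolding e using heat_kernel_integral[of "t/2" x] t by simp_all
qed

lemma heat_flow_integrand_integrable:
  fixes F :: "real^'n \<Rightarrow> complex"
  assumes F: "L2_on UNIV F" and t: "t > 0"
  shows "integrable lborel (\<lambda>y. heat_kernel t (x - y) *\<^sub>R F y)"
proof (rule Bochner_Integration.integrable_bound)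
  note [measurable] = L2_on_UNIV_measurable[OF F]
  show "integrable lborel (\<lambda>y. (heat_kernel t (x - y))\<^sup>2 + (norm (F y))\<^sup>2)"
    by (intro Bochner_Integration.integrable_add heat_kernel_sq_integrable t L2_on_UNIV_integrable F)
  show "(\<lambda>y. heat_kernel t (x - y) *\<^sub>R F y) \<in> borel_measurable lborel" by measurable
  have "heat_kernel t (x - y) * norm (F y) \<le> (heat_kernel t (x - y))\<^sup>2 + (norm (F y))\<^sup>2" for y
    using sum_squares_bound[of "heat_kernel t (x - y)" "norm (F y)"]
      mult_nonneg_nonneg[OF heat_kernel_nonneg norm_ge_zero, of t "x - y" "F y"] by linarith
  then show "AE y in lborel. norm (heat_kernel t (x - y) *\<^sub>R F y) \<le> norm ((heat_kernel t (x - y))\<^sup>2 + (norm (F y))\<^sup>2)"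
    by (auto simp: heat_kernel_nonneg)
qed

lemma norm_integral_le_nn: "ennreal (norm (integral\<^sup>L M f)) \<le> (\<integral>\<^sup>+x. ennreal (norm (f x)) \<partial>M)"
  by (cases "integrable M f") (auto simp: integral_norm_bound_ennreal not_integrable_integral_eq)

text \<open>Jensen's inequality for the probability density \<open>heat_kernel t (x - \<cdot>)\<close>, followed by Tonelli's theorem.\<close>

lemma heat_flow_contraction:
  fixes f :: "real^'n \<Rightarrow> complex"
  assumes [measurable]: "f \<in> borel_measurable borel" and t: "t > 0"
  shows "(\<integral>\<^sup>+x. ennreal ((norm (heat_flow f t x))\<^sup>2) \<partial>lborel) \<le> (\<integral>\<^sup>+x. ennreal ((norm (f x))\<^sup>2) \<partial>lborel)"
proof -
  let ?H = "\<lambda>x y. heat_kernel t (x - y)"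
  have "ennreal ((norm (heat_flow f t x))\<^sup>2) \<le> (\<integral>\<^sup>+y. ennreal (?H x y * (norm (f y))\<^sup>2) \<partial>lborel)" for x
  proof -
    let ?a = "\<lambda>y. ennreal (sqrt (?H x y))" and ?b = "\<lambda>y. ennreal (sqrt (?H x y) * norm (f y))"
    have "ennreal (norm (heat_flow f t x)) \<le> (\<integral>\<^sup>+y. ?a y * ?b y \<partial>lborel)"
      unfolding heat_flow_def
      by (rule order_trans[OF norm_integral_le_nn])
        (auto intro!: nn_integral_mono simp: heat_kernel_nonneg mult.assoc[symmetric] simp flip: ennreal_mult)
    then have "ennreal (norm (heat_flow f t x)) ^ 2 \<le> (\<integral>\<^sup>+y. ?a y * ?b y \<partial>lborel)\<^sup>2"
      by (rule power_mono) simp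
    also have "\<dots> \<le> (\<integral>\<^sup>+y. (?a y)\<^sup>2 \<partial>lborel) * (\<integral>\<^sup>+y. (?b y)\<^sup>2 \<partial>lborel)"
      by (rule Cauchy_Schwarz_nn_integral) measurable
    also have "(\<lambda>y. (?a y)\<^sup>2) = (\<lambda>y. ennreal (?H x y))"
      by (auto simp: ennreal_power heat_kernel_nonneg)
    also have "(\<lambda>y. (?b y)\<^sup>2) = (\<lambda>y. ennreal (?H x y * (norm (f y))\<^sup>2))"
      by (auto simp: ennreal_power heat_kernel_nonneg power_mult_distrib)
    finally show ?thesis using t by (simp add: heat_kernel_integral ennreal_power)
  qed
  then have "(\<integral>\<^sup>+x. ennreal ((norm (heat_flow f t x))\<^sup>2) \<partial>lborel)
      \<le> (\<integral>\<^sup>+x. (\<integral>\<^sup>+y. ennreal (?H x y * (norm (f y))\<^sup>2) \<partial>lborel) \<partial>lborel)"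
    by (rule nn_integral_mono)
  also have "\<dots> = (\<integral>\<^sup>+y. (\<integral>\<^sup>+x. ennreal (?H x y * (norm (f y))\<^sup>2) \<partial>lborel) \<partial>lborel)"
    by (rule lborel_pair.Fubini') measurable
  also have "\<dots> = (\<integral>\<^sup>+y. ennreal ((norm (f y))\<^sup>2) \<partial>lborel)"
    using t by (simp add: ennreal_mult heat_kernel_nonneg nn_integral_multc heat_kernel_integral)
  finally show ?thesis .
qed

text \<open>For the truncations \<open>F\<^sub>n\<close> of \<open>F\<close> to balls with transforms \<open>u\<^sub>n\<close>, Parseval gives
  \<open>(2 \<pi>)\<^sup>d \<parallel>e\<^sup>t\<^sup>\<Delta> F\<^sub>n\<parallel>\<^sup>2 = \<integral> \<rho> |u\<^sub>n|\<^sup>2\<close> with \<open>\<rho>(\<omega>) = exp (- 2 t |\<omega>|\<^sup>2)\<close>. The right-hand side tends to \<open>\<integral> \<rho> |g|\<^sup>2\<close>, where \<open>g\<close> is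
  the transform of \<open>F\<close>; on the support of \<open>g\<close> the weight is at most \<open>exp (- 2 \<omega>0\<^sup>2 t)\<close>. The missing bound
  \<open>\<parallel>g\<parallel>\<^sup>2 \<le> (2 \<pi>)\<^sup>d \<parallel>F\<parallel>\<^sup>2\<close> comes from the same identity as the time tends to zero.\<close>

lemma heat_flow_spectral_decay:
  fixes F :: "real^'n \<Rightarrow> complex"
  assumes F: "F \<in> spectral_gap_space \<omega>0" and w0: "\<omega>0 \<ge> 0" and t: "t > 0"
  shows "(\<integral>\<^sup>+x. ennreal ((norm (heat_flow F t x))\<^sup>2) \<partial>lborel)
      \<le> ennreal (exp (- 2 * \<omega>0\<^sup>2 * t) * (L2_norm UNIV F)\<^sup>2)"
proof -
  obtain g where FL: "L2_on UNIV F" and hf: "has_L2_fourier F g"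
    and g0: "AE \<omega> in lborel. norm \<omega> \<le> \<omega>0 \<longrightarrow> g \<omega> = 0"
    using F by (auto simp: spectral_gap_space_def)
  define c where "c = (2 * pi) ^ CARD('n)"
  have c: "c > 0" by (simp add: c_def)
  define Fn where "Fn n x = indicator (cball 0 (real n)) x *\<^sub>R F x" for n x
  define u where "u n = fourier_integral (Fn n)" for n
  define \<delta> where "\<delta> n = (L2_norm UNIV (\<lambda>x. u n x - g x))\<^sup>2" for n
  define N where "N = (L2_norm UNIV F)\<^sup>2"
  define \<rho> where "\<rho> \<omega> = exp (- 2 * t * (norm \<omega>)\<^sup>2)" for \<omega> :: "real^'n"
  define E where "E = exp (- 2 * \<omega>0\<^sup>2 * t)"
  have gL: "L2_on UNIV g" and ugL: "\<And>n. L2_on UNIV (\<lambda>x. u n x - g x)" and \<delta>0: "\<delta> \<longlonglongrightarrow> 0"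
    using hf tendsto_power[of "\<lambda>n. L2_norm UNIV (\<lambda>x. u n x - g x)" 0 sequentially 2]
    by (auto simp: has_L2_fourier_def L2_tendsto_def u_def Fn_def[abs_def] \<delta>_def[abs_def])
  have [measurable]: "F \<in> borel_measurable borel" "g \<in> borel_measurable borel"
    using FL gL by (auto dest: L2_on_UNIV_measurable)
  have "cball (0::real^'n) (real n) \<in> sets borel" for n by simp
  then have Fnm[measurable]: "Fn n \<in> borel_measurable borel" for n
    unfolding Fn_def by measurable
  have "(\<lambda>x. (u n x - g x) + g x) \<in> borel_measurable borel" for n
    by (intro borel_measurable_add L2_on_UNIV_measurable ugL gL)
  then have um[measurable]: "u n \<in> borel_measurable borel" for n by simp
  have Fni: "integrable lborel (Fn n)" for n
    using L2_on_set_integrable[OF L2_on_restrict[OF FL, of "cball 0 (real n)"]] emeasure_bounded_finite[OF bounded_cball, of "0::real^'n" "real n"]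
    by (simp add: set_integrable_def Fn_def[abs_def])
  have NF: "(\<integral>\<^sup>+x. ennreal ((norm (F x))\<^sup>2) \<partial>lborel) = ennreal N"
    using L2_norm_sq_nn[OF FL] by (simp add: N_def)
  have NFn: "(\<integral>\<^sup>+x. ennreal ((norm (Fn n x))\<^sup>2) \<partial>lborel) \<le> ennreal N" for n
    unfolding NF[symmetric] by (intro nn_integral_mono) (auto simp: Fn_def split: split_indicator)
  have \<delta>: "(\<integral>\<^sup>+x. ennreal ((norm (u n x - g x))\<^sup>2) \<partial>lborel) = ennreal (\<delta> n)" for n
    using L2_norm_sq_nn[OF ugL] by (simp add: \<delta>_def)
  have parseval: "(\<integral>\<^sup>+\<omega>. ennreal (exp (- 2 * s * (norm \<omega>)\<^sup>2) * (norm (u n \<omega>))\<^sup>2) \<partial>lborel)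
      = ennreal c * (\<integral>\<^sup>+x. ennreal ((norm (heat_flow (Fn n) s x))\<^sup>2) \<partial>lborel)" if s: "s > 0" for s n
    using heat_flow_parseval[OF Fni s, of n] c unfolding u_def c_def[symmetric]
    by (subst (1 2) nn_integral_eq_integral) (auto simp flip: ennreal_mult)
  (* Parseval at the times 1/(m+1) together with the contraction property; Fatou removes the weight as m grows. *)
  have a: "(\<integral>\<^sup>+\<omega>. ennreal ((norm (u n \<omega>))\<^sup>2) \<partial>lborel) \<le> ennreal (c * N)" for n
  proof (rule fatou_bound)
    show "(\<integral>\<^sup>+\<omega>. ennreal (exp (- 2 * inverse (real (Suc m)) * (norm \<omega>)\<^sup>2) * (norm (u n \<omega>))\<^sup>2) \<partial>lborel) \<le> ennreal (c * N)" for m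
    proof (subst parseval)
      have "(\<integral>\<^sup>+x. ennreal ((norm (heat_flow (Fn n) (inverse (real (Suc m))) x))\<^sup>2) \<partial>lborel) \<le> ennreal N"
        by (rule order_trans[OF heat_flow_contraction NFn]) auto
      then show "ennreal c * (\<integral>\<^sup>+x. ennreal ((norm (heat_flow (Fn n) (inverse (real (Suc m))) x))\<^sup>2) \<partial>lborel) \<le> ennreal (c * N)"
        using c by (simp add: ennreal_mult N_def mult_left_mono)
    qed simp
    have "(\<lambda>m. exp (- 2 * inverse (real (Suc m)) * (norm \<omega>)\<^sup>2) * (norm (u n \<omega>))\<^sup>2) \<longlonglongrightarrow> exp (- 2 * 0 * (norm \<omega>)\<^sup>2) * (norm (u n \<omega>))\<^sup>2" for \<omega>
      by (intro tendsto_intros LIMSEQ_inverse_real_of_nat)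
    then show "AE \<omega> in lborel. (\<lambda>m. ennreal (exp (- 2 * inverse (real (Suc m)) * (norm \<omega>)\<^sup>2) * (norm (u n \<omega>))\<^sup>2)) \<longlonglongrightarrow> ennreal ((norm (u n \<omega>))\<^sup>2)"
      by (intro AE_I2 tendsto_ennrealI) simp
  qed auto
  have wt: "(\<integral>\<^sup>+\<omega>. ennreal (r \<omega> * (norm (p \<omega>))\<^sup>2) \<partial>lborel) \<le>
      ennreal (1 + e) * (\<integral>\<^sup>+\<omega>. ennreal (r \<omega> * (norm (q \<omega>))\<^sup>2) \<partial>lborel) + ennreal (1 + 1/e) * (\<integral>\<^sup>+\<omega>. ennreal ((norm (p \<omega> - q \<omega>))\<^sup>2) \<partial>lborel)"
    if e: "e > 0" and r: "\<And>\<omega>. 0 \<le> r \<omega>" "\<And>\<omega>. r \<omega> \<le> 1" and [measurable]: "p \<in> borel_measurable borel" "q \<in> borel_measurable borel" "r \<in> borel_measurable borel"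
    for e r and p q :: "real^'n \<Rightarrow> complex"
  proof -
    have "r \<omega> * (norm (p \<omega>))\<^sup>2 \<le> (1 + e) * (r \<omega> * (norm (q \<omega>))\<^sup>2) + (1 + 1/e) * (norm (p \<omega> - q \<omega>))\<^sup>2" for \<omega>
    proof -
      have "r \<omega> * (norm (p \<omega>))\<^sup>2 \<le> r \<omega> * ((1 + e) * (norm (q \<omega>))\<^sup>2 + (1 + 1/e) * (norm (p \<omega> - q \<omega>))\<^sup>2)"
        by (intro mult_left_mono norm_sq_weighted e r)
      also have "\<dots> = (1 + e) * (r \<omega> * (norm (q \<omega>))\<^sup>2) + r \<omega> * ((1 + 1/e) * (norm (p \<omega> - q \<omega>))\<^sup>2)"
        by (simp add: distrib_left mult.left_commute)
      also have "r \<omega> * ((1 + 1/e) * (norm (p \<omega> - q \<omega>))\<^sup>2) \<le> 1 * ((1 + 1/e) * (norm (p \<omega> - q \<omega>))\<^sup>2)"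
        using e by (intro mult_right_mono r) auto
      finally show ?thesis by simp
    qed
    then have "(\<integral>\<^sup>+\<omega>. ennreal (r \<omega> * (norm (p \<omega>))\<^sup>2) \<partial>lborel) \<le> (\<integral>\<^sup>+\<omega>. ennreal (1 + e) * ennreal (r \<omega> * (norm (q \<omega>))\<^sup>2) + ennreal (1 + 1/e) * ennreal ((norm (p \<omega> - q \<omega>))\<^sup>2) \<partial>lborel)"
      using e r by (intro nn_integral_mono) (simp flip: ennreal_mult ennreal_plus)
    also have "\<dots> = ennreal (1 + e) * (\<integral>\<^sup>+\<omega>. ennreal (r \<omega> * (norm (q \<omega>))\<^sup>2) \<partial>lborel) + ennreal (1 + 1/e) * (\<integral>\<^sup>+\<omega>. ennreal ((norm (p \<omega> - q \<omega>))\<^sup>2) \<partial>lborel)"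
      by (subst nn_integral_add) (auto simp: nn_integral_cmult)
    finally show ?thesis .
  qed
  have limB: "(\<lambda>n. ennreal (A + B * \<delta> n)) \<longlonglongrightarrow> ennreal A" for A B
  proof -
    have "(\<lambda>n. A + B * \<delta> n) \<longlonglongrightarrow> A + B * 0" by (intro tendsto_intros \<delta>0)
    then show ?thesis by (intro tendsto_ennrealI) simp
  qed
  have \<delta>nn: "0 \<le> \<delta> n" for n by (simp add: \<delta>_def)
  have N0: "0 \<le> N" by (simp add: N_def)
  have b: "(\<integral>\<^sup>+\<omega>. ennreal ((norm (g \<omega>))\<^sup>2) \<partial>lborel) \<le> ennreal ((1 + e) * (c * N))" if e: "e > 0" for e
  proof (rule fatou_bound)
    show "(\<integral>\<^sup>+\<omega>. ennreal ((norm (g \<omega>))\<^sup>2) \<partial>lborel) \<le> ennreal ((1 + e) * (c * N) + (1 + 1/e) * \<delta> n)" for n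
    proof -
      have "(\<integral>\<^sup>+\<omega>. ennreal ((norm (g \<omega>))\<^sup>2) \<partial>lborel) \<le> ennreal (1 + e) * (\<integral>\<^sup>+\<omega>. ennreal ((norm (u n \<omega>))\<^sup>2) \<partial>lborel) + ennreal (1 + 1/e) * ennreal (\<delta> n)"
        using wt[OF e, of "\<lambda>_. 1" g "u n"] by (simp add: norm_minus_commute[of "g _"] \<delta>)
      also have "\<dots> \<le> ennreal (1 + e) * ennreal (c * N) + ennreal (1 + 1/e) * ennreal (\<delta> n)"
        by (intro add_right_mono mult_left_mono a) auto
      finally show ?thesis using e c N0 \<delta>nn by (simp add: ennreal_mult ennreal_plus)
    qed
  qed (use limB in auto)
  have flow_lim: "(\<lambda>n. heat_flow (Fn n) t x) \<longlonglongrightarrow> heat_flow F t x" for x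
    unfolding heat_flow_def
  proof (rule integral_dominated_convergence)
    show "integrable lborel (\<lambda>y. norm (heat_kernel t (x - y) *\<^sub>R F y))"
      by (intro integrable_norm heat_flow_integrand_integrable FL t)
    show "AE y in lborel. norm (heat_kernel t (x - y) *\<^sub>R Fn n y) \<le> norm (heat_kernel t (x - y) *\<^sub>R F y)" for n
      by (auto simp: Fn_def split: split_indicator)
    have "(\<lambda>n. Fn n y) \<longlonglongrightarrow> F y" for y
    proof (rule tendsto_eventually)
      obtain n0 where "norm y \<le> real n0" using real_arch_simple by blast
      then show "\<forall>\<^sub>F n in sequentially. Fn n y = F y"
        by (intro eventually_sequentiallyI[of n0]) (auto simp: Fn_def)
    qed
    then show "AE y in lborel. (\<lambda>n. heat_kernel t (x - y) *\<^sub>R Fn n y) \<longlonglongrightarrow> heat_kernel t (x - y) *\<^sub>R F y"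
      by (intro AE_I2 tendsto_intros)
  qed measurable
  have main: "(\<integral>\<^sup>+x. ennreal ((norm (heat_flow F t x))\<^sup>2) \<partial>lborel) \<le> ennreal ((1 + e) * (1 + e) * (E * N))" if e: "e > 0" for e
  proof (rule fatou_bound)
    show "AE x in lborel. (\<lambda>n. ennreal ((norm (heat_flow (Fn n) t x))\<^sup>2)) \<longlonglongrightarrow> ennreal ((norm (heat_flow F t x))\<^sup>2)"
      by (intro AE_I2 tendsto_ennrealI tendsto_intros flow_lim)
    show "(\<lambda>n. ennreal ((1 + e) * (1 + e) * (E * N) + (1 + 1/e) / c * \<delta> n)) \<longlonglongrightarrow> ennreal ((1 + e) * (1 + e) * (E * N))"
      by (rule limB)
    fix n
    have "(\<integral>\<^sup>+\<omega>. ennreal (\<rho> \<omega> * (norm (u n \<omega>))\<^sup>2) \<partial>lborel) \<le>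
        ennreal (1 + e) * (\<integral>\<^sup>+\<omega>. ennreal (\<rho> \<omega> * (norm (g \<omega>))\<^sup>2) \<partial>lborel) + ennreal (1 + 1/e) * ennreal (\<delta> n)"
      unfolding \<delta>[symmetric] using t by (intro wt e) (auto simp: \<rho>_def)
    also have "(\<integral>\<^sup>+\<omega>. ennreal (\<rho> \<omega> * (norm (g \<omega>))\<^sup>2) \<partial>lborel) \<le> (\<integral>\<^sup>+\<omega>. ennreal E * ennreal ((norm (g \<omega>))\<^sup>2) \<partial>lborel)"
    proof (rule nn_integral_mono_AE)
      show "AE \<omega> in lborel. ennreal (\<rho> \<omega> * (norm (g \<omega>))\<^sup>2) \<le> ennreal E * ennreal ((norm (g \<omega>))\<^sup>2)"
        using g0
      proof eventually_elim
        case (elim \<omega>)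
        show ?case
        proof (cases "norm \<omega> \<le> \<omega>0")
          case False
          then have "\<omega>0\<^sup>2 \<le> (norm \<omega>)\<^sup>2" using w0 by (intro power_mono) auto
          then have "\<rho> \<omega> \<le> E" using t by (simp add: \<rho>_def E_def mult.commute)
          then show ?thesis by (simp add: E_def flip: ennreal_mult) (intro ennreal_leI mult_right_mono, auto simp: E_def)
        qed (use elim in simp)
      qed
    qed
    also have "\<dots> = ennreal E * (\<integral>\<^sup>+\<omega>. ennreal ((norm (g \<omega>))\<^sup>2) \<partial>lborel)"
      by (rule nn_integral_cmult) measurable
    also have "\<dots> \<le> ennreal E * ennreal ((1 + e) * (c * N))"
      by (intro mult_left_mono b e) auto
    finally have "ennreal c * (\<integral>\<^sup>+x. ennreal ((norm (heat_flow (Fn n) t x))\<^sup>2) \<partial>lborel)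
        \<le> ennreal (1 + e) * (ennreal E * ennreal ((1 + e) * (c * N))) + ennreal (1 + 1/e) * ennreal (\<delta> n)"
      unfolding \<rho>_def parseval[OF t] by (simp add: mult_left_mono add_right_mono)
    also have "\<dots> = ennreal c * ennreal ((1 + e) * (1 + e) * (E * N) + (1 + 1/e) / c * \<delta> n)"
      using e c N0 \<delta>nn by (simp add: E_def field_simps flip: ennreal_mult ennreal_plus)
    finally show "(\<integral>\<^sup>+x. ennreal ((norm (heat_flow (Fn n) t x))\<^sup>2) \<partial>lborel) \<le> ennreal ((1 + e) * (1 + e) * (E * N) + (1 + 1/e) / c * \<delta> n)"
      using c by (subst (asm) ennreal_mult_le_mult_iff) auto
  qed (use t in measurable)
  have "(\<integral>\<^sup>+x. ennreal ((norm (heat_flow F t x))\<^sup>2) \<partial>lborel) \<le> ennreal (E * N)"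
  proof (rule tendsto_lowerbound)
    have "(\<lambda>k. ennreal ((1 + inverse (real (Suc k))) * (1 + inverse (real (Suc k))) * (E * N))) \<longlonglongrightarrow> ennreal ((1 + 0) * (1 + 0) * (E * N))"
      by (intro tendsto_ennrealI tendsto_intros LIMSEQ_inverse_real_of_nat)
    then show "(\<lambda>k. ennreal ((1 + inverse (real (Suc k))) * (1 + inverse (real (Suc k))) * (E * N))) \<longlonglongrightarrow> ennreal (E * N)" by simp
    show "\<forall>\<^sub>F k in sequentially. (\<integral>\<^sup>+x. ennreal ((norm (heat_flow F t x))\<^sup>2) \<partial>lborel) \<le> ennreal ((1 + inverse (real (Suc k))) * (1 + inverse (real (Suc k))) * (E * N))"
      by (intro always_eventually allI main) simp
  qed simp
  then show ?thesis by (simp add: E_def N_def)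
qed

section \<open>The time tail of the heat flow\<close>

lemma nn_integral_exp_tail:
  fixes a :: real
  assumes a: "a > 0"
  shows "(\<integral>\<^sup>+t\<in>{T<..}. ennreal (exp (- a * t)) \<partial>lborel) = ennreal (exp (- a * T) / a)"
proof -
  have "(\<integral>\<^sup>+t\<in>{T<..}. ennreal (exp (- a * t)) \<partial>lborel) = (\<integral>\<^sup>+t\<in>{T..}. ennreal (exp (- a * t)) \<partial>lborel)"
    using AE_lborel_singleton[of T] by (intro nn_integral_cong_AE) (auto elim!: eventually_mono split: split_indicator)
  also have "\<dots> = ennreal (0 - (- exp (- a * T) / a))"
  proof (rule nn_integral_FTC_atLeast)
    show "((\<lambda>x. - exp (- a * x) / a) has_real_derivative exp (- a * x)) (at x)" for x
      using a by (auto intro!: derivative_eq_intros)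
    have "((\<lambda>x. exp (- a * x)) \<longlongrightarrow> 0) at_top"
      using a by real_asymp
    then show "((\<lambda>x. - exp (- a * x) / a) \<longlongrightarrow> 0) at_top"
      using tendsto_divide[of "\<lambda>x. - exp (- a * x)" 0 at_top "\<lambda>_. a" a] tendsto_minus[of "\<lambda>x. exp (- a * x)" 0] a by auto
  qed auto
  finally show ?thesis by simp
qed

text \<open>Minkowski's integral inequality with an exponentially decaying integrand, in the form of Cauchy-Schwarz with the
  weights \<open>exp (\<plusminus> a t / 2)\<close>. For \<open>a = \<omega>0\<^sup>2\<close> the two resulting factors are equal, so no constant is lost.\<close>

lemma heat_flow_tail:
  fixes F :: "real^'n \<Rightarrow> complex"
  assumes F: "F \<in> spectral_gap_space \<omega>0" and w0: "\<omega>0 > 0" and T: "T \<ge> 0"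
  shows "(\<integral>\<^sup>+x. (\<integral>\<^sup>+t\<in>{T<..}. ennreal (norm (heat_flow F t x)) \<partial>lborel)\<^sup>2 \<partial>lborel)
     \<le> ennreal ((1 / \<omega>0\<^sup>2 * exp (- \<omega>0\<^sup>2 * T) * L2_norm UNIV F)\<^sup>2)"
proof -
  define a where "a = \<omega>0\<^sup>2"
  have a: "a > 0" using w0 by (simp add: a_def)
  define N where "N = (L2_norm UNIV F)\<^sup>2"
  have Fm[measurable]: "F \<in> borel_measurable borel"
    using F by (auto simp: spectral_gap_space_def L2_on_UNIV_measurable)
  let ?A = "\<lambda>t. ennreal (exp (- a * t / 2)) * indicator {T<..} t"
  let ?B = "\<lambda>x t. ennreal (exp (a * t / 2) * norm (heat_flow F t x)) * indicator {T<..} t"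
  let ?C = "\<lambda>x t. ennreal (exp (a * t) * (norm (heat_flow F t x))\<^sup>2) * indicator {T<..} t"
  have CS: "(\<integral>\<^sup>+t\<in>{T<..}. ennreal (norm (heat_flow F t x)) \<partial>lborel)\<^sup>2 \<le> ennreal (exp (- a * T) / a) * (\<integral>\<^sup>+t. ?C x t \<partial>lborel)" for x
  proof -
    have "ennreal (norm (heat_flow F t x)) * indicator {T<..} t = ?A t * ?B x t" for t
      by (simp add: exp_minus flip: ennreal_mult split: split_indicator)
    then have "(\<integral>\<^sup>+t\<in>{T<..}. ennreal (norm (heat_flow F t x)) \<partial>lborel)\<^sup>2 \<le> (\<integral>\<^sup>+t. (?A t)\<^sup>2 \<partial>lborel) * (\<integral>\<^sup>+t. (?B x t)\<^sup>2 \<partial>lborel)"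
      by (simp only:) (rule Cauchy_Schwarz_nn_integral; measurable)
    also have "(\<lambda>t. (?A t)\<^sup>2) = (\<lambda>t. ennreal (exp (- a * t)) * indicator {T<..} t)"
      by (auto simp: fun_eq_iff ennreal_power exp_double[symmetric] split: split_indicator)
    also have "(\<lambda>t. (?B x t)\<^sup>2) = ?C x"
      by (auto simp: fun_eq_iff ennreal_power power_mult_distrib exp_double[symmetric] split: split_indicator)
    finally show ?thesis unfolding nn_integral_exp_tail[OF a] .
  qed
  have "(\<integral>\<^sup>+x. (\<integral>\<^sup>+t\<in>{T<..}. ennreal (norm (heat_flow F t x)) \<partial>lborel)\<^sup>2 \<partial>lborel)
     \<le> (\<integral>\<^sup>+x. ennreal (exp (- a * T) / a) * (\<integral>\<^sup>+t. ?C x t \<partial>lborel) \<partial>lborel)"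
    by (intro nn_integral_mono CS)
  also have "\<dots> = ennreal (exp (- a * T) / a) * (\<integral>\<^sup>+x. (\<integral>\<^sup>+t. ?C x t \<partial>lborel) \<partial>lborel)"
    by (rule nn_integral_cmult) measurable
  also have "(\<integral>\<^sup>+x. (\<integral>\<^sup>+t. ?C x t \<partial>lborel) \<partial>lborel) = (\<integral>\<^sup>+t. (\<integral>\<^sup>+x. ?C x t \<partial>lborel) \<partial>lborel)"
    by (rule lborel_pair.Fubini') measurable
  also have "\<dots> \<le> (\<integral>\<^sup>+t. ennreal N * (ennreal (exp (- a * t)) * indicator {T<..} t) \<partial>lborel)"
  proof (rule nn_integral_mono)
    fix t :: real
    show "(\<integral>\<^sup>+x. ?C x t \<partial>lborel) \<le> ennreal N * (ennreal (exp (- a * t)) * indicator {T<..} t)"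
    proof (cases "t > T")
      case True
      then have "t > 0" using T by simp
      have "(\<integral>\<^sup>+x. ?C x t \<partial>lborel) = ennreal (exp (a * t)) * (\<integral>\<^sup>+x. ennreal ((norm (heat_flow F t x))\<^sup>2) \<partial>lborel)"
        using True by (subst nn_integral_cmult[symmetric]) (auto simp: ennreal_mult)
      also have "\<dots> \<le> ennreal (exp (a * t)) * ennreal (exp (- 2 * \<omega>0\<^sup>2 * t) * N)"
        unfolding N_def using w0 \<open>t > 0\<close> by (intro mult_left_mono heat_flow_spectral_decay F) auto
      also have "\<dots> = ennreal N * ennreal (exp (- a * t))"
        by (simp add: N_def a_def mult.left_commute exp_add[symmetric] flip: ennreal_mult)
      finally show ?thesis using True by simp
    qed simp
  qed
  also have "\<dots> = ennreal N * ennreal (exp (- a * T) / a)"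
    unfolding nn_integral_exp_tail[OF a, symmetric] by (rule nn_integral_cmult) measurable
  finally have "(\<integral>\<^sup>+x. (\<integral>\<^sup>+t\<in>{T<..}. ennreal (norm (heat_flow F t x)) \<partial>lborel)\<^sup>2 \<partial>lborel)
      \<le> ennreal (exp (- a * T) / a) * (ennreal N * ennreal (exp (- a * T) / a))"
    by (simp add: mult_left_mono)
  also have "\<dots> = ennreal ((1 / \<omega>0\<^sup>2 * exp (- \<omega>0\<^sup>2 * T) * L2_norm UNIV F)\<^sup>2)"
    using a by (simp add: N_def a_def power2_eq_square flip: ennreal_mult)
  finally show ?thesis .
qed

text \<open>The tail estimate from time \<open>0\<close> on; it makes the pointwise time integral defining \<open>w_infinity\<close> meaningful almost
  everywhere.\<close>

lemma heat_flow_time_integrable: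
  fixes F :: "real^'n \<Rightarrow> complex"
  assumes F: "F \<in> spectral_gap_space \<omega>0" and w0: "\<omega>0 > 0"
  shows "AE x in lborel. set_integrable lborel {0<..} (\<lambda>t. heat_flow F t x)"
proof -
  have Fm[measurable]: "F \<in> borel_measurable borel"
    using F by (auto simp: spectral_gap_space_def L2_on_UNIV_measurable)
  have "(\<integral>\<^sup>+x. (\<integral>\<^sup>+t\<in>{0<..}. ennreal (norm (heat_flow F t x)) \<partial>lborel)\<^sup>2 \<partial>lborel) \<noteq> \<infinity>"
    using heat_flow_tail[OF F w0, of 0] by (auto simp: top_unique)
  then have "AE x in lborel. (\<integral>\<^sup>+t\<in>{0<..}. ennreal (norm (heat_flow F t x)) \<partial>lborel)\<^sup>2 \<noteq> \<infinity>"
    by (intro nn_integral_PInf_AE) measurable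
  then show ?thesis
  proof eventually_elim
    case (elim x)
    show ?case unfolding set_integrable_def
    proof (rule integrableI_bounded)
      show "(\<lambda>t. indicator {0<..} t *\<^sub>R heat_flow F t x) \<in> borel_measurable lborel" by measurable
      have "(\<integral>\<^sup>+t. ennreal (norm (indicator {0<..} t *\<^sub>R heat_flow F t x)) \<partial>lborel) = (\<integral>\<^sup>+t\<in>{0<..}. ennreal (norm (heat_flow F t x)) \<partial>lborel)"
        by (intro nn_integral_cong) (auto split: split_indicator)
      also have "\<dots> < \<infinity>" using elim by (auto simp: less_top power2_eq_square ennreal_mult_eq_top_iff)
      finally show "(\<integral>\<^sup>+t. ennreal (norm (indicator {0<..} t *\<^sub>R heat_flow F t x)) \<partial>lborel) < \<infinity>" .
    qed
  qed
qed

section \<open>The Dirichlet heat kernel of an interval by reflections\<close>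

definition image_sign :: "int \<Rightarrow> real" where
  "image_sign m = (if even m then 1 else -1)"

text \<open>The \<open>m\<close>-th image of \<open>a\<close> under the group generated by the reflections in \<open>R\<close> and \<open>-R\<close>;
  \<open>image_sign m\<close> is its slope.\<close>

definition image_point :: "real \<Rightarrow> int \<Rightarrow> real \<Rightarrow> real" where
  "image_point R m a = 2 * R * real_of_int m + image_sign m * a"

text \<open>The Dirichlet heat kernel of \<open>(-R, R)\<close>: the odd periodization of the heat kernel of the line. The sum over all
  integers is an integral for the counting measure, so that Fubini's theorem applies to it.\<close>

definition image_kernel :: "real \<Rightarrow> real \<Rightarrow> real \<Rightarrow> real \<Rightarrow> real" where
  "image_kernel R t a b = (\<integral>m. image_sign m * heat_kernel1 t (image_point R m a - b) \<partial>count_space UNIV)"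

text \<open>The eigenfunctions of the Dirichlet Laplacian on \<open>(-R, R)\<close>, with eigenvalue \<open>(k \<pi> / 2 R)\<^sup>2\<close>. The index \<open>0\<close> gives the
  zero function.\<close>

definition sine_mode :: "real \<Rightarrow> nat \<Rightarrow> real \<Rightarrow> real" where
  "sine_mode R k a = sin (real k * pi * (a + R) / (2 * R))"

lemma abs_image_sign[simp]: "\<bar>image_sign m\<bar> = 1"
  by (simp add: image_sign_def)

lemma heat_kernel1_measurable[measurable]: "heat_kernel1 t \<in> borel_measurable borel"
  unfolding heat_kernel1_def[abs_def] by measurable

text \<open>The images of \<open>(-R, R)\<close> are disjoint and cover the line up to the odd multiples of \<open>R\<close>.\<close>

lemma image_tiling_nn:
  assumes R: "R > 0" and [measurable]: "g \<in> borel_measurable borel"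
  shows "(\<integral>\<^sup>+m. (\<integral>\<^sup>+a\<in>{-R<..<R}. g (image_point R m a) \<partial>lborel) \<partial>count_space UNIV) = (\<integral>\<^sup>+x. g x \<partial>lborel)"
proof -
  let ?I = "\<lambda>m::int. {2 * R * real_of_int m - R <..< 2 * R * real_of_int m + R}"
  have "(\<integral>\<^sup>+a\<in>{-R<..<R}. g (image_point R m a) \<partial>lborel) = (\<integral>\<^sup>+x. g x * indicator (?I m) x \<partial>lborel)" for m
  proof -
    have "indicator (?I m) (2 * R * real_of_int m + image_sign m * a) = (indicator {-R<..<R} a :: ennreal)" for a
      by (auto simp: image_sign_def indicator_def)
    moreover have "(\<integral>\<^sup>+x. g x * indicator (?I m) x \<partial>lborel)
        = ennreal \<bar>image_sign m\<bar> * (\<integral>\<^sup>+a. g (2 * R * real_of_int m + image_sign m * a) * indicator (?I m) (2 * R * real_of_int m + image_sign m * a) \<partial>lborel)"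
      by (rule nn_integral_real_affine) (auto simp: image_sign_def)
    ultimately show ?thesis by (simp add: image_point_def)
  qed
  then have "(\<integral>\<^sup>+m. (\<integral>\<^sup>+a\<in>{-R<..<R}. g (image_point R m a) \<partial>lborel) \<partial>count_space UNIV)
      = (\<integral>\<^sup>+x. (\<integral>\<^sup>+m. g x * indicator (?I m) x \<partial>count_space UNIV) \<partial>lborel)"
    by (subst nn_integral_count_space_nn_integral) auto
  also have "\<dots> = (\<integral>\<^sup>+x. g x \<partial>lborel)"
  proof (rule nn_integral_cong_AE)
    have "range (\<lambda>m::int. 2 * R * real_of_int m + R) \<in> null_sets lborel"
      by (intro countable_imp_null_set_lborel) auto
    from AE_not_in[OF this]
    show "AE x in lborel. (\<integral>\<^sup>+m. g x * indicator (?I m) x \<partial>count_space UNIV) = g x"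
    proof eventually_elim
      case (elim x)
      (* m0 is the index of the only tile that contains x. *)
      define m0 where "m0 = \<lfloor>(x + R) / (2 * R)\<rfloor>"
      have "real_of_int m0 \<le> (x + R) / (2 * R)" "(x + R) / (2 * R) < real_of_int m0 + 1"
        unfolding m0_def by linarith+
      then have b: "2 * R * real_of_int m0 - R \<le> x" "x < 2 * R * real_of_int m0 + R"
        using R by (simp_all add: field_simps)
      have "x \<noteq> 2 * R * real_of_int (m0 - 1) + R"
      proof
        assume "x = 2 * R * real_of_int (m0 - 1) + R"
        then have "x \<in> range (\<lambda>m::int. 2 * R * real_of_int m + R)" by (rule image_eqI) simp
        with elim show False by contradiction
      qed
      then have b': "2 * R * real_of_int m0 - R < x" using b by (simp add: algebra_simps)
      have "indicator (?I m) x = (indicator {m0} m :: ennreal)" for m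
      proof -
        have "m = m0" if "x \<in> ?I m"
        proof -
          have "2 * R * (real_of_int m - real_of_int m0) < 2 * R * 1" "2 * R * (real_of_int m0 - real_of_int m) < 2 * R * 1"
            using that b by (auto simp: algebra_simps)
          then have "real_of_int m - real_of_int m0 < 1" "real_of_int m0 - real_of_int m < 1"
            using R by (auto simp: mult_less_cancel_left_pos)
          then show ?thesis by linarith
        qed
        moreover have "x \<in> ?I m0" using b b' by simp
        ultimately have "x \<in> ?I m \<longleftrightarrow> m = m0" by blast
        then show ?thesis by (simp only: indicator_def singleton_iff)
      qed
      moreover have "(\<integral>\<^sup>+m. g x * indicator {m0} m \<partial>count_space UNIV) = g x" by simp
      ultimately show ?case by (simp only:)
    qed
  qed
  finally show ?thesis .
qed

abbreviation centered_interval :: "real \<Rightarrow> real measure" where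
  "centered_interval R \<equiv> restrict_space lborel {-R<..<R}"

lemma sigma_finite_centered_interval: "sigma_finite_measure (centered_interval R)"
  by (rule sigma_finite_measure_restrict_space[OF lborel.sigma_finite_measure_axioms]) auto

lemma image_point_measurable:
  "(\<lambda>p. image_point R (fst p) (snd p)) \<in> borel_measurable (count_space UNIV \<Otimes>\<^sub>M centered_interval R)"
proof (rule measurable_pair_measure_countable1)
  show "(\<lambda>y. image_point R (fst (m, y)) (snd (m, y))) \<in> borel_measurable (centered_interval R)" for m
    by (rule measurable_restrict_space1) (simp add: image_point_def)
qed auto

text \<open>The tiling as an identity of measures, which transfers integrability and integrals of signed functions as well.\<close>

lemma image_tiling:
  assumes R: "R > 0"
  shows "distr (count_space UNIV \<Otimes>\<^sub>M centered_interval R) borel (\<lambda>p. image_point R (fst p) (snd p)) = lborel"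
proof (rule measure_eqI)
  let ?P = "count_space (UNIV::int set) \<Otimes>\<^sub>M centered_interval R"
  interpret N: sigma_finite_measure "centered_interval R" by (rule sigma_finite_centered_interval)
  fix A assume "A \<in> sets (distr ?P borel (\<lambda>p. image_point R (fst p) (snd p)))"
  then have A[measurable]: "A \<in> sets borel" by simp
  note [measurable] = image_point_measurable
  have "emeasure (distr ?P borel (\<lambda>p. image_point R (fst p) (snd p))) A = (\<integral>\<^sup>+p. indicator A (image_point R (fst p) (snd p)) \<partial>?P)"
    by (subst nn_integral_indicator[symmetric], simp, subst nn_integral_distr) auto
  also have "\<dots> = (\<integral>\<^sup>+m. (\<integral>\<^sup>+a. indicator A (image_point R m a) \<partial>centered_interval R) \<partial>count_space UNIV)"
    by (subst N.nn_integral_fst[symmetric]) auto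
  also have "\<dots> = (\<integral>\<^sup>+m. (\<integral>\<^sup>+a\<in>{-R<..<R}. indicator A (image_point R m a) \<partial>lborel) \<partial>count_space UNIV)"
    by (subst nn_integral_restrict_space) auto
  also have "\<dots> = emeasure lborel A"
    by (subst image_tiling_nn[OF R]) auto
  finally show "emeasure (distr ?P borel (\<lambda>p. image_point R (fst p) (snd p))) A = emeasure lborel A" .
qed simp

lemma
  fixes G :: "real \<Rightarrow> real"
  assumes R: "R > 0" and G: "integrable lborel G"
  shows image_unfold_integrable: "integrable (centered_interval R) (\<lambda>a. \<integral>m. G (image_point R m a) \<partial>count_space UNIV)"
    and image_unfold_integral: "(\<integral>a. (\<integral>m. G (image_point R m a) \<partial>count_space UNIV) \<partial>centered_interval R) = (LINT x|lborel. G x)"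
proof -
  let ?P = "count_space (UNIV::int set) \<Otimes>\<^sub>M centered_interval R"
  interpret pair_sigma_finite "count_space (UNIV::int set)" "centered_interval R"
    by (intro pair_sigma_finite.intro sigma_finite_centered_interval sigma_finite_measure_count_space)
  have Gm: "G \<in> borel_measurable borel" using G by (auto dest!: borel_measurable_integrable)
  have i: "integrable ?P (\<lambda>(m, a). G (image_point R m a))"
    using G integrable_distr_eq[OF image_point_measurable[of R] Gm] unfolding image_tiling[OF R] by (simp add: case_prod_beta')
  show "integrable (centered_interval R) (\<lambda>a. \<integral>m. G (image_point R m a) \<partial>count_space UNIV)"
    by (rule integrable_snd[OF i])
  have "(LINT x|lborel. G x) = (\<integral>p. G (image_point R (fst p) (snd p)) \<partial>?P)"
    using integral_distr[OF image_point_measurable[of R] Gm] unfolding image_tiling[OF R] .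
  then show "(\<integral>a. (\<integral>m. G (image_point R m a) \<partial>count_space UNIV) \<partial>centered_interval R) = (LINT x|lborel. G x)"
    using integral_snd[OF i] by (simp add: case_prod_beta')
qed

text \<open>The sine modes, extended to the line by their formula, are odd under both reflections. This is the reason for the
  signs in the image kernel.\<close>

lemma sine_mode_image_point:
  assumes R: "R > 0"
  shows "sine_mode R k (image_point R m a) = image_sign m * sine_mode R k a"
proof -
  define X where "X = real k * pi * (a + R) / (2 * R)"
  have per: "sin (real_of_int j * pi + y) = (if even j then sin y else - sin y)" for j y
  proof (cases "even j")
    case True
    then obtain i where "j = 2 * i" by (elim evenE)
    then have "real_of_int j * pi + y = y + 2 * pi * of_int i" by simp
    moreover have "sin (y + 2 * pi * of_int i) = sin y" by (simp add: sin_add sin_int_2pin cos_int_2pin)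
    ultimately show ?thesis using True by (simp only: if_True)
  next
    case False
    then obtain i where "j = 2 * i + 1" by (elim oddE)
    then have "real_of_int j * pi + y = (y + pi) + 2 * pi * of_int i" by (simp add: algebra_simps)
    moreover have "sin ((y + pi) + 2 * pi * of_int i) = - sin y" by (simp add: sin_add[of "y + pi"] sin_int_2pin cos_int_2pin)
    ultimately show ?thesis using False by (simp only: if_False)
  qed
  show ?thesis
  proof (cases "even m")
    case True
    then have "real k * pi * (image_point R m a + R) / (2 * R) = real_of_int (int k * m) * pi + X"
      using R by (simp add: image_point_def image_sign_def X_def field_simps)
    then show ?thesis using True by (simp only: sine_mode_def X_def[symmetric] per) (simp add: image_sign_def)
  next
    case False
    then have "real k * pi * (image_point R m a + R) / (2 * R) = real_of_int (int k * (m + 1)) * pi + (- X)"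
      using R by (simp add: image_point_def image_sign_def X_def field_simps)
    then show ?thesis using False by (simp only: sine_mode_def X_def[symmetric] per) (simp add: image_sign_def)
  qed
qed

text \<open>Unfolding: by the oddness of the mode, the sum over images of integrals over \<open>(-R, R)\<close> is the integral of heat
  kernel times sine over the whole line.\<close>

lemma
  assumes R: "R > 0" and t: "t > 0"
  shows image_kernel_sine_integrable: "integrable (centered_interval R) (\<lambda>a. image_kernel R t a b * sine_mode R k a)"
    and image_kernel_sine_integral: "(\<integral>a. image_kernel R t a b * sine_mode R k a \<partial>centered_interval R)
        = exp (- (real k * pi / (2 * R))\<^sup>2 * t) * sine_mode R k b"
proof -
  let ?\<kappa> = "real k * pi / (2 * R)" and ?c = "real k * pi / 2"
  define G where "G x = heat_kernel1 t (x - b) * sine_mode R k x" for x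
  have sm: "sine_mode R k x = sin (?\<kappa> * x + ?c)" for x
    using R by (simp add: sine_mode_def field_simps)
  have G: "integrable lborel G" "(LINT x|lborel. G x) = exp (- ?\<kappa>\<^sup>2 * t) * sine_mode R k b"
    unfolding G_def sm by (fact heat_kernel1_sin[OF t])+
  have e: "image_kernel R t a b * sine_mode R k a = (\<integral>m. G (image_point R m a) \<partial>count_space UNIV)" for a
    unfolding image_kernel_def G_def sine_mode_image_point[OF R] integral_mult_left_zero[symmetric]
    by (simp only: ac_simps)
  show "integrable (centered_interval R) (\<lambda>a. image_kernel R t a b * sine_mode R k a)"
    unfolding e by (rule image_unfold_integrable[OF R G(1)])
  show "(\<integral>a. image_kernel R t a b * sine_mode R k a \<partial>centered_interval R)
        = exp (- (real k * pi / (2 * R))\<^sup>2 * t) * sine_mode R k b"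
    unfolding e image_unfold_integral[OF R G(1)] G(2) ..
qed

text \<open>Dropping the signs, the images of the heat kernel add up to the heat kernel of the line, which has mass \<open>1\<close>.\<close>

lemma image_kernel_mass:
  assumes R: "R > 0" and t: "t > 0"
  shows "(\<integral>\<^sup>+a\<in>{-R<..<R}. ennreal \<bar>image_kernel R t a b\<bar> \<partial>lborel) \<le> 1"
proof -
  have "(\<integral>\<^sup>+a\<in>{-R<..<R}. ennreal \<bar>image_kernel R t a b\<bar> \<partial>lborel)
     \<le> (\<integral>\<^sup>+a. (\<integral>\<^sup>+m. ennreal (heat_kernel1 t (image_point R m a - b)) * indicator {-R<..<R} a \<partial>count_space UNIV) \<partial>lborel)"
  proof (rule nn_integral_mono)
    fix a :: real
    have "ennreal \<bar>image_kernel R t a b\<bar> \<le> (\<integral>\<^sup>+m. ennreal (heat_kernel1 t (image_point R m a - b)) \<partial>count_space UNIV)"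
      unfolding image_kernel_def real_norm_def[symmetric]
      by (rule order_trans[OF norm_integral_le_nn]) (simp add: abs_mult heat_kernel1_integral(3)[OF t])
    then show "ennreal \<bar>image_kernel R t a b\<bar> * indicator {-R<..<R} a
      \<le> (\<integral>\<^sup>+m. ennreal (heat_kernel1 t (image_point R m a - b)) * indicator {-R<..<R} a \<partial>count_space UNIV)"
      by (auto split: split_indicator)
  qed
  also have "\<dots> = (\<integral>\<^sup>+m. (\<integral>\<^sup>+a\<in>{-R<..<R}. ennreal (heat_kernel1 t (image_point R m a - b)) \<partial>lborel) \<partial>count_space UNIV)"
    by (subst nn_integral_count_space_nn_integral) (auto simp: image_point_def)
  also have "\<dots> = (\<integral>\<^sup>+x. ennreal (heat_kernel1 t (x - b)) \<partial>lborel)"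
    by (rule image_tiling_nn[OF R]) measurable
  also have "\<dots> = 1"
    using heat_kernel1_integral[OF t] by (subst nn_integral_eq_integral) auto
  finally show ?thesis .
qed

lemma image_kernel_measurable:
  "(\<lambda>p. image_kernel R (fst p) (fst (snd p)) (snd (snd p))) \<in> borel_measurable borel"
proof -
  interpret sigma_finite_measure "count_space (UNIV :: int set)" by (rule sigma_finite_measure_count_space)
  have "(\<lambda>q. image_sign (fst q) * heat_kernel1 (fst (snd q)) (image_point R (fst q) (fst (snd (snd q))) - snd (snd (snd q))))
     \<in> borel_measurable (count_space UNIV \<Otimes>\<^sub>M (borel :: (real \<times> real \<times> real) measure))"
  proof (rule measurable_pair_measure_countable1)
    have [measurable]: "(\<lambda>y :: real \<times> real \<times> real. fst y) \<in> borel_measurable borel"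
       "(\<lambda>y :: real \<times> real \<times> real. fst (snd y)) \<in> borel_measurable borel"
       "(\<lambda>y :: real \<times> real \<times> real. snd (snd y)) \<in> borel_measurable borel"
      by (intro borel_measurable_continuous_onI continuous_intros)+
    fix m :: int
    show "(\<lambda>y. image_sign (fst (m, y)) * heat_kernel1 (fst (snd (m, y))) (image_point R (fst (m, y)) (fst (snd (snd (m, y)))) - snd (snd (snd (m, y)))))
        \<in> borel_measurable borel"
      unfolding heat_kernel1_def image_point_def fst_conv snd_conv
      by (intro borel_measurable_times borel_measurable_divide borel_measurable_const borel_measurable_diff borel_measurable_add
          borel_measurable_uminus borel_measurable_power measurable_compose[OF _ borel_measurable_exp] measurable_compose[OF _ borel_measurable_sqrt]; measurable)
  qed simp
  then have "(\<lambda>p. \<integral>m. image_sign m * heat_kernel1 (fst p) (image_point R m (fst (snd p)) - snd (snd p)) \<partial>count_space UNIV) \<in> borel_measurable (borel :: (real \<times> real \<times> real) measure)"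
    by (intro borel_measurable_lebesgue_integral) (subst measurable_pair_swap_iff, simp add: case_prod_beta')
  then show ?thesis by (simp add: image_kernel_def)
qed

text \<open>The \<open>m\<close>-th image of a point of the unit interval stays at distance at least \<open>(R - 1) |m|\<close> from \<open>[-R, R]\<close>, so the
  terms other than the central one are dominated by a geometric series with ratio \<open>p = exp (- (R - 1)\<^sup>2 / (8 t))\<close>, and
  \<open>t < (R - 1)\<^sup>2\<close> keeps \<open>p\<close> away from \<open>1\<close>.\<close>

lemma image_kernel_near_heat_kernel:
  assumes R: "R > 1" and t: "0 < t" "t < (R - 1)\<^sup>2" and a: "\<bar>a\<bar> \<le> 1/2" and b: "\<bar>b\<bar> \<le> R"
  shows "\<bar>image_kernel R t a b - heat_kernel1 t (a - b)\<bar> \<le> 9 / sqrt (4 * pi * t) * exp (- (R - 1)\<^sup>2 / (8 * t))"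
proof -
  define p where "p = exp (- (R - 1)\<^sup>2 / (8 * t))"
  define c where "c = 1 / sqrt (4 * pi * t)"
  have c: "c > 0" using t by (simp add: c_def)
  have p0: "0 < p" by (simp add: p_def)
  have "p \<le> exp (- (1/8))" unfolding p_def using t by (simp add: field_simps)
  also have "\<dots> = inverse (exp (1/8))" by (simp add: exp_minus)
  also have "\<dots> \<le> inverse (1 + 1/8)" by (intro le_imp_inverse_le exp_ge_add_one_self) auto
  finally have p1: "p \<le> 8/9" by simp
  have hb: "heat_kernel1 t (image_point R m a - b) \<le> c * p ^ (2 * nat \<bar>m\<bar>)" for m
  proof (cases "m = 0")
    case True
    then show ?thesis using t by (simp add: heat_kernel1_def c_def divide_right_mono)
  next
    case False
    define r where "r = real_of_int \<bar>m\<bar>"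
    have r1: "r \<ge> 1" using False by (simp add: r_def)
    have "\<bar>image_sign m * a\<bar> \<le> 1/2" using a by (simp add: abs_mult)
    moreover have "\<bar>2 * R * real_of_int m\<bar> = 2 * R * r" using R by (simp add: r_def abs_mult)
    ultimately have "\<bar>image_point R m a - b\<bar> \<ge> 2 * R * r - 1/2 - R"
      unfolding image_point_def using b by linarith
    moreover have "R * r \<ge> R * 1" using r1 R by (intro mult_left_mono) auto
    moreover have "(R - 1) * r = R * r - r" by (simp add: algebra_simps)
    ultimately have g: "\<bar>image_point R m a - b\<bar> \<ge> (R - 1) * r" using r1 by linarith
    have "(R - 1)\<^sup>2 * r \<le> (R - 1)\<^sup>2 * r\<^sup>2" using r1 by (intro mult_left_mono) (auto simp: power2_eq_square)
    also have "\<dots> = ((R - 1) * r)\<^sup>2" by (simp add: power_mult_distrib)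
    also have "\<dots> \<le> \<bar>image_point R m a - b\<bar>\<^sup>2" using g R r1 by (intro power_mono) auto
    finally have sq: "(R - 1)\<^sup>2 * r \<le> (image_point R m a - b)\<^sup>2" by simp
    have "p ^ (2 * nat \<bar>m\<bar>) = exp (real (2 * nat \<bar>m\<bar>) * (- (R - 1)\<^sup>2 / (8 * t)))"
      unfolding p_def by (rule exp_of_nat_mult[symmetric])
    also have "real (2 * nat \<bar>m\<bar>) * (- (R - 1)\<^sup>2 / (8 * t)) = - ((R - 1)\<^sup>2 * r) / (4 * t)"
      using t by (simp add: r_def field_simps)
    finally have pe: "p ^ (2 * nat \<bar>m\<bar>) = exp (- ((R - 1)\<^sup>2 * r) / (4 * t))" .
    have "exp (- (image_point R m a - b)\<^sup>2 / (4 * t)) \<le> p ^ (2 * nat \<bar>m\<bar>)"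
      unfolding pe using sq t by (simp add: divide_right_mono)
    then show ?thesis using c unfolding heat_kernel1_def c_def by (simp add: divide_right_mono)
  qed
  define D where "D m = (if m = 0 then 0 else image_sign m * heat_kernel1 t (image_point R m a - b))" for m
  (* The integers are enumerated as 0, -1, 1, -2, 2, ..., so the n-th one has absolute value at least n/2. *)
  have dec: "n \<le> 2 * nat \<bar>int_decode n\<bar>" for n
    by (auto simp: int_decode_def sum_decode_def elim!: oddE)
  have h0: "0 \<le> heat_kernel1 t x" for x using heat_kernel1_integral(3)[of t] t by auto
  have bd: "norm (image_sign m * heat_kernel1 t (image_point R m a - b)) \<le> c * p ^ (2 * nat \<bar>m\<bar>)" for m
    using hb[of m] h0 by (simp add: abs_mult)
  have bd': "norm (D (int_decode n)) \<le> (if n = 0 then 0 else c * p ^ n)" for n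
  proof -
    have "p ^ (2 * nat \<bar>int_decode n\<bar>) \<le> p ^ n"
      using dec p0 p1 by (intro power_decreasing) auto
    then have "c * p ^ (2 * nat \<bar>int_decode n\<bar>) \<le> c * p ^ n" using c by simp
    with bd[of "int_decode n"] have "norm (image_sign (int_decode n) * heat_kernel1 t (image_point R (int_decode n) a - b)) \<le> c * p ^ n"
      by (rule order_trans)
    moreover have "int_decode 0 = 0" by (simp add: int_decode_def sum_decode_def)
    ultimately show ?thesis using p0 c by (auto simp: D_def)
  qed
  have sg: "summable (\<lambda>n. p ^ n)" using p0 p1 by (intro summable_geometric) auto
  have intg: "integrable (count_space UNIV) (\<lambda>n. D (int_decode n))"
    unfolding integrable_count_space_nat_iff
  proof (rule summable_comparison_test'[where g = "\<lambda>n. c * p ^ n" and N = 0])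
    show "summable (\<lambda>n. c * p ^ n)" by (rule summable_mult[OF sg])
    have "(if n = 0 then 0 else c * p ^ n) \<le> c * p ^ n" for n using p0 c by simp
    then show "norm (norm (D (int_decode n))) \<le> c * p ^ n" for n using bd'[of n] order_trans by auto
  qed
  then have Di: "integrable (count_space UNIV) D"
    using integrable_bij_count_space[OF bij_int_decode, of D] by simp
  have split: "(\<lambda>m. image_sign m * heat_kernel1 t (image_point R m a - b)) = (\<lambda>m. D m + indicator {0} m *\<^sub>R heat_kernel1 t (a - b))"
    by (auto simp: D_def fun_eq_iff image_sign_def image_point_def)
  have "image_kernel R t a b = (\<integral>m. D m \<partial>count_space UNIV) + heat_kernel1 t (a - b)"
    unfolding image_kernel_def split using Di by (subst Bochner_Integration.integral_add) auto
  then have "\<bar>image_kernel R t a b - heat_kernel1 t (a - b)\<bar> = norm (\<integral>n. D (int_decode n) \<partial>count_space UNIV)"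
    using integral_bij_count_space[OF bij_int_decode, of D] by simp
  also have "\<dots> \<le> (\<integral>n. norm (D (int_decode n)) \<partial>count_space UNIV)" by (rule integral_norm_bound)
  also have "\<dots> = (\<Sum>n. norm (D (int_decode n)))"
    using intg by (intro integral_count_space_nat) auto
  also have "\<dots> \<le> (\<Sum>n. c * p * p ^ n)"
  proof -
    have s: "summable (\<lambda>n. norm (D (int_decode n)))" using intg by (simp add: integrable_count_space_nat_iff)
    have "norm (D (int_decode 0)) = 0" using bd'[of 0] by simp
    then have "(\<Sum>n. norm (D (int_decode n))) = (\<Sum>n. norm (D (int_decode (Suc n))))"
      using suminf_split_head[OF s] by simp
    also have "\<dots> \<le> (\<Sum>n. c * p * p ^ n)"
    proof (rule suminf_le)
      show "norm (D (int_decode (Suc n))) \<le> c * p * p ^ n" for n using bd'[of "Suc n"] by (simp add: mult.assoc)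
      show "summable (\<lambda>n. norm (D (int_decode (Suc n))))" using s by (rule summable_ignore_initial_segment[of _ 1, simplified])
      show "summable (\<lambda>n. c * p * p ^ n)" by (rule summable_mult[OF sg])
    qed
    finally show ?thesis .
  qed
  also have "\<dots> = c * p * (1 / (1 - p))"
    using p0 p1 by (subst suminf_mult[OF sg]) (simp add: suminf_geometric)
  also have "\<dots> \<le> c * p * 9"
    using p0 p1 c by (intro mult_left_mono) (auto simp: field_simps)
  finally show ?thesis by (simp add: c_def p_def mult.commute)
qed

section \<open>Smooth functions\<close>

text \<open>All derivatives exist, witnessed by the sequence of derivatives.\<close>

definition smooth_real :: "(real \<Rightarrow> real) \<Rightarrow> bool" where
  "smooth_real f \<longleftrightarrow> (\<exists>D. D 0 = f \<and> (\<forall>n t. (D n has_real_derivative D (Suc n) t) (at t)))"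

lemma smooth_real_deriv:
  assumes "smooth_real f"
  obtains f' where "\<And>t. (f has_real_derivative f' t) (at t)" "smooth_real f'"
proof -
  obtain D where D: "D 0 = f" "\<And>n t. (D n has_real_derivative D (Suc n) t) (at t)"
    using assms by (auto simp: smooth_real_def)
  have "smooth_real (D 1)"
    unfolding smooth_real_def by (intro exI[of _ "\<lambda>n. D (Suc n)"]) (use D(2) in auto)
  then show ?thesis using that[of "D 1"] D(1) D(2)[of 0] by simp
qed

text \<open>A class of functions that is closed under directional derivatives and contains the test functions needed here.
  Closure under differentiation is what makes every member infinitely differentiable.\<close>

inductive smooth_fun :: "('a::euclidean_space \<Rightarrow> real) \<Rightarrow> bool" where
  smooth_linear: "bounded_linear l \<Longrightarrow> smooth_fun l"
| smooth_const: "smooth_fun (\<lambda>_. c)"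
| smooth_add: "smooth_fun f \<Longrightarrow> smooth_fun g \<Longrightarrow> smooth_fun (\<lambda>x. f x + g x)"
| smooth_mult: "smooth_fun f \<Longrightarrow> smooth_fun g \<Longrightarrow> smooth_fun (\<lambda>x. f x * g x)"
| smooth_compose: "smooth_real h \<Longrightarrow> smooth_fun f \<Longrightarrow> smooth_fun (\<lambda>x. h (f x))"

lemma smooth_fun_deriv:
  fixes g :: "'a::euclidean_space \<Rightarrow> real"
  assumes "smooth_fun g"
  shows "\<exists>g'. (\<forall>x. (g has_derivative g' x) (at x)) \<and> (\<forall>b. smooth_fun (\<lambda>x. g' x b))"
  using assms
proof induction
  case (smooth_linear l)
  then show ?case
    by (intro exI[of _ "\<lambda>_. l"]) (auto intro: bounded_linear_imp_has_derivative smooth_const)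
next
  case (smooth_const c)
  show ?case by (intro exI[of _ "\<lambda>_ _. 0"]) (auto intro: smooth_fun.smooth_const)
next
  case (smooth_add f g)
  then obtain f' g' where f': "\<And>x. (f has_derivative f' x) (at x)" "\<And>b. smooth_fun (\<lambda>x. f' x b)"
    and g': "\<And>x. (g has_derivative g' x) (at x)" "\<And>b. smooth_fun (\<lambda>x. g' x b)" by blast
  show ?case
    by (intro exI[of _ "\<lambda>x b. f' x b + g' x b"] conjI allI has_derivative_add f' g' smooth_fun.smooth_add)
next
  case (smooth_mult f g)
  then obtain f' g' where f': "\<And>x. (f has_derivative f' x) (at x)" "\<And>b. smooth_fun (\<lambda>x. f' x b)"
    and g': "\<And>x. (g has_derivative g' x) (at x)" "\<And>b. smooth_fun (\<lambda>x. g' x b)" by blast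
  show ?case
    by (intro exI[of _ "\<lambda>x b. f x * g' x b + f' x b * g x"] conjI allI has_derivative_mult f' g' smooth_fun.smooth_add
      smooth_fun.smooth_mult smooth_mult.hyps)
next
  case (smooth_compose h f)
  then obtain f' where f': "\<And>x. (f has_derivative f' x) (at x)" "\<And>b. smooth_fun (\<lambda>x. f' x b)" by blast
  obtain h' where h': "\<And>t. (h has_real_derivative h' t) (at t)" "smooth_real h'"
    using smooth_real_deriv[OF smooth_compose.hyps(1)] by blast
  have "((\<lambda>x. h (f x)) has_derivative (\<lambda>b. h' (f x) * f' x b)) (at x)" for x
    using has_derivative_compose[OF f'(1) h'(1)[unfolded has_field_derivative_def]] by (simp add: mult.commute)
  then show ?case
    by (intro exI[of _ "\<lambda>x b. h' (f x) * f' x b"] conjI allI smooth_fun.smooth_mult smooth_fun.smooth_compose[OF h'(2)] f'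
      smooth_compose.hyps) auto
qed

lemma smooth_fun_C_k: "smooth_fun g \<Longrightarrow> C_k k (\<lambda>x. complex_of_real (g x))"
proof (induction k arbitrary: g)
  case 0
  then obtain g' where "\<And>x. (g has_derivative g' x) (at x)" using smooth_fun_deriv by blast
  then have "continuous_on UNIV g"
    by (meson continuous_at_imp_continuous_on has_derivative_continuous)
  then show ?case by (auto intro!: continuous_intros)
next
  case (Suc k)
  obtain g' where g': "\<And>x. (g has_derivative g' x) (at x)" "\<And>b. smooth_fun (\<lambda>x. g' x b)"
    using smooth_fun_deriv[OF Suc.prems] by blast
  have d: "((\<lambda>x. complex_of_real (g x)) has_derivative (\<lambda>b. complex_of_real (g' x b))) (at x)" for x
    by (intro has_derivative_of_real g')
  have "frechet_derivative (\<lambda>x. complex_of_real (g x)) (at x) = (\<lambda>b. complex_of_real (g' x b))" for x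
    using frechet_derivative_at[OF d] by simp
  then show ?case using d Suc.IH[OF g'(2)] by (auto simp: differentiable_def)
qed

lemma smooth_prod:
  "finite I \<Longrightarrow> (\<And>i. i \<in> I \<Longrightarrow> smooth_fun (f i)) \<Longrightarrow> smooth_fun (\<lambda>x. \<Prod>i\<in>I. f i x)"
  by (induction rule: finite_induct) (auto intro: smooth_const smooth_mult)

lemma smooth_real_sin: "smooth_real sin"
  unfolding smooth_real_def
proof (intro exI[of _ "\<lambda>n t. sin (t + real n * pi / 2)"] conjI allI)
  fix n t
  have "cos (t + real n * pi / 2) = sin (t + real (Suc n) * pi / 2)"
  proof -
    have "t + real (Suc n) * pi / 2 = (t + real n * pi / 2) + pi / 2" by (simp add: algebra_simps add_divide_distrib)
    then show ?thesis by (simp only: sin_add[of _ "pi / 2"]) simp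
  qed
  then show "((\<lambda>t. sin (t + real n * pi / 2)) has_real_derivative sin (t + real (Suc n) * pi / 2)) (at t)"
    by (auto intro!: derivative_eq_intros)
qed simp

lemma smooth_real_exp: "smooth_real exp"
  unfolding smooth_real_def
  by (intro exI[of _ "\<lambda>_. exp"]) (auto intro!: derivative_eq_intros)

text \<open>The standard smooth function that is flat at \<open>0\<close>. It vanishes on the negative half-line and tends to \<open>1\<close>, so its
  rescalings \<open>flat_step (n s)\<close> are smooth approximations of the Heaviside function.\<close>

definition flat_step :: "real \<Rightarrow> real" where
  "flat_step s = (if s > 0 then exp (- 1 / s) else 0)"

lemma poly_exp_tendsto_0: "((\<lambda>x. poly p x * exp (- x)) \<longlongrightarrow> (0::real)) at_top"
proof -
  have "((\<lambda>x. \<Sum>i\<le>degree p. coeff p i * (x ^ i / exp x)) \<longlongrightarrow> (\<Sum>i\<le>degree p. coeff p i * 0)) at_top"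
    by (intro tendsto_intros tendsto_power_div_exp_0)
  then show ?thesis by (simp add: poly_altdef exp_minus divide_inverse sum_distrib_right mult.assoc)
qed

text \<open>The functions \<open>p(1/s) exp (- 1/s)\<close>, extended by zero, are closed under differentiation. At the origin the difference
  quotient has the same form and tends to zero because the exponential beats every polynomial.\<close>

lemma flat_poly_deriv:
  fixes p :: "real poly"
  defines "q \<equiv> [:0, 0, 1:] * (p - pderiv p)"
  shows "((\<lambda>s. if s > 0 then poly p (1 / s) * exp (- 1 / s) else 0) has_real_derivative
      (if t > 0 then poly q (1 / t) * exp (- 1 / t) else 0)) (at t)"
proof -
  let ?f = "\<lambda>s::real. if s > 0 then poly p (1 / s) * exp (- 1 / s) else 0"
  consider "t > 0" | "t < 0" | "t = 0" by linarith
  then show ?thesis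
  proof cases
    case 1
    have "((\<lambda>s. poly p (1 / s) * exp (- 1 / s)) has_real_derivative poly q (1 / t) * exp (- 1 / t)) (at t)"
      using 1 unfolding q_def
      by (auto intro!: derivative_eq_intros simp: power2_eq_square field_simps)
    then have "(?f has_real_derivative poly q (1 / t) * exp (- 1 / t)) (at t)"
      by (rule has_field_derivative_transform_within_open[where S = "{0<..}"]) (use 1 in auto)
    then show ?thesis using 1 by simp
  next
    case 2
    have "(?f has_real_derivative 0) (at t)"
      by (rule has_field_derivative_transform_within_open[where S = "{..<0}" and f = "\<lambda>_. 0"]) (use 2 in auto)
    then show ?thesis using 2 by simp
  next
    case 3
    have "((\<lambda>h. poly (pCons 0 p) (inverse h) * exp (- inverse h)) \<longlongrightarrow> 0) (at_right 0)"
      by (rule filterlim_compose[OF poly_exp_tendsto_0 filterlim_inverse_at_top_right])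
    then have r: "((\<lambda>h. (?f (0 + h) - ?f 0) / h) \<longlongrightarrow> 0) (at_right 0)"
      by (rule Lim_transform_eventually) (auto simp: eventually_at_right_less field_simps intro!: eventually_mono[OF eventually_at_right_less])
    have l: "((\<lambda>h. (?f (0 + h) - ?f 0) / h) \<longlongrightarrow> 0) (at_left 0)"
      by (rule Lim_transform_eventually[OF tendsto_const]) (auto simp: eventually_at_left_field intro!: exI[of _ "-1"])
    show ?thesis unfolding \<open>t = 0\<close> DERIV_def using filterlim_split_at[OF l r] by simp
  qed
qed

lemma smooth_real_flat_step: "smooth_real flat_step"
proof -
  (* P n is the polynomial of the n-th derivative, as given by flat_poly_deriv. *)
  define P where "P = rec_nat 1 (\<lambda>_ p. [:0, 0, 1:] * (p - pderiv p :: real poly))"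
  have P0: "P 0 = 1" and PS: "P (Suc n) = [:0, 0, 1:] * (P n - pderiv (P n))" for n by (simp_all add: P_def)
  show ?thesis
    unfolding smooth_real_def
  proof (intro exI[of _ "\<lambda>n s. if s > 0 then poly (P n) (1 / s) * exp (- 1 / s) else 0"] conjI allI)
    show "(\<lambda>s. if s > 0 then poly (P 0) (1 / s) * exp (- 1 / s) else 0) = flat_step"
      by (rule ext) (simp add: P0 flat_step_def)
  qed (unfold PS, rule flat_poly_deriv)
qed

definition flat_step_deriv :: "real \<Rightarrow> real" where
  "flat_step_deriv s = (if s > 0 then exp (- 1 / s) / s\<^sup>2 else 0)"

lemma flat_step_has_derivative: "(flat_step has_real_derivative flat_step_deriv t) (at t)"
proof -
  have "flat_step = (\<lambda>s. if s > 0 then poly 1 (1 / s) * exp (- 1 / s) else 0)"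
    by (rule ext) (simp add: flat_step_def)
  moreover have "flat_step_deriv t = (if t > 0 then poly ([:0, 0, 1:] * (1 - pderiv 1)) (1 / t) * exp (- 1 / t) else 0)"
    by (simp add: flat_step_deriv_def power2_eq_square)
  ultimately show ?thesis using flat_poly_deriv[of 1 t] by (simp only:)
qed

lemma flat_step_bounds: "0 \<le> flat_step s" "flat_step s \<le> 1"
  by (auto simp: flat_step_def)

lemma flat_step_tendsto: "(flat_step \<longlongrightarrow> 1) at_top"
proof -
  have "((\<lambda>s::real. exp (- 1 / s)) \<longlongrightarrow> 1) at_top" by real_asymp
  then show ?thesis
    by (rule Lim_transform_eventually) (auto simp: flat_step_def intro!: eventually_mono[OF eventually_gt_at_top[of 0]])
qed

text \<open>The second bound controls the derivative of the boundary cut-off multiplied by the distance to the boundary.\<close>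

lemma flat_step_deriv_bounds: "0 \<le> flat_step_deriv s" "(s + 1) * flat_step_deriv s \<le> 2"
proof -
  show "0 \<le> flat_step_deriv s" by (simp add: flat_step_deriv_def)
  show "(s + 1) * flat_step_deriv s \<le> 2"
  proof (cases "s > 0")
    case True
    define y where "y = 1 / s"
    have y: "y > 0" using True by (simp add: y_def)
    have "1 + y + y\<^sup>2 / 2 \<le> exp y"
      using y exp_lower_Taylor_quadratic[of y] by simp
    moreover have "y + y\<^sup>2 \<le> 2 * (1 + y + y\<^sup>2 / 2)" using y by (simp add: power2_eq_square)
    moreover have "2 * (1 + y + y\<^sup>2 / 2) \<le> 2 * exp y" using calculation(1) by (intro mult_left_mono) auto
    ultimately have "y + y\<^sup>2 \<le> 2 * exp y" using order_trans by blast
    then have "(y + y\<^sup>2) * exp (- y) \<le> 2" by (simp add: exp_minus field_simps)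
    moreover have "(s + 1) * flat_step_deriv s = (y + y\<^sup>2) * exp (- y)"
      using True by (simp add: flat_step_deriv_def y_def power2_eq_square field_simps)
    ultimately show ?thesis by simp
  qed (simp add: flat_step_deriv_def)
qed

lemma flat_step_deriv_scaled_tendsto:
  assumes "c > 0"
  shows "(\<lambda>m. real m * flat_step_deriv (real m * c - 1)) \<longlonglongrightarrow> 0"
proof -
  have "(\<lambda>m. real m * (exp (- 1 / (real m * c - 1)) / (real m * c - 1)\<^sup>2)) \<longlonglongrightarrow> 0"
    using assms by real_asymp
  then show ?thesis
  proof (rule Lim_transform_eventually)
    have "\<forall>\<^sub>F m in sequentially. real m * c - 1 > 0"
      using assms by real_asymp
    then show "\<forall>\<^sub>F m in sequentially. real m * (exp (- 1 / (real m * c - 1)) / (real m * c - 1)\<^sup>2) = real m * flat_step_deriv (real m * c - 1)"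
      by eventually_elim (simp add: flat_step_deriv_def)
  qed
qed

lemma smooth_diff: "smooth_fun f \<Longrightarrow> smooth_fun g \<Longrightarrow> smooth_fun (\<lambda>x. f x - g x)"
  using smooth_add[of f "\<lambda>x. (-1) * g x"] smooth_mult[OF smooth_const[of "-1"], of g] by simp

section \<open>Test functions of product form\<close>

lemma vec_product_has_derivative:
  fixes x :: "real^'n"
  assumes b: "\<And>i x. (\<beta> i has_real_derivative \<beta>' i x) (at x)"
  shows "((\<lambda>x. \<Prod>i\<in>UNIV. \<beta> i (x $ i)) has_derivative
    (\<lambda>h. \<Sum>i\<in>UNIV. (\<beta>' i (x $ i) * (h $ i)) * (\<Prod>j\<in>UNIV-{i}. \<beta> j (x $ j)))) (at x)"
proof (intro has_derivative_prod)
  fix i :: 'n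
  have "((\<lambda>x::real^'n. x $ i) has_derivative (\<lambda>h. h $ i)) (at x)"
    by (intro bounded_linear_imp_has_derivative bounded_linear_vec_nth)
  from has_derivative_compose[OF this b[unfolded has_field_derivative_def]]
  show "((\<lambda>x. \<beta> i (x $ i)) has_derivative (\<lambda>h. \<beta>' i (x $ i) * (h $ i))) (at x)" .
qed

lemma product_function_has_derivative:
  fixes p :: "real \<times> (real^'n)"
  assumes a: "\<And>t. (\<alpha> has_real_derivative \<alpha>' t) (at t)"
    and b: "\<And>i x. (\<beta> i has_real_derivative \<beta>' i x) (at x)"
  shows "((\<lambda>p. complex_of_real (\<alpha> (fst p) * (\<Prod>i\<in>UNIV. \<beta> i (snd p $ i)))) has_derivative
    (\<lambda>h. complex_of_real (\<alpha> (fst p) * (\<Sum>i\<in>UNIV. (\<beta>' i (snd p $ i) * (snd h $ i)) * (\<Prod>j\<in>UNIV-{i}. \<beta> j (snd p $ j)))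
       + (\<alpha>' (fst p) * fst h) * (\<Prod>i\<in>UNIV. \<beta> i (snd p $ i))))) (at p)"
proof (intro has_derivative_of_real has_derivative_mult)
  show "((\<lambda>p. \<alpha> (fst p)) has_derivative (\<lambda>h. \<alpha>' (fst p) * fst h)) (at p)"
    by (rule has_derivative_compose[of fst fst, OF _ a[unfolded has_field_derivative_def]])
      (intro bounded_linear_imp_has_derivative bounded_linear_fst)
  show "((\<lambda>p. \<Prod>i\<in>UNIV. \<beta> i (snd p $ i)) has_derivative
      (\<lambda>h. \<Sum>i\<in>UNIV. (\<beta>' i (snd p $ i) * (snd h $ i)) * (\<Prod>j\<in>UNIV-{i}. \<beta> j (snd p $ j)))) (at p)"
    by (rule has_derivative_compose[of snd snd, OF _ vec_product_has_derivative[OF b]])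
      (intro bounded_linear_imp_has_derivative bounded_linear_snd)
qed

lemma product_function_partials:
  fixes x :: "real^'n"
  assumes a: "\<And>t. (\<alpha> has_real_derivative \<alpha>' t) (at t)"
    and b: "\<And>i x. (\<beta> i has_real_derivative \<beta>' i x) (at x)"
  defines "\<phi> \<equiv> \<lambda>p. complex_of_real (\<alpha> (fst p) * (\<Prod>i\<in>UNIV. \<beta> i (snd p $ i)))"
  shows "frechet_derivative \<phi> (at (t, x)) (1, 0) = complex_of_real (\<alpha>' t * (\<Prod>i\<in>UNIV. \<beta> i (x $ i)))"
    and "frechet_derivative \<phi> (at (t, x)) (0, axis i 1) = complex_of_real (\<alpha> t * (\<beta>' i (x $ i) * (\<Prod>j\<in>UNIV-{i}. \<beta> j (x $ j))))"
proof -
  have e: "frechet_derivative \<phi> (at (t, x)) = (\<lambda>h. complex_of_real (\<alpha> t * (\<Sum>i\<in>UNIV. (\<beta>' i (x $ i) * (snd h $ i)) * (\<Prod>j\<in>UNIV-{i}. \<beta> j (x $ j)))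
       + (\<alpha>' t * fst h) * (\<Prod>i\<in>UNIV. \<beta> i (x $ i))))"
    using frechet_derivative_at[OF product_function_has_derivative[where p = "(t, x)", OF a b]] unfolding \<phi>_def by simp
  show "frechet_derivative \<phi> (at (t, x)) (1, 0) = complex_of_real (\<alpha>' t * (\<Prod>i\<in>UNIV. \<beta> i (x $ i)))"
    unfolding e by simp
  have "(\<Sum>k\<in>UNIV. (\<beta>' k (x $ k) * ((axis i 1 :: real^'n) $ k)) * (\<Prod>j\<in>UNIV-{k}. \<beta> j (x $ j)))
     = (\<Sum>k\<in>UNIV. if k = i then \<beta>' i (x $ i) * (\<Prod>j\<in>UNIV-{i}. \<beta> j (x $ j)) else 0)"
    by (intro sum.cong) (auto simp: axis_def)
  also have "\<dots> = \<beta>' i (x $ i) * (\<Prod>j\<in>UNIV-{i}. \<beta> j (x $ j))" by simp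
  finally show "frechet_derivative \<phi> (at (t, x)) (0, axis i 1) = complex_of_real (\<alpha> t * (\<beta>' i (x $ i) * (\<Prod>j\<in>UNIV-{i}. \<beta> j (x $ j))))"
    unfolding e by simp
qed

lemma interior_cube: "interior (cube R :: (real^'n) set) = box (\<chi> i. - R) (\<chi> i. R)"
  by (simp add: cube_def interior_cbox)

lemma mem_interior_cube: "x \<in> interior (cube R) \<longleftrightarrow> (\<forall>i. \<bar>(x::real^'n) $ i\<bar> < R)"
  unfolding interior_cube mem_box_cart by (auto simp: abs_less_iff minus_less_iff)

lemma mem_cube: "x \<in> cube R \<longleftrightarrow> (\<forall>i. \<bar>(x::real^'n) $ i\<bar> \<le> R)"
  unfolding cube_def mem_box_cart by (auto simp: abs_le_iff minus_le_iff)

text \<open>Vanishing of the factors outside intervals gives compact support in a cylinder over a smaller cube.\<close>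

lemma product_test_function:
  fixes \<beta> :: "'n::finite \<Rightarrow> real \<Rightarrow> real"
  assumes a: "smooth_fun \<alpha>" and b: "\<And>i. smooth_fun (\<beta> i)"
    and a0: "\<And>t. t \<notin> {c..d} \<Longrightarrow> \<alpha> t = 0" "d < T"
    and b0: "\<And>i x. \<bar>x\<bar> > \<rho> \<Longrightarrow> \<beta> i x = 0" "\<rho> < R"
  shows "test_function ({..<T} \<times> interior (cube R)) (\<lambda>p. complex_of_real (\<alpha> (fst p) * (\<Prod>i\<in>UNIV. \<beta> i (snd (p :: real \<times> (real^'n)) $ i))))"
  unfolding test_function_def
proof (intro conjI allI)
  have comp: "smooth_fun (\<lambda>p. f (l p))" if "smooth_fun f" and l: "bounded_linear l" for f :: "real \<Rightarrow> real" and l :: "real \<times> (real^'n) \<Rightarrow> real"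
    using that(1)
  proof induction
    case (smooth_linear k)
    show ?case using smooth_fun.smooth_linear[OF bounded_linear_compose[OF smooth_linear l]] .
  next
    case (smooth_const k)
    show ?case by (rule smooth_fun.smooth_const)
  next
    case (smooth_add f g)
    show ?case by (rule smooth_fun.smooth_add[OF smooth_add.IH])
  next
    case (smooth_mult f g)
    show ?case by (rule smooth_fun.smooth_mult[OF smooth_mult.IH])
  next
    case (smooth_compose h f)
    show ?case by (rule smooth_fun.smooth_compose[OF smooth_compose.hyps(1) smooth_compose.IH])
  qed
  have "smooth_fun (\<lambda>p::real \<times> (real^'n). \<alpha> (fst p) * (\<Prod>i\<in>UNIV. \<beta> i (snd p $ i)))"
    by (intro smooth_mult smooth_prod comp[OF a bounded_linear_fst] comp[OF b bounded_linear_compose[OF bounded_linear_vec_nth bounded_linear_snd]]) simp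
  then show "C_k k (\<lambda>p. complex_of_real (\<alpha> (fst p) * (\<Prod>i\<in>UNIV. \<beta> i (snd (p :: real \<times> (real^'n)) $ i))))" for k
    by (rule smooth_fun_C_k)
  show "\<exists>C. compact C \<and> C \<subseteq> {..<T} \<times> interior (cube R) \<and>
      (\<forall>x. x \<notin> C \<longrightarrow> complex_of_real (\<alpha> (fst x) * (\<Prod>i\<in>UNIV. \<beta> i (snd (x :: real \<times> (real^'n)) $ i))) = 0)"
  proof (intro exI[of _ "{c..d} \<times> cube \<rho>"] conjI allI impI)
    show "compact ({c..d} \<times> (cube \<rho> :: (real^'n) set))"
      by (intro compact_Times) (auto simp: cube_def)
    show "{c..d} \<times> (cube \<rho> :: (real^'n) set) \<subseteq> {..<T} \<times> interior (cube R)"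
      using a0(2) b0(2) by (auto simp: mem_cube mem_interior_cube) (meson le_less_trans)
    fix x :: "real \<times> (real^'n)" assume "x \<notin> {c..d} \<times> cube \<rho>"
    then have "fst x \<notin> {c..d} \<or> (\<exists>i. \<bar>snd x $ i\<bar> > \<rho>)"
      by (auto simp: mem_Times_iff mem_cube not_le)
    then consider "fst x \<notin> {c..d}" | i where "\<bar>snd x $ i\<bar> > \<rho>" by blast
    then show "complex_of_real (\<alpha> (fst x) * (\<Prod>i\<in>UNIV. \<beta> i (snd x $ i))) = 0"
    proof cases
      case 1 then show ?thesis using a0 by simp
    next
      case (2 i)
      then have "(\<Prod>i\<in>UNIV. \<beta> i (snd x $ i)) = 0" using b0(1)[of "snd x $ i" i] by (intro prod_zero) auto
      then show ?thesis by simp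
    qed
  qed
qed

text \<open>Vanishes within distance \<open>1/m\<close> of the end points of \<open>(-R, R)\<close> and tends to \<open>1\<close> inside as \<open>m\<close> grows.\<close>

definition boundary_cutoff :: "real \<Rightarrow> real \<Rightarrow> real \<Rightarrow> real" where
  "boundary_cutoff R m x = flat_step (m * (R - x) - 1) * flat_step (m * (R + x) - 1)"

definition sine_mode_deriv :: "real \<Rightarrow> nat \<Rightarrow> real \<Rightarrow> real" where
  "sine_mode_deriv R k a = (real k * pi / (2 * R)) * cos (real k * pi * (a + R) / (2 * R))"

definition cut_mode :: "real \<Rightarrow> nat \<Rightarrow> real \<Rightarrow> real \<Rightarrow> real" where
  "cut_mode R k m x = sine_mode R k x * boundary_cutoff R m x"

definition cut_mode_deriv :: "real \<Rightarrow> nat \<Rightarrow> real \<Rightarrow> real \<Rightarrow> real" where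
  "cut_mode_deriv R k m x = sine_mode_deriv R k x * boundary_cutoff R m x +
     sine_mode R k x * (flat_step (m * (R - x) - 1) * (m * flat_step_deriv (m * (R + x) - 1))
       - (m * flat_step_deriv (m * (R - x) - 1)) * flat_step (m * (R + x) - 1))"

lemma sine_mode_has_derivative: "R > 0 \<Longrightarrow> (sine_mode R k has_real_derivative sine_mode_deriv R k x) (at x)"
  unfolding sine_mode_def[abs_def] sine_mode_deriv_def
  by (auto intro!: derivative_eq_intros)

lemma cut_mode_has_derivative:
  assumes "R > 0"
  shows "(cut_mode R k m has_real_derivative cut_mode_deriv R k m x) (at x)"
proof -
  note f = DERIV_chain'[OF _ flat_step_has_derivative]
  have 1: "((\<lambda>x. flat_step (m * (R - x) - 1)) has_real_derivative flat_step_deriv (m * (R - x) - 1) * (- m)) (at x)"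
    by (rule f) (auto intro!: derivative_eq_intros)
  have 2: "((\<lambda>x. flat_step (m * (R + x) - 1)) has_real_derivative flat_step_deriv (m * (R + x) - 1) * m) (at x)"
    by (rule f) (auto intro!: derivative_eq_intros)
  show ?thesis
    unfolding cut_mode_def[abs_def] boundary_cutoff_def cut_mode_deriv_def
    by (rule DERIV_cong[OF DERIV_mult[OF sine_mode_has_derivative[OF assms] DERIV_mult[OF 1 2]]]) (simp add: algebra_simps)
qed

lemma smooth_affine: "smooth_fun (\<lambda>x::real. a * x + c)"
  by (intro smooth_add smooth_const smooth_linear bounded_linear_mult_right)

lemma cut_mode_smooth: "R > 0 \<Longrightarrow> smooth_fun (cut_mode R k m)"
proof -
  assume R: "R > 0"
  have "smooth_fun (\<lambda>x. sin ((real k * pi / (2 * R)) * x + real k * pi / 2) *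
    (flat_step ((- m) * x + (m * R - 1)) * flat_step (m * x + (m * R - 1))))"
    by (intro smooth_mult smooth_compose[OF smooth_real_sin] smooth_compose[OF smooth_real_flat_step] smooth_affine)
  also have "(\<lambda>x. sin ((real k * pi / (2 * R)) * x + real k * pi / 2) *
    (flat_step ((- m) * x + (m * R - 1)) * flat_step (m * x + (m * R - 1)))) = cut_mode R k m"
  proof
    fix x
    have "real k * pi / (2 * R) * x + real k * pi / 2 = real k * pi * (x + R) / (2 * R)" using R by (simp add: field_simps)
    moreover have "(- m) * x + (m * R - 1) = m * (R - x) - 1" "m * x + (m * R - 1) = m * (R + x) - 1" by (simp_all add: algebra_simps)
    ultimately show "sin ((real k * pi / (2 * R)) * x + real k * pi / 2) *
    (flat_step ((- m) * x + (m * R - 1)) * flat_step (m * x + (m * R - 1))) = cut_mode R k m x"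
      by (simp only: cut_mode_def sine_mode_def boundary_cutoff_def)
  qed
  finally show ?thesis .
qed

lemma cut_mode_support:
  assumes "m > 0" "\<bar>x\<bar> > R - 1 / m"
  shows "cut_mode R k m x = 0"
proof -
  have "R - x < 1 / m \<or> R + x < 1 / m" using assms(2) by linarith
  then have "m * (R - x) < 1 \<or> m * (R + x) < 1" using assms(1) by (simp add: field_simps)
  then show ?thesis by (auto simp: cut_mode_def boundary_cutoff_def flat_step_def)
qed

lemma boundary_cutoff_bounds: "0 \<le> boundary_cutoff R m x" "boundary_cutoff R m x \<le> 1"
  using flat_step_bounds by (auto simp: boundary_cutoff_def mult_le_one)

lemma cut_mode_bound: "\<bar>cut_mode R k m x\<bar> \<le> 1"
proof -
  have "\<bar>sine_mode R k x\<bar> * boundary_cutoff R m x \<le> 1 * 1"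
    using boundary_cutoff_bounds by (intro mult_mono) (auto simp: sine_mode_def)
  then show ?thesis using boundary_cutoff_bounds(1)[of R m x] by (simp add: cut_mode_def abs_mult)
qed

text \<open>The derivative of the cut-off is of order \<open>m\<close> in a layer of width \<open>1/m\<close> at the boundary, but the mode vanishes there
  to first order. Hence the derivative of the product is bounded independently of \<open>m\<close>, which is what dominated
  convergence needs when the cut-off is removed.\<close>

lemma cut_mode_deriv_bound:
  assumes R: "R > 0" and m: "m > 0"
  shows "\<bar>cut_mode_deriv R k m x\<bar> \<le> 5 * (real k * pi / (2 * R))"
proof -
  define \<kappa> where "\<kappa> = real k * pi / (2 * R)"
  have k0: "\<kappa> \<ge> 0" using R by (simp add: \<kappa>_def)
  have s: "sine_mode R k x = sin (\<kappa> * (R + x))" using R by (simp add: sine_mode_def \<kappa>_def algebra_simps)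
  have s1: "\<bar>sine_mode R k x\<bar> \<le> \<kappa> * \<bar>R + x\<bar>"
    using abs_sin_x_le_abs_x[of "\<kappa> * (R + x)"] k0 unfolding s by (simp add: abs_mult)
  have "\<kappa> * (R + x) = real k * pi - \<kappa> * (R - x)" using R by (simp add: \<kappa>_def field_simps)
  then have "\<bar>sine_mode R k x\<bar> = \<bar>sin (\<kappa> * (R - x))\<bar>"
    unfolding s by (simp add: sin_diff abs_mult cos_npi)
  then have s2: "\<bar>sine_mode R k x\<bar> \<le> \<kappa> * \<bar>R - x\<bar>"
    using abs_sin_x_le_abs_x[of "\<kappa> * (R - x)"] k0 by (simp add: abs_mult)
  (* y is the distance to one of the end points and S bounds the mode there; the factor m y is absorbed by
     the decay of the derivative of the step. *)
  have aux: "S * (m * flat_step_deriv (m * y - 1)) \<le> 2 * \<kappa>" if S: "S \<le> \<kappa> * \<bar>y\<bar>" for S y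
  proof (cases "m * y - 1 > 0")
    case True
    then have "0 < m * y" by simp
    then have y: "y > 0" using m by (simp add: zero_less_mult_iff)
    have "S * (m * flat_step_deriv (m * y - 1)) \<le> (\<kappa> * y) * (m * flat_step_deriv (m * y - 1))"
      using S y m flat_step_deriv_bounds(1) by (intro mult_right_mono) auto
    also have "\<dots> = \<kappa> * (((m * y - 1) + 1) * flat_step_deriv (m * y - 1))" by simp
    also have "\<dots> \<le> \<kappa> * 2" by (intro mult_left_mono flat_step_deriv_bounds k0)
    finally show ?thesis by simp
  qed (use k0 in \<open>simp add: flat_step_deriv_def\<close>)
  let ?f1 = "flat_step (m * (R - x) - 1)" and ?f2 = "flat_step (m * (R + x) - 1)"
  let ?g1 = "m * flat_step_deriv (m * (R - x) - 1)" and ?g2 = "m * flat_step_deriv (m * (R + x) - 1)"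
  have g: "?g1 \<ge> 0" "?g2 \<ge> 0" using m flat_step_deriv_bounds(1) by auto
  have "\<bar>cut_mode_deriv R k m x\<bar> \<le> \<bar>sine_mode_deriv R k x * boundary_cutoff R m x\<bar> + \<bar>sine_mode R k x * (?f1 * ?g2)\<bar> + \<bar>sine_mode R k x * (?g1 * ?f2)\<bar>"
  proof -
    have "\<bar>a + (b - c)\<bar> \<le> \<bar>a\<bar> + \<bar>b\<bar> + \<bar>c\<bar>" for a b c :: real by linarith
    then show ?thesis unfolding cut_mode_deriv_def right_diff_distrib .
  qed
  also have "\<bar>sine_mode_deriv R k x * boundary_cutoff R m x\<bar> \<le> \<kappa> * 1"
    unfolding abs_mult[of _ "boundary_cutoff R m x"]
  proof (rule mult_mono)
    show "\<bar>sine_mode_deriv R k x\<bar> \<le> \<kappa>"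
      unfolding sine_mode_deriv_def \<kappa>_def[symmetric] abs_mult using k0 by (simp add: mult_left_le)
  qed (use boundary_cutoff_bounds[of R m x] k0 in auto)
  also have "\<bar>sine_mode R k x * (?f1 * ?g2)\<bar> \<le> 2 * \<kappa>"
  proof -
    have "\<bar>sine_mode R k x * (?f1 * ?g2)\<bar> = (\<bar>sine_mode R k x\<bar> * ?g2) * ?f1"
      using m flat_step_deriv_bounds(1) flat_step_bounds(1) by (simp add: abs_mult)
    also have "\<dots> \<le> (\<bar>sine_mode R k x\<bar> * ?g2) * 1" using g flat_step_bounds(2) by (intro mult_left_mono) auto
    finally show ?thesis using aux[OF s1] by simp
  qed
  also have "\<bar>sine_mode R k x * (?g1 * ?f2)\<bar> \<le> 2 * \<kappa>"
  proof -
    have "\<bar>sine_mode R k x * (?g1 * ?f2)\<bar> = (\<bar>sine_mode R k x\<bar> * ?g1) * ?f2"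
      using m flat_step_deriv_bounds(1) flat_step_bounds(1) by (simp add: abs_mult)
    also have "\<dots> \<le> (\<bar>sine_mode R k x\<bar> * ?g1) * 1" using g flat_step_bounds(2) by (intro mult_left_mono) auto
    finally show ?thesis using aux[OF s2] by simp
  qed
  finally show ?thesis unfolding \<kappa>_def[symmetric] by simp
qed

lemma flat_step_scaled_tendsto:
  assumes "c > 0"
  shows "(\<lambda>n. flat_step (real n * c - 1)) \<longlonglongrightarrow> 1" "(\<lambda>n. flat_step (real n * c)) \<longlonglongrightarrow> 1"
proof -
  have "filterlim (\<lambda>n. real n * c - 1) at_top sequentially" "filterlim (\<lambda>n. real n * c) at_top sequentially"
    using assms by real_asymp+
  then show "(\<lambda>n. flat_step (real n * c - 1)) \<longlonglongrightarrow> 1" "(\<lambda>n. flat_step (real n * c)) \<longlonglongrightarrow> 1"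
    by (auto intro: filterlim_compose[OF flat_step_tendsto])
qed

lemma cut_mode_tendsto:
  assumes x: "\<bar>x\<bar> < R"
  shows "(\<lambda>m. cut_mode R k (real m) x) \<longlonglongrightarrow> sine_mode R k x"
    and "(\<lambda>m. cut_mode_deriv R k (real m) x) \<longlonglongrightarrow> sine_mode_deriv R k x"
proof -
  have p: "R - x > 0" "R + x > 0" using x by auto
  note l = flat_step_scaled_tendsto(1)[OF p(1)] flat_step_scaled_tendsto(1)[OF p(2)]
    flat_step_deriv_scaled_tendsto[OF p(1)] flat_step_deriv_scaled_tendsto[OF p(2)]
  have "(\<lambda>m. cut_mode R k (real m) x) \<longlonglongrightarrow> sine_mode R k x * (1 * 1)"
    unfolding cut_mode_def boundary_cutoff_def by (intro tendsto_intros l)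
  then show "(\<lambda>m. cut_mode R k (real m) x) \<longlonglongrightarrow> sine_mode R k x" by simp
  have "(\<lambda>m. cut_mode_deriv R k (real m) x) \<longlonglongrightarrow> sine_mode_deriv R k x * (1 * 1) + sine_mode R k x * (1 * 0 - 0 * 1)"
    unfolding cut_mode_deriv_def boundary_cutoff_def by (intro tendsto_intros l)
  then show "(\<lambda>m. cut_mode_deriv R k (real m) x) \<longlonglongrightarrow> sine_mode_deriv R k x" by simp
qed

section \<open>The weak heat equation tested with sine modes\<close>

text \<open>The eigenfunctions of the Dirichlet Laplacian on the cube, and their partial derivatives.\<close>

abbreviation tensor_mode :: "real \<Rightarrow> ('n::finite \<Rightarrow> nat) \<Rightarrow> real^'n \<Rightarrow> real" where
  "tensor_mode R k x \<equiv> \<Prod>i\<in>UNIV. sine_mode R (k i) (x $ i)"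

abbreviation tensor_mode_partial :: "real \<Rightarrow> ('n::finite \<Rightarrow> nat) \<Rightarrow> 'n \<Rightarrow> real^'n \<Rightarrow> real" where
  "tensor_mode_partial R k i x \<equiv> sine_mode_deriv R (k i) (x $ i) * (\<Prod>j\<in>UNIV-{i}. sine_mode R (k j) (x $ j))"

lemma mode_measurable[measurable]:
  "sine_mode R k \<in> borel_measurable borel" "sine_mode_deriv R k \<in> borel_measurable borel"
  "cut_mode R k m \<in> borel_measurable borel" "cut_mode_deriv R k m \<in> borel_measurable borel"
  unfolding sine_mode_def[abs_def] sine_mode_deriv_def[abs_def] cut_mode_def[abs_def] cut_mode_deriv_def[abs_def]
    boundary_cutoff_def flat_step_def flat_step_deriv_def by measurable

lemma cube_emeasure_finite: "emeasure lborel (interior (cube R :: (real^'n) set)) < \<infinity>"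
  unfolding interior_cube using emeasure_bounded_finite[OF bounded_box] by auto

lemma cylinder_emeasure_finite: "emeasure lborel ({0<..<T::real} \<times> interior (cube R :: (real^'n) set)) < \<infinity>"
  using bounded_box[of 0 T] by (intro emeasure_bounded_finite bounded_Times) (auto simp: interior_cube bounded_box)

lemma cylinder_sets: "{0<..<T::real} \<times> interior (cube R :: (real^'n) set) \<in> sets borel"
  by (intro borel_open open_Times) auto

lemma sine_mode_abs_le: "\<bar>sine_mode R k x\<bar> \<le> 1"
  by (simp add: sine_mode_def)

lemma prod_abs_le_one:
  fixes f :: "'i \<Rightarrow> real"
  shows "(\<And>i. i \<in> I \<Longrightarrow> \<bar>f i\<bar> \<le> 1) \<Longrightarrow> \<bar>\<Prod>i\<in>I. f i\<bar> \<le> 1"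
  unfolding abs_prod by (rule prod_le_1) auto

text \<open>The sine modes are not compactly supported in the cube, so the weak formulation is applied to the cut-off modes and
  the cut-off is removed by dominated convergence.\<close>

lemma weak_identity_sine_mode:
  fixes v :: "real \<Rightarrow> real^'n \<Rightarrow> complex" and g :: "real \<Rightarrow> real^'n \<Rightarrow> complex^'n"
  defines "U R \<equiv> interior (cube R)"
  assumes R: "R > 0"
    and vL: "L2_on ({0<..<T} \<times> U R) (\<lambda>(t, x). v t x)"
    and gL: "L2_on ({0<..<T} \<times> U R) (\<lambda>(t, x). g t x)"
    and weak: "\<forall>\<phi> :: real \<times> (real^'n) \<Rightarrow> complex. test_function ({..<T} \<times> U R) \<phi> \<longrightarrow>
           (LINT p:{0<..<T} \<times> U R|lborel.
              - v (fst p) (snd p) * frechet_derivative \<phi> (at p) (1, 0)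
              + (\<Sum>i\<in>UNIV. g (fst p) (snd p) $ i * frechet_derivative \<phi> (at p) (0, axis i 1)))
           = (LINT x:U R|lborel. F x * \<phi> (0, x))"
    and FL: "L2_on UNIV F"
    and a: "smooth_fun \<alpha>" "\<And>t. (\<alpha> has_real_derivative \<alpha>' t) (at t)" "\<And>t. t \<notin> {c..d} \<Longrightarrow> \<alpha> t = 0" "d < T"
    and am: "\<alpha>' \<in> borel_measurable borel" and A: "\<And>t. t \<in> {0<..<T} \<Longrightarrow> \<bar>\<alpha> t\<bar> \<le> A \<and> \<bar>\<alpha>' t\<bar> \<le> A"
  shows "(LINT p:{0<..<T} \<times> U R|lborel.
              - v (fst p) (snd p) * complex_of_real (\<alpha>' (fst p) * tensor_mode R k (snd p))
              + (\<Sum>i\<in>UNIV. g (fst p) (snd p) $ i * complex_of_real (\<alpha> (fst p) * tensor_mode_partial R k i (snd p))))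
           = (LINT x:U R|lborel. F x * complex_of_real (\<alpha> 0 * tensor_mode R k x))"
proof -
  let ?D = "{0<..<T} \<times> U R"
  have Ds: "?D \<in> sets borel" "emeasure lborel ?D < \<infinity>"
    unfolding U_def using cylinder_sets[of T R] cylinder_emeasure_finite[of T R] by auto
  have Us[measurable]: "U R \<in> sets borel" unfolding U_def by simp
  have \<alpha>m: "\<alpha> \<in> borel_measurable borel"
    using a(2) by (intro borel_measurable_continuous_onI continuous_at_imp_continuous_on) (auto intro: DERIV_isCont)
  note [measurable] = am \<alpha>m
  define V where "V p = indicator ?D p *\<^sub>R v (fst p) (snd p)" for p
  define G where "G p = indicator ?D p *\<^sub>R g (fst p) (snd p)" for p
  have Vi: "integrable lborel V" and Gi: "integrable lborel G"
    using L2_on_set_integrable[OF vL Ds] L2_on_set_integrable[OF gL Ds]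
    by (simp_all add: set_integrable_def V_def[abs_def] G_def[abs_def] case_prod_beta')
  have [measurable]: "V \<in> borel_measurable borel" using Vi by (auto dest: borel_measurable_integrable)
  have Gii: "integrable lborel (\<lambda>p. G p $ i)" for i
    using integrable_bounded_linear[OF bounded_linear_vec_nth Gi] .
  then have [measurable]: "(\<lambda>p. G p $ i) \<in> borel_measurable borel" for i by (auto dest: borel_measurable_integrable)
  define X where "X m p = complex_of_real (\<alpha>' (fst p) * (\<Prod>i\<in>UNIV. cut_mode R (k i) (real (Suc m)) (snd p $ i)))" for m and p :: "real \<times> (real^'n)"
  define Y where "Y m i p = complex_of_real (\<alpha> (fst p) * (cut_mode_deriv R (k i) (real (Suc m)) (snd p $ i) * (\<Prod>j\<in>UNIV-{i}. cut_mode R (k j) (real (Suc m)) (snd p $ j))))" for m i and p :: "real \<times> (real^'n)"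
  define X0 where "X0 p = complex_of_real (\<alpha>' (fst p) * tensor_mode R k (snd p))" for p :: "real \<times> (real^'n)"
  define Y0 where "Y0 i p = complex_of_real (\<alpha> (fst p) * tensor_mode_partial R k i (snd p))" for i and p :: "real \<times> (real^'n)"
  have ms: "(\<lambda>p::real \<times> (real^'n). fst p) \<in> borel_measurable borel" "\<And>i. (\<lambda>p::real \<times> (real^'n). snd p $ i) \<in> borel_measurable borel"
    by (intro borel_measurable_continuous_onI continuous_intros)+
  have cm: "(\<lambda>p::real \<times> (real^'n). f (fst p)) \<in> borel_measurable borel" "\<And>i. (\<lambda>p::real \<times> (real^'n). f (snd p $ i)) \<in> borel_measurable borel"
    if "f \<in> borel_measurable borel" for f :: "real \<Rightarrow> real"
    using measurable_compose[OF ms(1) that] measurable_compose[OF ms(2) that] by auto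
  have XYm: "X m \<in> borel_measurable borel" "Y m i \<in> borel_measurable borel" "X0 \<in> borel_measurable borel" "Y0 i \<in> borel_measurable borel" for m i
    unfolding X_def[abs_def] Y_def[abs_def] X0_def[abs_def] Y0_def[abs_def]
    by (rule measurable_compose[OF _ borel_measurable_of_real]; intro borel_measurable_times borel_measurable_prod cm mode_measurable am \<alpha>m)+
  note [measurable] = XYm
  have split: "indicator ?D p *\<^sub>R (- v (fst p) (snd p) * x + (\<Sum>i\<in>UNIV. g (fst p) (snd p) $ i * y i)) = - V p * x + (\<Sum>i\<in>UNIV. G p $ i * y i)" for p x y
    by (simp add: V_def G_def split: split_indicator)
  define I where "I m p = - V p * X m p + (\<Sum>i\<in>UNIV. G p $ i * Y m i p)" for m p
  define I0 where "I0 p = - V p * X0 p + (\<Sum>i\<in>UNIV. G p $ i * Y0 i p)" for p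
  have idm: "integral\<^sup>L lborel (I m) = (LINT x:U R|lborel. F x * complex_of_real (\<alpha> 0 * (\<Prod>i\<in>UNIV. cut_mode R (k i) (real (Suc m)) (x $ i))))" for m
  proof -
    let ?\<beta> = "\<lambda>i. cut_mode R (k i) (real (Suc m))"
    let ?\<phi> = "\<lambda>p::real \<times> (real^'n). complex_of_real (\<alpha> (fst p) * (\<Prod>i\<in>UNIV. ?\<beta> i (snd p $ i)))"
    have "test_function ({..<T} \<times> U R) ?\<phi>"
      unfolding U_def
      by (rule product_test_function[where \<rho> = "R - 1 / real (Suc m)", OF a(1) cut_mode_smooth[OF R] a(3,4)])
        (auto intro: cut_mode_support)
    note w = weak[rule_format, OF this]
    note pf = product_function_partials[OF a(2), of ?\<beta> "\<lambda>i. cut_mode_deriv R (k i) (real (Suc m))", OF cut_mode_has_derivative[OF R]]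
    have pd: "frechet_derivative ?\<phi> (at p) (1, 0) = X m p" "frechet_derivative ?\<phi> (at p) (0, axis i 1) = Y m i p" for p i
      using pf(1)[of "fst p" "snd p"] pf(2)[of "fst p" "snd p" i] unfolding X_def Y_def prod.collapse by auto
    have "(LINT p:?D|lborel. - v (fst p) (snd p) * X m p + (\<Sum>i\<in>UNIV. g (fst p) (snd p) $ i * Y m i p))
        = (LINT x:U R|lborel. F x * ?\<phi> (0, x))"
      using w unfolding pd .
    then show ?thesis unfolding set_lebesgue_integral_def split I_def[abs_def] by simp
  qed
  have I0: "(LINT p:?D|lborel. - v (fst p) (snd p) * X0 p + (\<Sum>i\<in>UNIV. g (fst p) (snd p) $ i * Y0 i p)) = integral\<^sup>L lborel I0"
    unfolding set_lebesgue_integral_def split I0_def[abs_def] ..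
  define B where "B i = 5 * (real (k i) * pi / (2 * R))" for i
  have lim1: "(\<lambda>m. integral\<^sup>L lborel (I m)) \<longlonglongrightarrow> integral\<^sup>L lborel I0"
  proof (rule integral_dominated_convergence)
    show "I0 \<in> borel_measurable lborel" "\<And>m. I m \<in> borel_measurable lborel"
      unfolding I0_def[abs_def] I_def[abs_def] by measurable
    show "integrable lborel (\<lambda>p. norm (V p) * A + (\<Sum>i\<in>UNIV. norm (G p $ i) * (A * B i)))"
      using Vi Gii by (intro Bochner_Integration.integrable_add Bochner_Integration.integrable_sum integrable_mult_left integrable_norm)
    show "AE p in lborel. norm (I m p) \<le> norm (V p) * A + (\<Sum>i\<in>UNIV. norm (G p $ i) * (A * B i))" for m
    proof (rule AE_I2)
      fix p
      show "norm (I m p) \<le> norm (V p) * A + (\<Sum>i\<in>UNIV. norm (G p $ i) * (A * B i))"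
      proof (cases "p \<in> ?D")
        case False
        then show ?thesis by (simp add: I_def V_def G_def)
      next
        case True
        then have A': "\<bar>\<alpha> (fst p)\<bar> \<le> A" "\<bar>\<alpha>' (fst p)\<bar> \<le> A" using A[of "fst p"] by auto
        then have A0: "A \<ge> 0" by linarith
        have "norm (X m p) \<le> A * 1"
          unfolding X_def norm_of_real abs_mult
          by (intro mult_mono A' prod_abs_le_one cut_mode_bound A0) auto
        moreover have "norm (Y m i p) \<le> A * (B i * 1)" for i
          unfolding Y_def norm_of_real abs_mult B_def
          by (intro mult_mono A' prod_abs_le_one cut_mode_bound A0 cut_mode_deriv_bound R) (use R in auto)
        ultimately have n: "norm (X m p) \<le> A" "\<And>i. norm (Y m i p) \<le> A * B i" by auto
        have "norm (I m p) \<le> norm (- V p * X m p) + (\<Sum>i\<in>UNIV. norm (G p $ i * Y m i p))"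
          unfolding I_def by (intro order_trans[OF norm_triangle_ineq] add_mono norm_sum) auto
        also have "\<dots> \<le> norm (V p) * A + (\<Sum>i\<in>UNIV. norm (G p $ i) * (A * B i))"
          using n by (intro add_mono sum_mono) (auto simp: norm_mult intro!: mult_left_mono)
        finally show ?thesis .
      qed
    qed
    show "AE p in lborel. (\<lambda>m. I m p) \<longlonglongrightarrow> I0 p"
    proof (rule AE_I2)
      fix p
      show "(\<lambda>m. I m p) \<longlonglongrightarrow> I0 p"
      proof (cases "p \<in> ?D")
        case False
        then show ?thesis by (simp add: I_def I0_def V_def G_def)
      next
        case True
        then have x: "\<bar>snd p $ i\<bar> < R" for i unfolding U_def by (auto simp: mem_interior_cube)
        note l = LIMSEQ_Suc[OF cut_mode_tendsto(1)[OF x]] LIMSEQ_Suc[OF cut_mode_tendsto(2)[OF x]]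
        show ?thesis
          unfolding I_def I0_def X_def Y_def X0_def Y0_def
          by (intro tendsto_intros l)
      qed
    qed
  qed
  have Fi: "integrable lborel (\<lambda>x. indicator (U R) x *\<^sub>R F x)"
  proof -
    have "L2_on (U R) F" by (rule L2_on_restrict[OF FL Us])
    from L2_on_set_integrable[OF this Us] show ?thesis
      using cube_emeasure_finite[of R] by (simp add: set_integrable_def U_def)
  qed
  have lim2: "(\<lambda>m. LINT x:U R|lborel. F x * complex_of_real (\<alpha> 0 * (\<Prod>i\<in>UNIV. cut_mode R (k i) (real (Suc m)) (x $ i))))
      \<longlonglongrightarrow> (LINT x:U R|lborel. F x * complex_of_real (\<alpha> 0 * tensor_mode R k x))"
    unfolding set_lebesgue_integral_def
  proof (rule integral_dominated_convergence)
    have [measurable]: "F \<in> borel_measurable borel" by (rule L2_on_UNIV_measurable[OF FL])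
    have pm: "(\<lambda>x::real^'n. f i (x $ i)) \<in> borel_measurable borel" if "\<And>i. f i \<in> borel_measurable borel" for f :: "'n \<Rightarrow> real \<Rightarrow> real" and i
      using measurable_compose[OF measurable_vec_nth that] .
    show "(\<lambda>x. indicator (U R) x *\<^sub>R (F x * complex_of_real (\<alpha> 0 * tensor_mode R k x))) \<in> borel_measurable lborel"
      "\<And>m. (\<lambda>x. indicator (U R) x *\<^sub>R (F x * complex_of_real (\<alpha> 0 * (\<Prod>i\<in>UNIV. cut_mode R (k i) (real (Suc m)) (x $ i))))) \<in> borel_measurable lborel"
      by measurable
    show "integrable lborel (\<lambda>x. norm (indicator (U R) x *\<^sub>R F x) * \<bar>\<alpha> 0\<bar>)"
      by (intro integrable_mult_left integrable_norm Fi)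
    have "\<bar>\<alpha> 0 * (\<Prod>i\<in>UNIV. cut_mode R (k i) (real (Suc m)) (x $ i))\<bar> \<le> \<bar>\<alpha> 0\<bar>" for m and x :: "real^'n"
      unfolding abs_mult by (intro mult_left_le prod_abs_le_one cut_mode_bound) auto
    then show "AE x in lborel. norm (indicator (U R) x *\<^sub>R (F x * complex_of_real (\<alpha> 0 * (\<Prod>i\<in>UNIV. cut_mode R (k i) (real (Suc m)) (x $ i))))) \<le> norm (indicator (U R) x *\<^sub>R F x) * \<bar>\<alpha> 0\<bar>" for m
      by (intro AE_I2) (simp only: norm_scaleR norm_mult norm_of_real mult.assoc, intro mult_left_mono, auto)
    show "AE x in lborel. (\<lambda>m. indicator (U R) x *\<^sub>R (F x * complex_of_real (\<alpha> 0 * (\<Prod>i\<in>UNIV. cut_mode R (k i) (real (Suc m)) (x $ i))))) \<longlonglongrightarrow> indicator (U R) x *\<^sub>R (F x * complex_of_real (\<alpha> 0 * tensor_mode R k x))"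
    proof (rule AE_I2)
      fix x :: "real^'n"
      show "(\<lambda>m. indicator (U R) x *\<^sub>R (F x * complex_of_real (\<alpha> 0 * (\<Prod>i\<in>UNIV. cut_mode R (k i) (real (Suc m)) (x $ i))))) \<longlonglongrightarrow> indicator (U R) x *\<^sub>R (F x * complex_of_real (\<alpha> 0 * tensor_mode R k x))"
      proof (cases "x \<in> U R")
        case True
        then have x: "\<bar>x $ i\<bar> < R" for i unfolding U_def by (auto simp: mem_interior_cube)
        note l = LIMSEQ_Suc[OF cut_mode_tendsto(1)[OF x]]
        show ?thesis by (intro tendsto_intros l)
      qed simp
    qed
  qed
  show ?thesis
    using LIMSEQ_unique[OF lim1 lim2[folded idm]] I0 unfolding X0_def Y0_def by simp
qed

section \<open>Integration by parts for functions vanishing on the boundary\<close>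

text \<open>The complement of the closed set is open, so the function is locally constant there.\<close>

lemma frechet_derivative_zero_off_support:
  fixes h :: "'a::euclidean_space \<Rightarrow> 'b::real_normed_vector"
  assumes "closed C" "\<And>x. x \<notin> C \<Longrightarrow> h x = 0" "x \<notin> C"
  shows "frechet_derivative h (at x) e = 0"
proof -
  have "(h has_derivative (\<lambda>_. 0)) (at x)"
    by (rule has_derivative_transform_within_open[where f = "\<lambda>_. 0" and s = "- C"])
      (use assms in \<open>auto intro: has_derivative_const\<close>)
  from frechet_derivative_at[OF this] show ?thesis by metis
qed

lemma compact_support_integrable:
  fixes h :: "'a::euclidean_space \<Rightarrow> complex"
  assumes h: "continuous_on UNIV h" and C: "compact C" "\<And>x. x \<notin> C \<Longrightarrow> h x = 0"
  shows "integrable lborel h" "\<exists>M\<ge>0. \<forall>x. norm (h x) \<le> M"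
proof -
  have "compact (h ` C)" by (intro compact_continuous_image C continuous_on_subset[OF h]) auto
  then have "bounded (h ` C)" by (rule compact_imp_bounded)
  then obtain M where M: "M > 0" "\<And>x. x \<in> C \<Longrightarrow> norm (h x) \<le> M"
    by (auto simp: bounded_pos)
  have le: "norm (h x) \<le> M * indicator C x" for x using M C by (cases "x \<in> C") auto
  show "\<exists>M\<ge>0. \<forall>x. norm (h x) \<le> M"
    using M C by (intro exI[of _ M]) (metis less_eq_real_def norm_zero)
  show "integrable lborel h"
  proof (rule Bochner_Integration.integrable_bound)
    show "integrable lborel (\<lambda>x. M * indicator C x)"
      using C(1) by (intro integrable_mult_right integrable_real_indicator)
        (use emeasure_bounded_finite[OF compact_imp_bounded[OF C(1)]] borel_compact[OF C(1)] in auto)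
    show "h \<in> borel_measurable lborel" using h by (simp add: borel_measurable_continuous_onI)
    show "AE x in lborel. norm (h x) \<le> norm (M * indicator C x)"
      using le M by (intro AE_I2) (auto simp: abs_mult)
  qed
qed

text \<open>Translation invariance: the difference quotients in direction \<open>e\<close> have integral zero and converge boundedly with
  uniformly bounded supports.\<close>

lemma integral_partial_derivative_zero:
  fixes h :: "'a::euclidean_space \<Rightarrow> complex"
  assumes d: "\<And>x. h differentiable (at x)"
    and c: "continuous_on UNIV (\<lambda>x. frechet_derivative h (at x) e)"
    and C: "compact C" "\<And>x. x \<notin> C \<Longrightarrow> h x = 0"
  shows "(LINT x|lborel. frechet_derivative h (at x) e) = 0"
proof -
  let ?D = "\<lambda>x. frechet_derivative h (at x) e"
  have hc: "continuous_on UNIV h"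
    using d by (auto intro!: continuous_at_imp_continuous_on differentiable_imp_continuous_within)
  have D0: "?D x = 0" if "x \<notin> C" for x
    using frechet_derivative_zero_off_support[OF compact_imp_closed[OF C(1)] C(2) that] .
  obtain M where M: "M \<ge> 0" "\<And>x. norm (?D x) \<le> M" using compact_support_integrable(2)[OF c C(1) D0] by blast
  have hi: "integrable lborel h" by (rule compact_support_integrable(1)[OF hc C])
  obtain \<rho> where \<rho>: "\<And>x. x \<in> C \<Longrightarrow> norm x \<le> \<rho>"
    using compact_imp_bounded[OF C(1)] by (auto simp: bounded_iff)
  have dir: "((\<lambda>\<sigma>. h (x + \<sigma> *\<^sub>R e)) has_derivative (\<lambda>s. s *\<^sub>R ?D (x + \<sigma> *\<^sub>R e))) (at \<sigma>)" for x \<sigma>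
  proof -
    have "(h has_derivative frechet_derivative h (at (x + \<sigma> *\<^sub>R e))) (at (x + \<sigma> *\<^sub>R e))"
      using d by (simp add: frechet_derivative_works)
    moreover have "((\<lambda>\<sigma>. x + \<sigma> *\<^sub>R e) has_derivative (\<lambda>s. s *\<^sub>R e)) (at \<sigma>)"
      by (auto intro!: derivative_eq_intros)
    ultimately have "((\<lambda>\<sigma>. h (x + \<sigma> *\<^sub>R e)) has_derivative (\<lambda>s. frechet_derivative h (at (x + \<sigma> *\<^sub>R e)) (s *\<^sub>R e))) (at \<sigma>)"
      by (rule has_derivative_compose[rotated])
    then show ?thesis
      using linear_frechet_derivative[OF d] by (simp add: linear_scale)
  qed
  have lip: "norm (h (x + s *\<^sub>R e) - h x) \<le> M * \<bar>s\<bar>" for x s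
  proof -
    have "onorm (\<lambda>s. s *\<^sub>R ?D (x + \<sigma> *\<^sub>R e)) \<le> M" for \<sigma>
      using M by (intro onorm_bound) (auto simp: mult.commute[of M] intro!: mult_left_mono)
    then have "norm ((\<lambda>\<sigma>. h (x + \<sigma> *\<^sub>R e)) s - (\<lambda>\<sigma>. h (x + \<sigma> *\<^sub>R e)) 0) \<le> M * norm (s - 0)"
      by (intro differentiable_bound[of UNIV _ "\<lambda>\<sigma> s. s *\<^sub>R ?D (x + \<sigma> *\<^sub>R e)"] dir) auto
    then show ?thesis by simp
  qed
  let ?s = "\<lambda>n. inverse (real (Suc n))"
  let ?q = "\<lambda>n x. (h (x + ?s n *\<^sub>R e) - h x) /\<^sub>R ?s n"
  have "(\<lambda>n. LINT x|lborel. ?q n x) \<longlonglongrightarrow> (LINT x|lborel. ?D x)"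
  proof (rule integral_dominated_convergence)
    show "?D \<in> borel_measurable lborel" using c by (simp add: borel_measurable_continuous_onI)
    have [measurable]: "h \<in> borel_measurable borel" using hc by (rule borel_measurable_continuous_onI)
    show "?q n \<in> borel_measurable lborel" for n by measurable
    show "integrable lborel (\<lambda>x. M * indicator (cball (0::'a) (\<rho> + norm e)) x)"
      by (intro integrable_mult_right integrable_real_indicator) (use emeasure_bounded_finite[OF bounded_cball, of "0::'a" "\<rho> + norm e"] in auto)
    show "AE x in lborel. norm (?q n x) \<le> M * indicator (cball 0 (\<rho> + norm e)) x" for n
    proof (rule AE_I2)
      fix x :: 'a
      show "norm (?q n x) \<le> M * indicator (cball 0 (\<rho> + norm e)) x"
      proof (cases "norm x \<le> \<rho> + norm e")
        case True
        have "norm (w /\<^sub>R s) \<le> M" if "norm w \<le> M * \<bar>s\<bar>" "s > 0" for w :: complex and s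
          using that by (simp add: field_simps)
        then have "norm (?q n x) \<le> M" by this (rule lip, simp)
        then show ?thesis using True by simp
      next
        case False
        have "norm x \<le> norm (x + ?s n *\<^sub>R e) + norm (?s n *\<^sub>R e)" by (metis add_diff_cancel_right' norm_triangle_ineq4)
        moreover have "norm (?s n *\<^sub>R e) \<le> 1 * norm e"
          unfolding norm_scaleR by (intro mult_right_mono) (auto simp: field_simps)
        ultimately have "\<rho> < norm (x + ?s n *\<^sub>R e)" "\<rho> < norm x"
          using False norm_ge_zero[of e] by linarith+
        then have "h (x + ?s n *\<^sub>R e) = 0" "h x = 0" using \<rho> C(2) by (meson not_le)+
        then show ?thesis using M by simp
      qed
    qed
    show "AE x in lborel. (\<lambda>n. ?q n x) \<longlonglongrightarrow> ?D x"
    proof (rule AE_I2)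
      fix x
      have ss: "filterlim ?s (at 0) sequentially"
        using LIMSEQ_inverse_real_of_nat by (auto simp: filterlim_at)
      have dd: "((\<lambda>\<sigma>. h (x + \<sigma> *\<^sub>R e)) has_derivative (\<lambda>s. s *\<^sub>R ?D x)) (at 0)" using dir[of x 0] by simp
      have "((\<lambda>\<sigma>. Re (h (x + \<sigma> *\<^sub>R e))) has_real_derivative Re (?D x)) (at 0)"
        using has_derivative_Re[OF dd] by (simp add: has_field_derivative_def mult_commute_abs)
      from filterlim_compose[OF this[unfolded DERIV_def] ss]
      have re: "(\<lambda>n. Re (?q n x)) \<longlonglongrightarrow> Re (?D x)" by (simp add: divide_inverse mult.commute)
      have "((\<lambda>\<sigma>. Im (h (x + \<sigma> *\<^sub>R e))) has_real_derivative Im (?D x)) (at 0)"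
        using has_derivative_Im[OF dd] by (simp add: has_field_derivative_def mult_commute_abs)
      from filterlim_compose[OF this[unfolded DERIV_def] ss]
      have im: "(\<lambda>n. Im (?q n x)) \<longlonglongrightarrow> Im (?D x)" by (simp add: divide_inverse mult.commute)
      show "(\<lambda>n. ?q n x) \<longlonglongrightarrow> ?D x" using re im by (simp add: tendsto_complex_iff)
    qed
  qed
  moreover have "(LINT x|lborel. ?q n x) = 0" for n
  proof -
    have [measurable]: "h \<in> borel_measurable borel" using hc by (rule borel_measurable_continuous_onI)
    have A: "(LINT x|distr lborel borel ((+) c). h x) = (LINT x|lborel. h (c + x))" for c
      by (rule integral_distr) auto
    have A': "(LINT x|lborel. h (x + c)) = (LINT x|lborel. h x)" for c
      using A[of c] by (simp add: lborel_distr_plus add.commute[of _ c])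
    have B: "integrable (distr lborel borel ((+) c)) h \<longleftrightarrow> integrable lborel (\<lambda>x. h (c + x))" for c
      by (rule integrable_distr_eq) auto
    have B': "integrable lborel (\<lambda>x. h (x + c))" for c
      using B[of c] hi by (simp add: lborel_distr_plus add.commute[of _ c])
    show ?thesis using hi A' B' by simp
  qed
  ultimately have "(\<lambda>n. 0) \<longlonglongrightarrow> (LINT x|lborel. ?D x)" by (simp only:)
  then show ?thesis by (simp add: LIMSEQ_const_iff)
qed

text \<open>The product of \<open>\<phi>\<close> and \<open>f\<close> has compact support, so the integral of its partial derivative vanishes.\<close>

lemma test_function_parts:
  fixes \<phi> :: "real^'n \<Rightarrow> complex" and f :: "real^'n \<Rightarrow> real"
  assumes \<phi>: "test_function U \<phi>" and U: "U \<in> sets borel"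
    and f: "\<And>x. (f has_derivative f' x) (at x)" "continuous_on UNIV (\<lambda>x. f' x (axis i 1))"
  shows "(LINT x:U|lborel. grad \<phi> x $ i * complex_of_real (f x)) = - (LINT x:U|lborel. \<phi> x * complex_of_real (f' x (axis i 1)))"
proof -
  let ?e = "axis i 1 :: real^'n"
  obtain C where C: "compact C" "C \<subseteq> U" "\<And>x. x \<notin> C \<Longrightarrow> \<phi> x = 0"
    and Ck: "\<And>k. C_k k \<phi>" using \<phi> by (auto simp: test_function_def)
  have \<phi>d: "\<phi> differentiable (at x)" for x using Ck[of "Suc 0"] by simp
  have e: "?e \<in> Basis" by (auto simp: Basis_vec_def)
  have \<phi>'c: "continuous_on UNIV (\<lambda>x. frechet_derivative \<phi> (at x) ?e)" using Ck[of "Suc 0"] e by simp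
  have \<phi>c: "continuous_on UNIV \<phi>"
    using \<phi>d by (auto intro!: continuous_at_imp_continuous_on differentiable_imp_continuous_within)
  have fc: "continuous_on UNIV f"
    using f(1) by (meson continuous_at_imp_continuous_on has_derivative_continuous)
  let ?h = "\<lambda>x. \<phi> x * complex_of_real (f x)"
  have hd: "(?h has_derivative (\<lambda>b. \<phi> x * complex_of_real (f' x b) + frechet_derivative \<phi> (at x) b * complex_of_real (f x))) (at x)" for x
    using \<phi>d f by (intro has_derivative_mult has_derivative_of_real) (auto simp: frechet_derivative_works)
  have he: "frechet_derivative ?h (at x) ?e = \<phi> x * complex_of_real (f' x ?e) + frechet_derivative \<phi> (at x) ?e * complex_of_real (f x)" for x
    using frechet_derivative_at[OF hd] by metis
  have c1: "continuous_on UNIV (\<lambda>x. \<phi> x * complex_of_real (f' x ?e))" and c2: "continuous_on UNIV (\<lambda>x. frechet_derivative \<phi> (at x) ?e * complex_of_real (f x))"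
    by (intro continuous_intros \<phi>c \<phi>'c fc f(2))+
  have \<phi>'0: "frechet_derivative \<phi> (at x) ?e = 0" if "x \<notin> C" for x
    using frechet_derivative_zero_off_support[OF compact_imp_closed[OF C(1)] C(3) that] .
  have i1: "integrable lborel (\<lambda>x. \<phi> x * complex_of_real (f' x ?e))" and i2: "integrable lborel (\<lambda>x. frechet_derivative \<phi> (at x) ?e * complex_of_real (f x))"
    by (rule compact_support_integrable(1)[OF c1 C(1)], simp add: C(3), rule compact_support_integrable(1)[OF c2 C(1)], simp add: \<phi>'0)
  have "(LINT x|lborel. frechet_derivative ?h (at x) ?e) = 0"
  proof (rule integral_partial_derivative_zero[OF _ _ C(1)])
    show "?h differentiable (at x)" for x using hd by (auto simp: differentiable_def)
    show "continuous_on UNIV (\<lambda>x. frechet_derivative ?h (at x) ?e)" unfolding he by (intro continuous_on_add c1 c2)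
  qed (simp add: C)
  then have z: "(LINT x|lborel. \<phi> x * complex_of_real (f' x ?e)) + (LINT x|lborel. frechet_derivative \<phi> (at x) ?e * complex_of_real (f x)) = 0"
    unfolding he using i1 i2 by simp
  have "(LINT x:U|lborel. \<phi> x * complex_of_real (f' x ?e)) = (LINT x|lborel. \<phi> x * complex_of_real (f' x ?e))"
    unfolding set_lebesgue_integral_def using C by (intro Bochner_Integration.integral_cong) (auto split: split_indicator)
  moreover have "(LINT x:U|lborel. grad \<phi> x $ i * complex_of_real (f x)) = (LINT x|lborel. frechet_derivative \<phi> (at x) ?e * complex_of_real (f x))"
    unfolding set_lebesgue_integral_def grad_def using C \<phi>'0 by (intro Bochner_Integration.integral_cong) (auto split: split_indicator)
  ultimately show ?thesis using z by (simp add: eq_neg_iff_add_eq_0 add.commute)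
qed

text \<open>On a set of finite measure mean-square convergence implies convergence of integrals against bounded functions. The
  linear map \<open>L\<close> selects a component of vector-valued functions.\<close>

lemma L2_tendsto_integral:
  fixes u :: "'a::euclidean_space \<Rightarrow> 'b::euclidean_space" and L :: "'b \<Rightarrow> complex"
  assumes lim: "L2_tendsto U \<phi> u" and u: "L2_on U u" and U: "U \<in> sets borel" "emeasure lborel U < \<infinity>"
    and q: "q \<in> borel_measurable borel" "\<And>x. \<bar>q x\<bar> \<le> B"
    and L: "bounded_linear L" "\<And>y. norm (L y) \<le> norm y"
  shows "(\<lambda>n. LINT x:U|lborel. L (\<phi> n x) * complex_of_real (q x)) \<longlonglongrightarrow> (LINT x:U|lborel. L (u x) * complex_of_real (q x))"
proof -
  have B: "B \<ge> 0" using q(2)[of undefined] by linarith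
  interpret L: bounded_linear L by (rule L(1))
  define N where "N n = L2_norm U (\<lambda>x. \<phi> n x - u x)" for n
  have N0: "N \<longlonglongrightarrow> 0" and dL: "\<And>n. L2_on U (\<lambda>x. \<phi> n x - u x)"
    using lim by (auto simp: L2_tendsto_def N_def[abs_def])
  have Nn: "N n \<ge> 0" for n by (simp add: N_def L2_norm_nonneg)
  have N2: "(LINT x:U|lborel. (norm (\<phi> n x - u x))\<^sup>2) = (N n)\<^sup>2" for n
    unfolding N_def L2_norm_def by (subst real_sqrt_pow2) (simp_all add: set_lebesgue_integral_def)
  have di: "integrable lborel (\<lambda>x. indicator U x *\<^sub>R (\<phi> n x - u x))" and ui: "integrable lborel (\<lambda>x. indicator U x *\<^sub>R u x)" for n
    using L2_on_set_integrable[OF dL U] L2_on_set_integrable[OF u U] by (auto simp: set_integrable_def)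
  have Li: "integrable lborel (\<lambda>x. indicator U x *\<^sub>R (L (f x) * complex_of_real (q x)))" if "integrable lborel (\<lambda>x. indicator U x *\<^sub>R f x)" for f
  proof (rule Bochner_Integration.integrable_bound[OF integrable_mult_left[OF integrable_norm[OF that], of B]])
    have "(\<lambda>x. L (indicator U x *\<^sub>R f x)) \<in> borel_measurable lborel"
      using integrable_bounded_linear[OF L(1) that] by (rule borel_measurable_integrable)
    then have "(\<lambda>x. L (indicator U x *\<^sub>R f x) * complex_of_real (q x)) \<in> borel_measurable lborel"
      using q(1) by measurable
    then show "(\<lambda>x. indicator U x *\<^sub>R (L (f x) * complex_of_real (q x))) \<in> borel_measurable lborel"
      by (simp add: L.scaleR)
    show "AE x in lborel. norm (indicator U x *\<^sub>R (L (f x) * complex_of_real (q x))) \<le> norm (norm (indicator U x *\<^sub>R f x) * B)"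
      using q(2) L(2) B by (intro AE_I2) (auto simp: norm_mult abs_mult intro!: mult_mono split: split_indicator)
  qed
  define \<mu> where "\<mu> = measure lborel U"
  (* In a <= e + a^2 / e, a weight e slightly larger than the mean-square distance N n makes both terms tend to zero.
     The summand 1/(n+1) keeps e positive. *)
  define \<epsilon> where "\<epsilon> n = N n + inverse (real (Suc n))" for n
  have \<epsilon>: "\<epsilon> n > 0" for n using Nn[of n] by (simp add: \<epsilon>_def add_nonneg_pos)
  have bound: "norm ((LINT x:U|lborel. L (\<phi> n x) * complex_of_real (q x)) - (LINT x:U|lborel. L (u x) * complex_of_real (q x))) \<le> B * (\<epsilon> n * \<mu> + N n)" for n
  proof -
    have \<phi>i: "integrable lborel (\<lambda>x. indicator U x *\<^sub>R \<phi> n x)"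
      using Bochner_Integration.integrable_add[OF di[of n] ui] by (simp add: scaleR_diff_right)
    have "(LINT x:U|lborel. L (\<phi> n x) * complex_of_real (q x)) - (LINT x:U|lborel. L (u x) * complex_of_real (q x))
        = (LINT x|lborel. indicator U x *\<^sub>R (L (\<phi> n x - u x) * complex_of_real (q x)))"
      unfolding set_lebesgue_integral_def
      by (subst Bochner_Integration.integral_diff[symmetric, OF Li[OF \<phi>i] Li[OF ui]])
        (auto simp: L.diff algebra_simps scaleR_diff_right intro!: Bochner_Integration.integral_cong)
    also have "norm \<dots> \<le> (LINT x|lborel. norm (indicator U x *\<^sub>R (L (\<phi> n x - u x) * complex_of_real (q x))))"
      by (rule integral_norm_bound)
    also have "\<dots> \<le> (LINT x|lborel. B * (\<epsilon> n * indicator U x + (indicator U x *\<^sub>R (norm (\<phi> n x - u x))\<^sup>2) / \<epsilon> n))"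
    proof (rule integral_mono)
      show "integrable lborel (\<lambda>x. norm (indicator U x *\<^sub>R (L (\<phi> n x - u x) * complex_of_real (q x))))"
        by (intro integrable_norm Li di)
      show "integrable lborel (\<lambda>x. B * (\<epsilon> n * indicator U x + (indicator U x *\<^sub>R (norm (\<phi> n x - u x))\<^sup>2) / \<epsilon> n))"
        using U dL[of n] by (intro integrable_mult_right Bochner_Integration.integrable_add integrable_divide integrable_real_indicator)
          (auto simp: L2_on_def set_integrable_def)
      fix x
      have a: "a \<le> \<epsilon> n + a\<^sup>2 / \<epsilon> n" if "a \<ge> 0" for a
      proof (cases "a \<le> \<epsilon> n")
        case True then show ?thesis using \<epsilon>[of n] by (simp add: add_increasing2)
      next
        case False
        then have "a * \<epsilon> n \<le> a\<^sup>2" using that by (simp add: power2_eq_square mult_left_mono)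
        then have "a \<le> a\<^sup>2 / \<epsilon> n" using \<epsilon>[of n] by (simp add: field_simps)
        then show ?thesis using \<epsilon>[of n] by linarith
      qed
      have "norm (L (\<phi> n x - u x)) * \<bar>q x\<bar> \<le> norm (\<phi> n x - u x) * B"
        using q(2) L(2) B by (intro mult_mono) auto
      also have "\<dots> \<le> (\<epsilon> n + (norm (\<phi> n x - u x))\<^sup>2 / \<epsilon> n) * B" using B by (intro mult_right_mono a) auto
      finally show "norm (indicator U x *\<^sub>R (L (\<phi> n x - u x) * complex_of_real (q x))) \<le> B * (\<epsilon> n * indicator U x + (indicator U x *\<^sub>R (norm (\<phi> n x - u x))\<^sup>2) / \<epsilon> n)"
        by (simp add: norm_mult mult.commute split: split_indicator)
    qed
    also have "\<dots> = B * (\<epsilon> n * \<mu> + (N n)\<^sup>2 / \<epsilon> n)"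
      using U dL[of n] N2[of n] unfolding \<mu>_def
      by (subst integral_mult_right_zero, subst Bochner_Integration.integral_add)
        (auto simp: L2_on_def set_integrable_def set_lebesgue_integral_def)
    also have "\<dots> \<le> B * (\<epsilon> n * \<mu> + N n)"
    proof -
      have "(N n)\<^sup>2 \<le> N n * \<epsilon> n" using Nn[of n] by (simp add: \<epsilon>_def power2_eq_square distrib_left)
      then have "(N n)\<^sup>2 / \<epsilon> n \<le> N n" using \<epsilon>[of n] by (simp add: divide_le_eq)
      then show ?thesis using B by (intro mult_left_mono add_left_mono)
    qed
    finally show ?thesis .
  qed
  have "(\<lambda>n. B * (\<epsilon> n * \<mu> + N n)) \<longlonglongrightarrow> B * ((0 + 0) * \<mu> + 0)"
    unfolding \<epsilon>_def by (intro tendsto_intros N0 LIMSEQ_inverse_real_of_nat)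
  then have "(\<lambda>n. B * (\<epsilon> n * \<mu> + N n)) \<longlonglongrightarrow> 0" by simp
  then have "(\<lambda>n. (LINT x:U|lborel. L (\<phi> n x) * complex_of_real (q x)) - (LINT x:U|lborel. L (u x) * complex_of_real (q x))) \<longlonglongrightarrow> 0"
    by (rule Lim_null_comparison[rotated]) (intro always_eventually allI bound)
  then show ?thesis by (simp add: LIM_zero_iff)
qed

text \<open>The boundary term vanishes although \<open>f\<close> need not vanish on the boundary: \<open>u\<close> is a limit of compactly supported
  functions together with its gradient.\<close>

lemma H01_parts:
  fixes u :: "real^'n \<Rightarrow> complex" and f :: "real^'n \<Rightarrow> real"
  assumes H: "H01_with_gradient U u g" and U: "U \<in> sets borel" "emeasure lborel U < \<infinity>"
    and f: "\<And>x. (f has_derivative f' x) (at x)" "continuous_on UNIV (\<lambda>x. f' x (axis i 1))"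
    and B: "\<And>x. \<bar>f x\<bar> \<le> B" "\<And>x. \<bar>f' x (axis i 1)\<bar> \<le> B'"
  shows "(LINT x:U|lborel. g x $ i * complex_of_real (f x)) = - (LINT x:U|lborel. u x * complex_of_real (f' x (axis i 1)))"
proof -
  obtain \<phi> where \<phi>: "\<And>n. test_function U (\<phi> n)" "L2_tendsto U \<phi> u" "L2_tendsto U (\<lambda>n. grad (\<phi> n)) g"
    and L: "L2_on U u" "L2_on U g"
    using H by (auto simp: H01_with_gradient_def)
  have fc: "f \<in> borel_measurable borel" "(\<lambda>x. f' x (axis i 1)) \<in> borel_measurable borel"
    using f by (auto intro!: borel_measurable_continuous_onI) (meson continuous_at_imp_continuous_on has_derivative_continuous)
  have 1: "(\<lambda>n. LINT x:U|lborel. grad (\<phi> n) x $ i * complex_of_real (f x)) \<longlonglongrightarrow> (LINT x:U|lborel. g x $ i * complex_of_real (f x))"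
    by (rule L2_tendsto_integral[OF \<phi>(3) L(2) U fc(1) B(1) bounded_linear_vec_nth]) (rule Finite_Cartesian_Product.norm_nth_le)
  have 2: "(\<lambda>n. LINT x:U|lborel. \<phi> n x * complex_of_real (f' x (axis i 1))) \<longlonglongrightarrow> (LINT x:U|lborel. u x * complex_of_real (f' x (axis i 1)))"
    by (rule L2_tendsto_integral[OF \<phi>(2) L(1) U fc(2) B(2) bounded_linear_ident]) simp
  show ?thesis
    using LIMSEQ_unique[OF 1] tendsto_minus[OF 2] unfolding test_function_parts[OF \<phi>(1) U(1) f] by blast
qed

section \<open>A scalar evolution equation in weak form\<close>

text \<open>The positive and the negative part of \<open>h\<close> are densities of measures that agree on boxes, hence everywhere.\<close>

lemma AE_zero_of_box_integrals:
  fixes h :: "'a::euclidean_space \<Rightarrow> real"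
  assumes h: "integrable lborel h" and z: "\<And>a b. (LINT x:box a b|lborel. h x) = 0"
  shows "AE x in lborel. h x = 0"
proof -
  have [measurable]: "h \<in> borel_measurable borel" using h by (auto dest: borel_measurable_integrable)
  let ?M = "density lborel (\<lambda>x. ennreal (h x))" and ?N = "density lborel (\<lambda>x. ennreal (- h x))"
  have fin: "(\<integral>\<^sup>+x. ennreal (h x) \<partial>lborel) \<noteq> \<infinity>"
    using h real_integrable_def by blast
  have "?M = ?N"
  proof (rule measure_eqI_generator_eq[where E = "range (\<lambda>(a, b). box a b::'a set)" and \<Omega> = UNIV and A = "\<lambda>i::nat. box (- (real i *\<^sub>R One)) (real i *\<^sub>R One)"])
    show "Int_stable (range (\<lambda>(a, b). box a b::'a set))"
      by (auto simp: Int_stable_def box_Int_box)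
    show "sets ?M = sigma_sets UNIV (range (\<lambda>(a, b). box a b))" "sets ?N = sigma_sets UNIV (range (\<lambda>(a, b). box a b))"
      by (simp_all add: borel_eq_box)
    show "(\<Union>i::nat. box (- (real i *\<^sub>R One)) (real i *\<^sub>R One)) = (UNIV :: 'a set)" by (rule UN_box_eq_UNIV)
    show "emeasure ?M (box (- (real i *\<^sub>R One)) (real i *\<^sub>R One)) \<noteq> \<infinity>" for i
    proof -
      have "emeasure ?M (box (- (real i *\<^sub>R One)) (real i *\<^sub>R One)) \<le> (\<integral>\<^sup>+x. ennreal (h x) \<partial>lborel)"
        by (subst emeasure_density) (auto intro!: nn_integral_mono split: split_indicator)
      then show ?thesis using fin by (auto simp: top_unique)
    qed
    fix X assume "X \<in> range (\<lambda>(a, b). box a b::'a set)"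
    then obtain a b where X: "X = box a b" by auto
    have i: "integrable lborel (\<lambda>x. indicator X x *\<^sub>R h x)"
      using h by (intro integrable_mult_indicator) (auto simp: X)
    have e1: "emeasure ?M X = (\<integral>\<^sup>+x. ennreal (indicator X x *\<^sub>R h x) \<partial>lborel)"
      by (subst emeasure_density) (auto simp: X intro!: nn_integral_cong split: split_indicator)
    have e2: "emeasure ?N X = (\<integral>\<^sup>+x. ennreal (- (indicator X x *\<^sub>R h x)) \<partial>lborel)"
      by (subst emeasure_density) (auto simp: X intro!: nn_integral_cong split: split_indicator)
    have "enn2real (emeasure ?M X) - enn2real (emeasure ?N X) = 0"
      using real_lebesgue_integral_def[OF i] z[of a b] unfolding e1 e2 by (simp add: set_lebesgue_integral_def X)
    moreover have "emeasure ?M X < \<infinity>" "emeasure ?N X < \<infinity>"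
      using i unfolding e1 e2 real_integrable_def by (auto simp: less_top)
    ultimately show "emeasure ?M X = emeasure ?N X"
      by (metis eq_iff_diff_eq_0 ennreal_enn2real infinity_ennreal_def)
  qed auto
  then have "AE x in lborel. ennreal (h x) = ennreal (- h x)"
    by (intro sigma_finite_measure.density_unique[OF lborel.sigma_finite_measure_axioms]) auto
  then show ?thesis
  proof eventually_elim
    case (elim x)
    then show ?case by (cases "h x \<ge> 0") (auto simp: ennreal_neg)
  qed
qed

lemma AE_zero_of_box_integrals_complex:
  fixes h :: "'a::euclidean_space \<Rightarrow> complex"
  assumes h: "integrable lborel h" and z: "\<And>a b. (LINT x:box a b|lborel. h x) = 0"
  shows "AE x in lborel. h x = 0"
proof -
  have i: "integrable lborel (\<lambda>x. indicator (box a b) x *\<^sub>R h x)" for a b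
    using h by (intro integrable_mult_indicator) auto
  have "AE x in lborel. Re (h x) = 0"
  proof (rule AE_zero_of_box_integrals)
    show "(LINT x:box a b|lborel. Re (h x)) = 0" for a b
      using z[of a b] integral_Re[OF i[of a b]] by (simp add: set_lebesgue_integral_def)
  qed (use h in auto)
  moreover have "AE x in lborel. Im (h x) = 0"
  proof (rule AE_zero_of_box_integrals)
    show "(LINT x:box a b|lborel. Im (h x)) = 0" for a b
      using z[of a b] integral_Im[OF i[of a b]] by (simp add: set_lebesgue_integral_def)
  qed (use h in auto)
  ultimately show ?thesis by eventually_elim (simp add: complex_eq_iff)
qed

text \<open>On positive times this is a constant multiple of \<open>exp (\<mu> t) (b - t)\<close> for \<open>t < b\<close>, with the corner at \<open>b\<close> smoothed. The
  second factor is equal to that constant for \<open>t \<ge> 0\<close> and vanishes for \<open>t \<le> -2\<close>, which makes the support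
  compact. The exponential is the integrating factor of \<open>y' = - \<mu> y\<close>.\<close>

definition time_test :: "real \<Rightarrow> real \<Rightarrow> real \<Rightarrow> real \<Rightarrow> real" where
  "time_test \<mu> b n t = exp (\<mu> * t) * flat_step (1 - 2 * flat_step (- t)) * ((b - t) * flat_step (n * (b - t)))"

definition time_test_deriv :: "real \<Rightarrow> real \<Rightarrow> real \<Rightarrow> real \<Rightarrow> real" where
  "time_test_deriv \<mu> b n t =
     (\<mu> * exp (\<mu> * t) * flat_step (1 - 2 * flat_step (- t)) + exp (\<mu> * t) * (flat_step_deriv (1 - 2 * flat_step (- t)) * (2 * flat_step_deriv (- t))))
       * ((b - t) * flat_step (n * (b - t)))
     - exp (\<mu> * t) * flat_step (1 - 2 * flat_step (- t)) * (flat_step (n * (b - t)) + (b - t) * (n * flat_step_deriv (n * (b - t))))"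

lemma time_test_has_derivative: "(time_test \<mu> b n has_real_derivative time_test_deriv \<mu> b n t) (at t)"
proof -
  note f = DERIV_chain'[OF _ flat_step_has_derivative]
  have 1: "((\<lambda>t. flat_step (- t)) has_real_derivative flat_step_deriv (- t) * (- 1)) (at t)"
    by (rule f) (auto intro!: derivative_eq_intros)
  have 2: "((\<lambda>t. flat_step (1 - 2 * flat_step (- t))) has_real_derivative flat_step_deriv (1 - 2 * flat_step (- t)) * (2 * flat_step_deriv (- t))) (at t)"
    by (rule f) (rule DERIV_cong[OF DERIV_diff[OF DERIV_const DERIV_mult[OF DERIV_const 1]]], simp)
  have 3: "((\<lambda>t. flat_step (n * (b - t))) has_real_derivative flat_step_deriv (n * (b - t)) * (- n)) (at t)"
    by (rule f) (auto intro!: derivative_eq_intros)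
  have 4: "((\<lambda>t. exp (\<mu> * t)) has_real_derivative \<mu> * exp (\<mu> * t)) (at t)"
    by (auto intro!: derivative_eq_intros)
  have 5: "((\<lambda>t. b - t) has_real_derivative - 1) (at t)"
    by (auto intro!: derivative_eq_intros)
  show ?thesis
    unfolding time_test_def[abs_def] time_test_deriv_def
    by (rule DERIV_cong[OF DERIV_mult[OF DERIV_mult[OF 4 2] DERIV_mult[OF 5 3]]]) (simp add: algebra_simps)
qed

lemma time_test_smooth: "smooth_fun (time_test \<mu> b n)"
proof -
  have "smooth_fun (\<lambda>t. exp (\<mu> * t + 0) * flat_step (1 - 2 * flat_step ((- 1) * t + 0)) * (((- 1) * t + b) * flat_step ((- n) * t + n * b)))"
    by (intro smooth_mult smooth_compose[OF smooth_real_exp] smooth_compose[OF smooth_real_flat_step] smooth_diff smooth_const smooth_affine)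
  then show ?thesis by (simp add: time_test_def[abs_def] algebra_simps)
qed

lemma time_test_support:
  assumes n: "n > 0" and t: "t \<notin> {-2..b}"
  shows "time_test \<mu> b n t = 0"
proof (cases "t > b")
  case True
  then have "n * (b - t) < 0" using n by (simp add: mult_pos_neg)
  then show ?thesis by (simp add: time_test_def flat_step_def)
next
  case False
  then have t2: "t < -2" using t by auto
  have "1/2 \<le> exp (- (1/2) :: real)" using exp_ge_add_one_self[of "- (1/2) :: real"] by simp
  also have "\<dots> \<le> exp (- 1 / (- t))" using t2 by (simp add: field_simps)
  finally have "1 - 2 * flat_step (- t) \<le> 0" using t2 by (simp add: flat_step_def)
  then show ?thesis by (simp add: time_test_def flat_step_def[of "1 - _"])
qed

text \<open>The combination to which the weak equation reduces; the derivative falling on the exponential cancels.\<close>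

lemma time_test_positive_time:
  assumes t: "t > 0"
  shows "\<mu> * time_test \<mu> b n t - time_test_deriv \<mu> b n t
     = exp (\<mu> * t) * flat_step 1 * (flat_step (n * (b - t)) + (b - t) * (n * flat_step_deriv (n * (b - t))))"
proof -
  have "flat_step (- t) = 0" "flat_step_deriv (- t) = 0" using t by (simp_all add: flat_step_def flat_step_deriv_def)
  then show ?thesis by (simp add: time_test_def time_test_deriv_def algebra_simps)
qed

lemma flat_step_ramp_bounds:
  "0 \<le> flat_step s + s * flat_step_deriv s" "flat_step s + s * flat_step_deriv s \<le> 3"
proof -
  have "0 \<le> s * flat_step_deriv s" by (auto simp: flat_step_deriv_def)
  moreover have "s * flat_step_deriv s \<le> 2"
    using flat_step_deriv_bounds[of s] by (simp add: distrib_right)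
  ultimately show "0 \<le> flat_step s + s * flat_step_deriv s" "flat_step s + s * flat_step_deriv s \<le> 3"
    using flat_step_bounds[of s] by linarith+
qed

lemma flat_step_ramp_tendsto:
  assumes "c > 0"
  shows "(\<lambda>m. flat_step (real (Suc m) * c) + c * (real (Suc m) * flat_step_deriv (real (Suc m) * c))) \<longlonglongrightarrow> 1"
proof -
  have "(\<lambda>m. exp (- 1 / (real (Suc m) * c)) + c * (real (Suc m) * (exp (- 1 / (real (Suc m) * c)) / (real (Suc m) * c)\<^sup>2))) \<longlonglongrightarrow> 1"
    using assms by real_asymp
  moreover have "real (Suc m) * c > 0" for m using assms by simp
  ultimately show ?thesis by (simp only: flat_step_def flat_step_deriv_def if_True)
qed

text \<open>Testing with \<open>time_test \<mu> b n\<close> and letting \<open>n\<close> tend to infinity gives \<open>\<integral>\<^sub>0\<^sup>b (exp (\<mu> t) y(t) - c) dt = 0\<close> for every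
  \<open>b < T\<close>, so the integrand vanishes almost everywhere.\<close>

lemma time_ode_weak:
  fixes y :: "real \<Rightarrow> complex"
  assumes y: "set_integrable lborel {0<..<T} y"
    and id: "\<And>b n. 0 < b \<Longrightarrow> b < T \<Longrightarrow> n > 0 \<Longrightarrow>
       (LINT t:{0<..<T}|lborel. y t * complex_of_real (\<mu> * time_test \<mu> b n t - time_test_deriv \<mu> b n t)) = complex_of_real (time_test \<mu> b n 0) * c"
  shows "AE t in lborel. t \<in> {0<..<T} \<longrightarrow> y t = complex_of_real (exp (- \<mu> * t)) * c"
proof -
  define Y where "Y t = indicator {0<..<T} t *\<^sub>R y t" for t
  have Yi: "integrable lborel Y" using y by (simp add: set_integrable_def Y_def[abs_def])
  have [measurable]: "Y \<in> borel_measurable borel" using Yi by (auto dest: borel_measurable_integrable)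
  have f1: "flat_step 1 > 0" by (simp add: flat_step_def)
  have [measurable]: "flat_step \<in> borel_measurable borel" "flat_step_deriv \<in> borel_measurable borel"
    unfolding flat_step_def[abs_def] flat_step_deriv_def[abs_def] by measurable
  have main: "(LINT t:{0<..<b}|lborel. Y t * complex_of_real (exp (\<mu> * t)) - c) = 0" if b: "0 < b" "b < T" for b
  proof -
    let ?p = "\<lambda>m t. flat_step (real (Suc m) * (b - t)) + (b - t) * (real (Suc m) * flat_step_deriv (real (Suc m) * (b - t)))"
    have pb: "\<bar>?p m t\<bar> \<le> 3" for m t
      using flat_step_ramp_bounds[of "real (Suc m) * (b - t)"] by (simp add: mult.commute mult.left_commute)
    have eq: "(LINT t|lborel. Y t * complex_of_real (exp (\<mu> * t) * ?p m t)) = complex_of_real (b * flat_step (real (Suc m) * b)) * c" for m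
    proof -
      have "(LINT t:{0<..<T}|lborel. y t * complex_of_real (\<mu> * time_test \<mu> b (real (Suc m)) t - time_test_deriv \<mu> b (real (Suc m)) t))
         = (LINT t|lborel. complex_of_real (flat_step 1) * (Y t * complex_of_real (exp (\<mu> * t) * ?p m t)))"
        unfolding set_lebesgue_integral_def
      proof (rule Bochner_Integration.integral_cong[OF refl])
        fix t
        show "indicator {0<..<T} t *\<^sub>R (y t * complex_of_real (\<mu> * time_test \<mu> b (real (Suc m)) t - time_test_deriv \<mu> b (real (Suc m)) t))
            = complex_of_real (flat_step 1) * (Y t * complex_of_real (exp (\<mu> * t) * ?p m t))"
        proof (cases "t \<in> {0<..<T}")
          case True
          then have "t > 0" by simp
          show ?thesis unfolding time_test_positive_time[OF \<open>t > 0\<close>] using True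
            by (simp only: Y_def indicator_simps scaleR_one of_real_mult ac_simps)
        qed (simp add: Y_def)
      qed
      moreover have "time_test \<mu> b (real (Suc m)) 0 = flat_step 1 * (b * flat_step (real (Suc m) * b))"
        by (simp add: time_test_def flat_step_def[of 0])
      ultimately have "complex_of_real (flat_step 1) * (LINT t|lborel. Y t * complex_of_real (exp (\<mu> * t) * ?p m t)) = complex_of_real (flat_step 1) * (complex_of_real (b * flat_step (real (Suc m) * b)) * c)"
        using id[OF b, of "real (Suc m)"] by (simp add: mult.assoc del: of_nat_Suc)
      then show ?thesis using f1 by simp
    qed
    have EB: "exp (\<mu> * t) \<le> exp (\<bar>\<mu>\<bar> * T)" if "t \<in> {0<..<T}" for t
    proof -
      have "\<mu> * t \<le> \<bar>\<mu>\<bar> * T" using that by (intro mult_mono) auto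
      then show ?thesis by simp
    qed
    have Yexp: "integrable lborel (\<lambda>t. norm (Y t) * (exp (\<bar>\<mu>\<bar> * T) * 3))"
      using Yi by (intro integrable_mult_left integrable_norm)
    have "(\<lambda>m. LINT t|lborel. Y t * complex_of_real (exp (\<mu> * t) * ?p m t)) \<longlonglongrightarrow> (LINT t|lborel. Y t * complex_of_real (exp (\<mu> * t) * indicator {..<b} t))"
    proof (rule integral_dominated_convergence[OF _ _ Yexp])
      show "(\<lambda>t. Y t * complex_of_real (exp (\<mu> * t) * indicator {..<b} t)) \<in> borel_measurable lborel" by measurable
      show "(\<lambda>t. Y t * complex_of_real (exp (\<mu> * t) * ?p m t)) \<in> borel_measurable lborel" for m by measurable
      show "AE t in lborel. norm (Y t * complex_of_real (exp (\<mu> * t) * ?p m t)) \<le> norm (Y t) * (exp (\<bar>\<mu>\<bar> * T) * 3)" for m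
      proof (rule AE_I2)
        fix t
        show "norm (Y t * complex_of_real (exp (\<mu> * t) * ?p m t)) \<le> norm (Y t) * (exp (\<bar>\<mu>\<bar> * T) * 3)"
        proof (cases "t \<in> {0<..<T}")
          case True
          have "\<bar>exp (\<mu> * t) * ?p m t\<bar> \<le> exp (\<bar>\<mu>\<bar> * T) * 3"
            unfolding abs_mult using EB[OF True] pb by (intro mult_mono) auto
          then show ?thesis unfolding norm_mult norm_of_real by (intro mult_left_mono) auto
        qed (simp add: Y_def)
      qed
      show "AE t in lborel. (\<lambda>m. Y t * complex_of_real (exp (\<mu> * t) * ?p m t)) \<longlonglongrightarrow> Y t * complex_of_real (exp (\<mu> * t) * indicator {..<b} t)"
      proof (rule AE_I2)
        fix t
        have "(\<lambda>m. ?p m t) \<longlonglongrightarrow> indicator {..<b} t"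
        proof (cases "t < b")
          case True
          then show ?thesis using flat_step_ramp_tendsto[of "b - t"] by (simp del: of_nat_Suc)
        next
          case False
          then have "real (Suc m) * (b - t) \<le> 0" for m by (intro mult_nonneg_nonpos) auto
          then have "?p m t = 0" for m unfolding flat_step_def flat_step_deriv_def by (simp add: not_less[symmetric] del: of_nat_Suc)
          then show ?thesis using False by (simp del: of_nat_Suc)
        qed
        then show "(\<lambda>m. Y t * complex_of_real (exp (\<mu> * t) * ?p m t)) \<longlonglongrightarrow> Y t * complex_of_real (exp (\<mu> * t) * indicator {..<b} t)"
          by (intro tendsto_intros)
      qed
    qed
    moreover have "(\<lambda>m. LINT t|lborel. Y t * complex_of_real (exp (\<mu> * t) * ?p m t)) \<longlonglongrightarrow> complex_of_real (b * 1) * c"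
      unfolding eq by (intro tendsto_intros LIMSEQ_Suc[OF flat_step_scaled_tendsto(2)] b)
    ultimately have "(LINT t|lborel. Y t * complex_of_real (exp (\<mu> * t) * indicator {..<b} t)) = complex_of_real b * c"
      using LIMSEQ_unique by fastforce
    moreover have "(LINT t|lborel. Y t * complex_of_real (exp (\<mu> * t) * indicator {..<b} t)) = (LINT t|lborel. indicator {0<..<b} t *\<^sub>R (Y t * complex_of_real (exp (\<mu> * t))))"
      by (intro Bochner_Integration.integral_cong) (auto simp: Y_def split: split_indicator)
    moreover have "integrable lborel (\<lambda>t. indicator {0<..<b} t *\<^sub>R (Y t * complex_of_real (exp (\<mu> * t))))"
    proof (rule Bochner_Integration.integrable_bound[OF Yexp])
      show "AE t in lborel. norm (indicator {0<..<b} t *\<^sub>R (Y t * complex_of_real (exp (\<mu> * t)))) \<le> norm (norm (Y t) * (exp (\<bar>\<mu>\<bar> * T) * 3))"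
        using EB b by (intro AE_I2) (auto simp: norm_mult intro!: mult_left_mono order_trans[OF EB] split: split_indicator)
    qed measurable
    moreover have "(LINT t|lborel. indicator {0<..<b} t *\<^sub>R c) = complex_of_real b * c"
      using b by (simp add: scaleR_conv_of_real)
    moreover have "integrable lborel (\<lambda>t. indicator {0<..<b} t *\<^sub>R c)" using b by simp
    ultimately show ?thesis unfolding set_lebesgue_integral_def scaleR_diff_right by simp
  qed
  (* Since b < T is strict, intervals reaching up to T are not available; work on (0, S) with S < T and exhaust. *)
  have part: "AE t in lborel. t \<in> {0<..<S} \<longrightarrow> y t = complex_of_real (exp (- \<mu> * t)) * c" if S: "0 < S" "S < T" for S
  proof -
    define h where "h t = indicator {0<..<S} t *\<^sub>R (Y t * complex_of_real (exp (\<mu> * t)) - c)" for t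
    have hi: "integrable lborel h"
    proof (rule Bochner_Integration.integrable_bound)
      show "integrable lborel (\<lambda>t. norm (Y t) * exp (\<bar>\<mu>\<bar> * T) + indicator {0<..<S} t *\<^sub>R norm c)"
        using Yi by (intro Bochner_Integration.integrable_add integrable_mult_left integrable_norm) (use S in simp_all)
      show "h \<in> borel_measurable lborel" unfolding h_def by measurable
      show "AE t in lborel. norm (h t) \<le> norm (norm (Y t) * exp (\<bar>\<mu>\<bar> * T) + indicator {0<..<S} t *\<^sub>R norm c)"
      proof (rule AE_I2)
        fix t
        show "norm (h t) \<le> norm (norm (Y t) * exp (\<bar>\<mu>\<bar> * T) + indicator {0<..<S} t *\<^sub>R norm c)"
        proof (cases "t \<in> {0<..<S}")
          case True
          have "\<mu> * t \<le> \<bar>\<mu>\<bar> * T" using True S by (intro mult_mono) auto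
          then have "norm (Y t * complex_of_real (exp (\<mu> * t)) - c) \<le> norm (Y t) * exp (\<bar>\<mu>\<bar> * T) + norm c"
            by (intro order_trans[OF norm_triangle_ineq4] add_mono) (auto simp: norm_mult intro!: mult_left_mono)
          then show ?thesis using True by (simp add: h_def)
        qed (simp add: h_def)
      qed
    qed
    have int0: "(LINT t:{0<..<b}|lborel. h t) = 0" if "b \<le> S" for b
    proof (cases "b > 0")
      case True
      have "(LINT t:{0<..<b}|lborel. h t) = (LINT t:{0<..<b}|lborel. Y t * complex_of_real (exp (\<mu> * t)) - c)"
        unfolding set_lebesgue_integral_def h_def using that by (intro Bochner_Integration.integral_cong) (auto split: split_indicator)
      also have "\<dots> = 0" using True that S by (intro main) auto
      finally show ?thesis .
    qed (simp add: set_lebesgue_integral_def)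
    have "AE t in lborel. h t = 0"
    proof (rule AE_zero_of_box_integrals_complex[OF hi])
      fix a b :: real
      define p where "p = max a 0" define q where "q = min b S"
      have ind: "indicator (box a b) t *\<^sub>R h t = indicator {p<..<q} t *\<^sub>R h t" for t
        by (auto simp: p_def q_def h_def box_real split: split_indicator)
      show "(LINT t:box a b|lborel. h t) = 0"
      proof (cases "p < q")
        case True
        have i: "integrable lborel (\<lambda>t. indicator A t *\<^sub>R h t)" if "A \<in> sets borel" for A
          using hi that by (intro integrable_mult_indicator) auto
        have "(LINT t|lborel. indicator {p<..<q} t *\<^sub>R h t) = (LINT t|lborel. indicator {0<..<q} t *\<^sub>R h t - indicator {0<..<p} t *\<^sub>R h t)"
        proof (rule integral_cong_AE)
          show "AE t in lborel. indicator {p<..<q} t *\<^sub>R h t = indicator {0<..<q} t *\<^sub>R h t - indicator {0<..<p} t *\<^sub>R h t"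
            using AE_lborel_singleton[of p]
          proof eventually_elim
            case (elim t)
            then show ?case using True by (auto simp: p_def split: split_indicator)
          qed
        qed (use hi in \<open>auto dest!: borel_measurable_integrable\<close>)
        also have "\<dots> = 0"
          using int0[of q] int0[of p] True i unfolding set_lebesgue_integral_def
          by (subst Bochner_Integration.integral_diff) (auto simp: q_def)
        finally show ?thesis unfolding set_lebesgue_integral_def ind .
      next
        case False
        then show ?thesis unfolding set_lebesgue_integral_def ind by simp
      qed
    qed
    then show ?thesis
    proof eventually_elim
      case (elim t)
      show ?case
      proof
        assume t: "t \<in> {0<..<S}"
        then have "y t * complex_of_real (exp (\<mu> * t)) = c" using elim S by (simp add: h_def Y_def)
        then show "y t = complex_of_real (exp (- \<mu> * t)) * c"
          by (metis (no_types, lifting) exp_minus_inverse mult.assoc mult.commute mult.right_neutral mult_minus_left of_real_1 of_real_mult)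
      qed
    qed
  qed
  have "AE t in lborel. \<forall>m::nat. t \<in> {0<..<T * (1 - inverse (real (m + 2)))} \<longrightarrow> y t = complex_of_real (exp (- \<mu> * t)) * c"
    unfolding AE_all_countable
  proof
    fix m :: nat
    show "AE t in lborel. t \<in> {0<..<T * (1 - inverse (real (m + 2)))} \<longrightarrow> y t = complex_of_real (exp (- \<mu> * t)) * c"
    proof (cases "T > 0")
      case True
      show ?thesis by (rule part) (use True in \<open>auto simp: field_simps add_pos_nonneg\<close>)
    next
      case False
      have "0 < 1 - inverse (real (m + 2))" by (simp add: field_simps)
      then have "T * (1 - inverse (real (m + 2))) \<le> 0" using False by (simp add: mult_nonpos_nonneg)
      then show ?thesis by simp
    qed
  qed
  then show ?thesis
  proof eventually_elim
    case (elim t)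
    show ?case
    proof
      assume t: "t \<in> {0<..<T}"
      then have "0 < 1 - t / T" by simp
      then obtain m where "inverse (real (Suc m)) < 1 - t / T" using reals_Archimedean by blast
      moreover have "inverse (real (m + 2)) \<le> inverse (real (Suc m))" by (simp add: le_imp_inverse_le)
      ultimately have "t / T < 1 - inverse (real (m + 2))" by linarith
      then have "t < T * (1 - inverse (real (m + 2)))" using t by (simp add: pos_divide_less_eq mult.commute)
      then show "y t = complex_of_real (exp (- \<mu> * t)) * c" using elim t by auto
    qed
  qed
qed

section \<open>Sine coefficients of weak solutions\<close>

lemma sine_mode_deriv_has_derivative:
  "R > 0 \<Longrightarrow> (sine_mode_deriv R k has_real_derivative - (real k * pi / (2 * R))\<^sup>2 * sine_mode R k x) (at x)"
  unfolding sine_mode_def sine_mode_deriv_def[abs_def]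
  by (auto intro!: derivative_eq_intros simp: power2_eq_square)

lemma tensor_mode_partial_has_derivative:
  fixes k :: "'n::finite \<Rightarrow> nat"
  assumes R: "R > 0"
  obtains f' where "\<And>x. (tensor_mode_partial R k i has_derivative f' x) (at x)"
    "\<And>x. f' x (axis i 1) = - (real (k i) * pi / (2 * R))\<^sup>2 * tensor_mode R k x"
proof -
  define \<beta> where "\<beta> j = (if j = i then sine_mode_deriv R (k i) else sine_mode R (k j))" for j
  define \<beta>' where "\<beta>' j x = (if j = i then - (real (k i) * pi / (2 * R))\<^sup>2 * sine_mode R (k i) x else sine_mode_deriv R (k j) x)" for j x
  have b: "(\<beta> j has_real_derivative \<beta>' j x) (at x)" for j x
    using sine_mode_deriv_has_derivative[OF R, of "k i" x] sine_mode_has_derivative[OF R, of "k j" x]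
    by (auto simp: \<beta>_def \<beta>'_def)
  have off: "(\<Prod>j\<in>UNIV-{i}. \<beta> j (x $ j)) = (\<Prod>j\<in>UNIV-{i}. sine_mode R (k j) (x $ j))" for x :: "real^'n"
    by (intro prod.cong) (auto simp: \<beta>_def)
  have e: "tensor_mode_partial R k i = (\<lambda>x. \<Prod>j\<in>UNIV. \<beta> j (x $ j))"
  proof
    fix x :: "real^'n"
    have "(\<Prod>j\<in>UNIV. \<beta> j (x $ j)) = \<beta> i (x $ i) * (\<Prod>j\<in>UNIV-{i}. \<beta> j (x $ j))" by (rule prod.remove) auto
    then show "tensor_mode_partial R k i x = (\<Prod>j\<in>UNIV. \<beta> j (x $ j))" unfolding off by (simp add: \<beta>_def)
  qed
  let ?f' = "\<lambda>x h. \<Sum>j\<in>UNIV. (\<beta>' j (x $ j) * (h $ j)) * (\<Prod>l\<in>UNIV-{j}. \<beta> l (x $ l))"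
  show ?thesis
  proof (rule that)
    show "(tensor_mode_partial R k i has_derivative ?f' x) (at x)" for x
      unfolding e by (rule vec_product_has_derivative[OF b])
    fix x :: "real^'n"
    have "?f' x (axis i 1) = (\<Sum>j\<in>UNIV. if j = i then \<beta>' i (x $ i) * (\<Prod>l\<in>UNIV-{i}. \<beta> l (x $ l)) else 0)"
      by (intro sum.cong) (auto simp: axis_def)
    also have "\<dots> = \<beta>' i (x $ i) * (\<Prod>j\<in>UNIV-{i}. sine_mode R (k j) (x $ j))" by (simp add: off)
    also have "\<dots> = - (real (k i) * pi / (2 * R))\<^sup>2 * (sine_mode R (k i) (x $ i) * (\<Prod>j\<in>UNIV-{i}. sine_mode R (k j) (x $ j)))"
      by (simp add: \<beta>'_def)
    also have "sine_mode R (k i) (x $ i) * (\<Prod>j\<in>UNIV-{i}. sine_mode R (k j) (x $ j)) = tensor_mode R k x"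
      by (rule prod.remove[symmetric]) auto
    finally show "?f' x (axis i 1) = - (real (k i) * pi / (2 * R))\<^sup>2 * tensor_mode R k x" .
  qed
qed

lemma sine_mode_continuous: "continuous_on UNIV (sine_mode R k)"
  unfolding sine_mode_def[abs_def] divide_inverse by (intro continuous_intros)

lemma tensor_mode_continuous: "continuous_on UNIV (tensor_mode R k)"
  by (intro continuous_on_prod continuous_on_compose2[OF sine_mode_continuous] continuous_intros) auto

lemma sine_mode_deriv_abs_le: "R > 0 \<Longrightarrow> \<bar>sine_mode_deriv R k x\<bar> \<le> real k * pi / (2 * R)"
  unfolding sine_mode_deriv_def abs_mult by (rule order_trans[OF mult_left_le]) auto

text \<open>Integration by parts against the partial derivative of a mode, which produces the \<open>i\<close>-th part of the eigenvalue.\<close>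

lemma H01_tensor_mode:
  fixes u :: "real^'n \<Rightarrow> complex"
  assumes H: "H01_with_gradient (interior (cube R)) u g" and R: "R > 0"
  shows "(LINT x:interior (cube R)|lborel. g x $ i * complex_of_real (tensor_mode_partial R k i x))
     = complex_of_real ((real (k i) * pi / (2 * R))\<^sup>2) * (LINT x:interior (cube R)|lborel. u x * complex_of_real (tensor_mode R k x))"
proof -
  let ?\<kappa> = "real (k i) * pi / (2 * R)"
  obtain f' where f': "\<And>x. (tensor_mode_partial R k i has_derivative f' x) (at x)"
    "\<And>x. f' x (axis i 1) = - ?\<kappa>\<^sup>2 * tensor_mode R k x"
    using tensor_mode_partial_has_derivative[OF R] by blast
  have "(LINT x:interior (cube R)|lborel. g x $ i * complex_of_real (tensor_mode_partial R k i x))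
     = - (LINT x:interior (cube R)|lborel. u x * complex_of_real (f' x (axis i 1)))"
  proof (rule H01_parts[OF H _ cube_emeasure_finite f'(1)])
    show "continuous_on UNIV (\<lambda>x. f' x (axis i 1))"
      unfolding f'(2) by (intro continuous_intros tensor_mode_continuous)
    show "\<bar>tensor_mode_partial R k i x\<bar> \<le> ?\<kappa> * 1" for x
      unfolding abs_mult using R by (intro mult_mono sine_mode_deriv_abs_le prod_abs_le_one sine_mode_abs_le) auto
    show "\<bar>f' x (axis i 1)\<bar> \<le> ?\<kappa>\<^sup>2 * 1" for x
      unfolding f'(2) abs_mult by (intro mult_mono prod_abs_le_one sine_mode_abs_le) auto
  qed simp
  also have "\<dots> = complex_of_real (?\<kappa>\<^sup>2) * (LINT x:interior (cube R)|lborel. u x * complex_of_real (tensor_mode R k x))"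
  proof -
    have "u x * complex_of_real (f' x (axis i 1)) = - complex_of_real (?\<kappa>\<^sup>2) * (u x * complex_of_real (tensor_mode R k x))" for x
      unfolding f'(2) by simp
    then show ?thesis by (simp only: set_integral_mult_right) simp
  qed
  finally show ?thesis .
qed

lemma tensor_mode_measurable: "tensor_mode R k \<in> borel_measurable borel" "tensor_mode_partial R k i \<in> borel_measurable borel"
proof -
  have pm: "(\<lambda>x::real^'n. f (x $ i)) \<in> borel_measurable borel" if "f \<in> borel_measurable borel" for f :: "real \<Rightarrow> real" and i
    using measurable_compose[OF measurable_vec_nth that] .
  show "tensor_mode R k \<in> borel_measurable borel" "tensor_mode_partial R k i \<in> borel_measurable borel"
    by (intro borel_measurable_times borel_measurable_prod pm mode_measurable)+
qed

lemma integrable_mult_bounded: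
  fixes f :: "'a::euclidean_space \<Rightarrow> complex"
  assumes f: "integrable lborel f" and q: "q \<in> borel_measurable borel" "\<And>x. \<bar>q x\<bar> \<le> B"
  shows "integrable lborel (\<lambda>x. f x * complex_of_real (q x))"
proof (rule Bochner_Integration.integrable_bound[OF integrable_mult_left[OF integrable_norm[OF f], of B]])
  have [measurable]: "f \<in> borel_measurable borel" using f by (auto dest: borel_measurable_integrable)
  note q(1)[measurable]
  show "(\<lambda>x. f x * complex_of_real (q x)) \<in> borel_measurable lborel" by measurable
  have "0 \<le> B" using q(2)[of undefined] by linarith
  then show "AE x in lborel. norm (f x * complex_of_real (q x)) \<le> norm (norm (f x) * B)"
    using q(2) by (auto simp: norm_mult intro!: mult_left_mono)
qed

lemma integral_linear_combination:
  fixes a :: "'a \<Rightarrow> complex" and b :: "'i::finite \<Rightarrow> 'a \<Rightarrow> complex"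
  assumes "integrable M a" "\<And>i. integrable M (b i)"
  shows "(LINT x|M. - c * a x + (\<Sum>i\<in>UNIV. d * b i x)) = - c * (LINT x|M. a x) + (\<Sum>i\<in>UNIV. d * (LINT x|M. b i x))"
  using assms by (subst Bochner_Integration.integral_add) (auto simp: Bochner_Integration.integral_sum)

text \<open>By Fubini's theorem and the eigenvalue equation, the weak formulation tested with \<open>\<alpha>(t)\<close> times a mode is the weak
  form of \<open>y' = - \<mu> y\<close> with initial value the coefficient of \<open>F\<close>.\<close>

lemma dirichlet_solution_coefficient:
  fixes F :: "real^'n \<Rightarrow> complex"
  defines "U R \<equiv> interior (cube R)"
  assumes sol: "dirichlet_heat_solution T (U R) F v" and R: "R > 0" and FL: "L2_on UNIV F"
  defines "\<mu> k \<equiv> \<Sum>i\<in>UNIV. (real (k i) * pi / (2 * R))\<^sup>2"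
  shows "AE t in lborel. t \<in> {0<..<T} \<longrightarrow>
     (LINT x:U R|lborel. v t x * complex_of_real (tensor_mode R k x))
      = complex_of_real (exp (- \<mu> k * t)) * (LINT x:U R|lborel. F x * complex_of_real (tensor_mode R k x))"
proof -
  let ?D = "{0<..<T} \<times> U R"
  let ?E = "tensor_mode R k" and ?Ei = "tensor_mode_partial R k"
  obtain g where vL: "L2_on ?D (\<lambda>(t, x). v t x)" and gL: "L2_on ?D (\<lambda>(t, x). g t x)"
    and H01: "AE t in lborel. t \<in> {0<..<T} \<longrightarrow> H01_with_gradient (U R) (v t) (g t)"
    and weak: "\<forall>\<phi> :: real \<times> (real^'n) \<Rightarrow> complex. test_function ({..<T} \<times> U R) \<phi> \<longrightarrow>
           (LINT p:?D|lborel.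
              - v (fst p) (snd p) * frechet_derivative \<phi> (at p) (1, 0)
              + (\<Sum>i\<in>UNIV. g (fst p) (snd p) $ i * frechet_derivative \<phi> (at p) (0, axis i 1)))
           = (LINT x:U R|lborel. F x * \<phi> (0, x))"
    using sol unfolding dirichlet_heat_solution_def by blast
  have Ds: "?D \<in> sets borel" "emeasure lborel ?D < \<infinity>" and Us: "U R \<in> sets borel" "emeasure lborel (U R) < \<infinity>"
    unfolding U_def using cylinder_sets[of T R] cylinder_emeasure_finite[of T R] cube_emeasure_finite[of R] by auto
  define V where "V p = indicator ?D p *\<^sub>R v (fst p) (snd p)" for p
  define G where "G p = indicator ?D p *\<^sub>R g (fst p) (snd p)" for p
  have Vi: "integrable lborel V" and Gi: "integrable lborel G"
    using L2_on_set_integrable[OF vL Ds] L2_on_set_integrable[OF gL Ds]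
    by (simp_all add: set_integrable_def V_def[abs_def] G_def[abs_def] case_prod_beta')
  have Gii: "integrable lborel (\<lambda>p. G p $ i)" for i
    using integrable_bounded_linear[OF bounded_linear_vec_nth Gi] .
  have Em: "(\<lambda>p::real \<times> (real^'n). ?E (snd p)) \<in> borel_measurable borel" "(\<lambda>p::real \<times> (real^'n). ?Ei i (snd p)) \<in> borel_measurable borel" for i
    by (rule measurable_compose[OF _ tensor_mode_measurable(1)] measurable_compose[OF _ tensor_mode_measurable(2)],
      intro borel_measurable_continuous_onI continuous_intros)+
  define y where "y t = (LINT x:U R|lborel. v t x * complex_of_real (?E x))" for t
  have VE: "integrable (lborel \<Otimes>\<^sub>M lborel) (\<lambda>p. V p * complex_of_real (?E (snd p)))"
    unfolding lborel_prod by (rule integrable_mult_bounded[OF Vi Em(1), where B = 1]) (intro prod_abs_le_one sine_mode_abs_le)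
  have ind: "indicator ?D (t, x) = (indicator {0<..<T} t * indicator (U R) x :: real)" for t x
    by (simp add: indicator_times)
  have y_int: "set_integrable lborel {0<..<T} y"
  proof -
    have "(LINT x|lborel. V (t, x) * complex_of_real (?E (snd (t, x)))) = indicator {0<..<T} t *\<^sub>R y t" for t
      unfolding y_def set_lebesgue_integral_def V_def
      by (cases "t \<in> {0<..<T}") (simp_all add: ind)
    then show ?thesis
      using lborel_pair.integrable_fst'[OF VE] by (simp add: set_integrable_def)
  qed
  have "AE t in lborel. t \<in> {0<..<T} \<longrightarrow> y t = complex_of_real (exp (- \<mu> k * t)) * (LINT x:U R|lborel. F x * complex_of_real (?E x))"
  proof (rule time_ode_weak[OF y_int])
    fix b n :: real assume b: "0 < b" "b < T" and n: "n > 0"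
    let ?\<alpha> = "time_test (\<mu> k) b n" and ?\<alpha>' = "time_test_deriv (\<mu> k) b n"
    have \<alpha>m: "?\<alpha>' \<in> borel_measurable borel"
      unfolding time_test_deriv_def[abs_def] flat_step_def flat_step_deriv_def by measurable
    have ac: "continuous_on {0..T} ?\<alpha>"
      by (intro continuous_at_imp_continuous_on ballI DERIV_isCont[OF time_test_has_derivative])
    obtain g' where g': "\<And>x. (?\<alpha> has_derivative g' x) (at x)" "\<And>b. smooth_fun (\<lambda>x. g' x b)"
      using smooth_fun_deriv[OF time_test_smooth[of "\<mu> k" b n]] by blast
    have "g' x = (*) (?\<alpha>' x)" for x
      using has_derivative_unique[OF g'(1) time_test_has_derivative[unfolded has_field_derivative_def]] .
    then have "smooth_fun ?\<alpha>'" using g'(2)[of 1] by simp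
    then have "continuous_on UNIV ?\<alpha>'"
      using smooth_fun_deriv by (meson continuous_at_imp_continuous_on has_derivative_continuous)
    then have a'c: "continuous_on {0..T} ?\<alpha>'" by (rule continuous_on_subset) simp
    have "\<exists>A1. \<forall>t\<in>{0..T}. \<bar>?\<alpha> t\<bar> \<le> A1" "\<exists>A2. \<forall>t\<in>{0..T}. \<bar>?\<alpha>' t\<bar> \<le> A2"
      using compact_imp_bounded[OF compact_continuous_image[OF ac]] compact_imp_bounded[OF compact_continuous_image[OF a'c]]
      by (simp_all add: bounded_iff)
    then obtain A1 A2 where A1: "\<And>t. t \<in> {0..T} \<Longrightarrow> \<bar>?\<alpha> t\<bar> \<le> A1" and A2: "\<And>t. t \<in> {0..T} \<Longrightarrow> \<bar>?\<alpha>' t\<bar> \<le> A2"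
      by blast
    define A where "A = max A1 A2"
    have A: "\<bar>?\<alpha> t\<bar> \<le> A \<and> \<bar>?\<alpha>' t\<bar> \<le> A" if "t \<in> {0<..<T}" for t
      using A1[of t] A2[of t] that by (auto simp: A_def)
    have \<alpha>m0: "?\<alpha> \<in> borel_measurable borel"
      unfolding time_test_def[abs_def] flat_step_def by measurable
    note wi = weak_identity_sine_mode[where k = k and \<alpha> = ?\<alpha> and \<alpha>' = ?\<alpha>', OF R vL[unfolded U_def] gL[unfolded U_def] weak[unfolded U_def] FL
        time_test_smooth time_test_has_derivative time_test_support[OF n] b(2) \<alpha>m A, folded U_def]
    define W where "W p = indicator ?D p *\<^sub>R (- v (fst p) (snd p) * complex_of_real (?\<alpha>' (fst p) * ?E (snd p))
              + (\<Sum>i\<in>UNIV. g (fst p) (snd p) $ i * complex_of_real (?\<alpha> (fst p) * ?Ei i (snd p))))" for p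
    define \<tau> where "\<tau> t = indicator {0<..<T} t * ?\<alpha> t" for t
    define \<tau>' where "\<tau>' t = indicator {0<..<T} t * ?\<alpha>' t" for t
    have W: "W p = - (V p * complex_of_real (\<tau>' (fst p) * ?E (snd p))) + (\<Sum>i\<in>UNIV. G p $ i * complex_of_real (\<tau> (fst p) * ?Ei i (snd p)))" for p
      by (cases "p \<in> ?D") (auto simp: W_def V_def G_def \<tau>_def \<tau>'_def)
    have fstm: "(\<lambda>p::real \<times> (real^'n). f (fst p)) \<in> borel_measurable borel" if "f \<in> borel_measurable borel" for f :: "real \<Rightarrow> real"
      by (rule measurable_compose[OF _ that]) (intro borel_measurable_continuous_onI continuous_intros)
    have \<tau>m: "\<tau> \<in> borel_measurable borel" "\<tau>' \<in> borel_measurable borel"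
      unfolding \<tau>_def[abs_def] \<tau>'_def[abs_def] using \<alpha>m \<alpha>m0 by measurable
    have A0: "A \<ge> 0" using A[of b] b by auto
    have \<tau>b: "\<bar>\<tau> t\<bar> \<le> A" "\<bar>\<tau>' t\<bar> \<le> A" for t
      using A[of t] A0 by (auto simp: \<tau>_def \<tau>'_def split: split_indicator)
    have Wi: "integrable lborel W"
      unfolding W[abs_def]
    proof (intro Bochner_Integration.integrable_add integrable_minus Bochner_Integration.integrable_sum)
      show "integrable lborel (\<lambda>p. V p * complex_of_real (\<tau>' (fst p) * ?E (snd p)))"
      proof (rule integrable_mult_bounded[OF Vi])
        show "(\<lambda>p. \<tau>' (fst p) * ?E (snd p)) \<in> borel_measurable borel" by (intro borel_measurable_times fstm \<tau>m Em)
        show "\<bar>\<tau>' (fst x) * ?E (snd x)\<bar> \<le> A * 1" for x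
          unfolding abs_mult[of _ "?E _"] by (intro mult_mono \<tau>b prod_abs_le_one sine_mode_abs_le A0) auto
      qed
      fix i
      show "integrable lborel (\<lambda>p. G p $ i * complex_of_real (\<tau> (fst p) * ?Ei i (snd p)))"
      proof (rule integrable_mult_bounded[OF Gii])
        show "(\<lambda>p. \<tau> (fst p) * ?Ei i (snd p)) \<in> borel_measurable borel" by (intro borel_measurable_times fstm \<tau>m Em[unfolded split_def])
        show "\<bar>\<tau> (fst x) * ?Ei i (snd x)\<bar> \<le> A * (real (k i) * pi / (2 * R) * 1)" for x
          unfolding abs_mult[of _ "?Ei i _"] abs_mult[of "sine_mode_deriv R (k i) _"]
          using R by (intro mult_mono \<tau>b prod_abs_le_one sine_mode_abs_le sine_mode_deriv_abs_le A0) auto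
      qed
    qed
    have Wi': "integrable (lborel \<Otimes>\<^sub>M lborel) W" using Wi by (simp add: lborel_prod)
    have inner: "AE t in lborel. (LINT x|lborel. W (t, x)) = indicator {0<..<T} t *\<^sub>R (y t * complex_of_real (\<mu> k * ?\<alpha> t - ?\<alpha>' t))"
      using H01
    proof eventually_elim
      case (elim t)
      show ?case
      proof (cases "t \<in> {0<..<T}")
        case False
        then show ?thesis by (simp add: W_def ind)
      next
        case True
        then have H: "H01_with_gradient (U R) (v t) (g t)" using elim by blast
        have vi: "integrable lborel (\<lambda>x. indicator (U R) x *\<^sub>R v t x)" and gi: "integrable lborel (\<lambda>x. indicator (U R) x *\<^sub>R g t x)"
          using L2_on_set_integrable[OF _ Us, of "v t"] L2_on_set_integrable[OF _ Us, of "g t"] H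
          by (auto simp: H01_with_gradient_def set_integrable_def)
        have gii: "integrable lborel (\<lambda>x. (indicator (U R) x *\<^sub>R g t x) $ i)" for i
          using integrable_bounded_linear[OF bounded_linear_vec_nth gi] .
        have 1: "integrable lborel (\<lambda>x. (indicator (U R) x *\<^sub>R v t x) * complex_of_real (?E x))"
          by (rule integrable_mult_bounded[OF vi tensor_mode_measurable(1), where B = 1]) (intro prod_abs_le_one sine_mode_abs_le)
        have 2: "integrable lborel (\<lambda>x. (indicator (U R) x *\<^sub>R g t x) $ i * complex_of_real (?Ei i x))" for i
          by (rule integrable_mult_bounded[OF gii tensor_mode_measurable(2), where B = "real (k i) * pi / (2 * R) * 1"])
            (unfold abs_mult[of "sine_mode_deriv R (k i) _"], use R in \<open>intro mult_mono prod_abs_le_one sine_mode_abs_le sine_mode_deriv_abs_le; auto\<close>)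
        have "(LINT x|lborel. W (t, x)) = (LINT x|lborel. - complex_of_real (?\<alpha>' t) * ((indicator (U R) x *\<^sub>R v t x) * complex_of_real (?E x))
            + (\<Sum>i\<in>UNIV. complex_of_real (?\<alpha> t) * ((indicator (U R) x *\<^sub>R g t x) $ i * complex_of_real (?Ei i x))))"
          using True by (intro Bochner_Integration.integral_cong refl) (auto simp: W_def ind mult.left_commute mult.commute split: split_indicator)
        also have "\<dots> = - complex_of_real (?\<alpha>' t) * y t + (\<Sum>i\<in>UNIV. complex_of_real (?\<alpha> t) * (LINT x:U R|lborel. g t x $ i * complex_of_real (?Ei i x)))"
          unfolding integral_linear_combination[OF 1 2]
          by (simp only: y_def set_lebesgue_integral_def mult_scaleR_left vector_scaleR_component)
        also have "\<dots> = y t * complex_of_real (\<mu> k * ?\<alpha> t - ?\<alpha>' t)"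
          unfolding H01_tensor_mode[OF H[unfolded U_def] R, folded U_def] y_def[symmetric]
          by (simp add: \<mu>_def sum_distrib_left sum_distrib_right algebra_simps)
        finally show ?thesis using True by simp
      qed
    qed
    have "(LINT t:{0<..<T}|lborel. y t * complex_of_real (\<mu> k * ?\<alpha> t - ?\<alpha>' t)) = (LINT t|lborel. (LINT x|lborel. W (t, x)))"
      unfolding set_lebesgue_integral_def
    proof (rule integral_cong_AE)
      show "AE t in lborel. indicator {0<..<T} t *\<^sub>R (y t * complex_of_real (\<mu> k * ?\<alpha> t - ?\<alpha>' t)) = (LINT x|lborel. W (t, x))"
        using inner by eventually_elim simp
      have "(\<lambda>t. (indicator {0<..<T} t *\<^sub>R y t) * complex_of_real (\<mu> k * ?\<alpha> t - ?\<alpha>' t)) \<in> borel_measurable lborel"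
        using borel_measurable_integrable[OF y_int[unfolded set_integrable_def]] \<alpha>m \<alpha>m0 by measurable
      then show "(\<lambda>t. indicator {0<..<T} t *\<^sub>R (y t * complex_of_real (\<mu> k * ?\<alpha> t - ?\<alpha>' t))) \<in> borel_measurable lborel" by simp
      show "(\<lambda>t. LINT x|lborel. W (t, x)) \<in> borel_measurable lborel"
        using lborel_pair.integrable_fst'[OF Wi'] by (rule borel_measurable_integrable)
    qed
    also have "\<dots> = integral\<^sup>L lborel W" using lborel_pair.integral_fst'[OF Wi'] by (simp add: lborel_prod)
    also have "\<dots> = (LINT x:U R|lborel. F x * complex_of_real (?\<alpha> 0 * ?E x))"
      using wi unfolding W_def set_lebesgue_integral_def by simp
    also have "\<dots> = complex_of_real (?\<alpha> 0) * (LINT x:U R|lborel. F x * complex_of_real (?E x))"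
    proof -
      have "F x * complex_of_real (?\<alpha> 0 * ?E x) = complex_of_real (?\<alpha> 0) * (F x * complex_of_real (?E x))" for x by simp
      then show ?thesis by (simp only: set_integral_mult_right)
    qed
    finally show "(LINT t:{0<..<T}|lborel. y t * complex_of_real (\<mu> k * ?\<alpha> t - ?\<alpha>' t)) = complex_of_real (?\<alpha> 0) * (LINT x:U R|lborel. F x * complex_of_real (?E x))" .
  qed
  then show ?thesis by (simp add: y_def)
qed

section \<open>Completeness of the sine system\<close>

text \<open>The linear span of the modes.\<close>

inductive sine_span :: "real \<Rightarrow> (real^'n \<Rightarrow> real) \<Rightarrow> bool" for R where
  mode: "sine_span R (tensor_mode R k)"
| add: "sine_span R f \<Longrightarrow> sine_span R g \<Longrightarrow> sine_span R (\<lambda>x. f x + g x)"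
| scale: "sine_span R f \<Longrightarrow> sine_span R (\<lambda>x. c * f x)"

lemma sine_mode_cos_mult:
  "cos (pi * (a + R) / (2 * R)) * sine_mode R (Suc k) a = (sine_mode R (Suc (Suc k)) a + sine_mode R k a) / 2"
proof -
  define y where "y = pi * (a + R) / (2 * R)"
  have s: "sine_mode R j a = sin (real j * y)" for j by (simp add: sine_mode_def y_def mult.assoc)
  have "sin (real (Suc (Suc k)) * y) + sin (real k * y) = sin (real (Suc k) * y + y) + sin (real (Suc k) * y - y)"
    by (simp add: algebra_simps)
  also have "\<dots> = 2 * (cos y * sin (real (Suc k) * y))"
    unfolding sin_add sin_diff by simp
  finally show ?thesis unfolding s y_def[symmetric] by simp
qed

text \<open>The span is a module over the polynomials in the functions \<open>cos (\<pi> (x\<^sub>i + R) / 2 R)\<close>, although it is not an algebra: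
  \<open>2 cos y sin (k y) = sin ((k + 1) y) + sin ((k - 1) y)\<close>.\<close>

lemma sine_span_cos_mult:
  fixes g :: "real^'n \<Rightarrow> real"
  assumes "sine_span R g"
  shows "sine_span R (\<lambda>x. cos (pi * (x $ i + R) / (2 * R)) * g x)"
  using assms
proof induction
  case (mode k)
  let ?c = "\<lambda>x::real^'n. cos (pi * (x $ i + R) / (2 * R))"
  have fact: "tensor_mode R l x = sine_mode R (l i) (x $ i) * (\<Prod>j\<in>UNIV-{i}. sine_mode R (l j) (x $ j))" for l and x :: "real^'n"
    by (rule prod.remove) auto
  show ?case
  proof (cases "k i")
    case 0
    have "(\<lambda>x. ?c x * tensor_mode R k x) = (\<lambda>x. 0 * tensor_mode R k x)"
      unfolding fact[of k] by (simp add: 0 sine_mode_def)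
    from ssubst[where P = "sine_span R", OF this sine_span.scale[OF sine_span.mode]] show ?thesis .
  next
    case (Suc n)
    have off: "(\<Prod>j\<in>UNIV-{i}. sine_mode R ((k(i := m)) j) (x $ j)) = (\<Prod>j\<in>UNIV-{i}. sine_mode R (k j) (x $ j))" for m and x :: "real^'n"
      by (intro prod.cong) auto
    have "?c x * tensor_mode R k x = (1/2) * (tensor_mode R (k(i := Suc (Suc n))) x + tensor_mode R (k(i := n)) x)" for x
    proof -
      have "?c x * tensor_mode R k x = (?c x * sine_mode R (Suc n) (x $ i)) * (\<Prod>j\<in>UNIV-{i}. sine_mode R (k j) (x $ j))"
        unfolding fact[of k] Suc by simp
      also have "\<dots> = (1/2) * (tensor_mode R (k(i := Suc (Suc n))) x + tensor_mode R (k(i := n)) x)"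
        unfolding sine_mode_cos_mult fact[of "k(i := _)"] off by (simp add: algebra_simps add_divide_distrib)
      finally show ?thesis .
    qed
    then have "(\<lambda>x. ?c x * tensor_mode R k x) = (\<lambda>x. (1/2) * (tensor_mode R (k(i := Suc (Suc n))) x + tensor_mode R (k(i := n)) x))"
      by (rule ext)
    from ssubst[where P = "sine_span R", OF this sine_span.scale[OF sine_span.add[OF sine_span.mode sine_span.mode]]] show ?thesis .
  qed
next
  case (add f g)
  from sine_span.add[OF add.IH] show ?case by (simp add: distrib_left)
next
  case (scale f c)
  from sine_span.scale[OF scale.IH, of c] show ?case by (simp add: mult.left_commute)
qed

lemma sine_span_bounded: "sine_span R g \<Longrightarrow> g \<in> borel_measurable borel \<and> (\<exists>B. \<forall>x. \<bar>g x\<bar> \<le> B)"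
proof (induction rule: sine_span.induct)
  case (mode k)
  show ?case using tensor_mode_measurable(1) by (auto intro!: exI[of _ 1] prod_abs_le_one sine_mode_abs_le)
next
  case (add f g)
  then obtain B B' where "\<And>x. \<bar>f x\<bar> \<le> B" "\<And>x. \<bar>g x\<bar> \<le> B'" by blast
  then have "\<bar>f x + g x\<bar> \<le> B + B'" for x using abs_triangle_ineq order_trans add_mono by metis
  then show ?case using add by (auto intro!: borel_measurable_add)
next
  case (scale f c)
  then obtain B where "\<And>x. \<bar>f x\<bar> \<le> B" by blast
  then have "\<bar>c * f x\<bar> \<le> \<bar>c\<bar> * B" for x by (simp add: abs_mult mult_left_mono)
  then show ?case using scale by (auto intro!: borel_measurable_times)
qed

lemma sine_mode_one_pos:
  assumes "\<bar>a\<bar> < R"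
  shows "0 < sine_mode R 1 a"
proof -
  have R: "0 < a + R" "a + R < 2 * R" using assms by auto
  then have "pi * (a + R) < pi * (2 * R)" by (intro mult_strict_left_mono) auto
  then have "pi * (a + R) / (2 * R) < pi" using R by (simp add: divide_less_eq)
  moreover have "0 < pi * (a + R) / (2 * R)" using R by (intro divide_pos_pos mult_pos_pos) auto
  ultimately show ?thesis unfolding sine_mode_def by (intro sin_gt_zero) auto
qed

text \<open>The multipliers that map the span of the modes into itself form an algebra, and the cosines in it separate the points
  of the closed cube. By Stone-Weierstrass they are dense in the continuous functions, so \<open>f\<close> times the lowest
  mode \<open>E\<close> is orthogonal to all continuous functions. As \<open>E\<close> is positive inside the cube, \<open>f\<close> vanishes.\<close>

lemma sine_system_complete:
  fixes f :: "real^'n \<Rightarrow> complex" and R :: real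
  defines "U \<equiv> interior (cube R)"
  assumes R: "R > 0" and f: "set_integrable lborel U f"
    and orth: "\<And>k. (LINT x:U|lborel. f x * complex_of_real (tensor_mode R k x)) = 0"
  shows "AE x in lborel. x \<in> U \<longrightarrow> f x = 0"
proof -
  define h where "h x = indicator U x *\<^sub>R f x" for x
  have hi: "integrable lborel h" using f by (simp add: set_integrable_def h_def[abs_def])
  have [measurable]: "h \<in> borel_measurable borel" using hi by (auto dest: borel_measurable_integrable)
  have hq: "integrable lborel (\<lambda>x. h x * complex_of_real (g x))" if "sine_span R g" for g
    using sine_span_bounded[OF that] integrable_mult_bounded[OF hi] by blast
  have span0: "(LINT x|lborel. h x * complex_of_real (g x)) = 0" if "sine_span R g" for g
    using that
  proof induction
    case (mode k)
    then show ?case using orth[of k] by (simp add: set_lebesgue_integral_def h_def)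
  next
    case (add f g)
    then show ?case using hq[OF add.hyps(1)] hq[OF add.hyps(2)] by (simp add: distrib_left)
  next
    case (scale f c)
    have "(\<lambda>x. h x * complex_of_real (c * f x)) = (\<lambda>x. complex_of_real c * (h x * complex_of_real (f x)))" by (auto simp: mult_ac)
    then show ?case using scale by simp
  qed
  let ?E = "tensor_mode R (\<lambda>_::'n. 1)"
  have hE: "integrable lborel (\<lambda>x. h x * complex_of_real (?E x))" by (rule hq[OF sine_span.mode])
  have cont0: "(LINT x|lborel. h x * complex_of_real (?E x) * complex_of_real (u x)) = 0"
    if u: "continuous_on UNIV u" "\<And>x. \<bar>u x\<bar> \<le> 1" for u
  proof -
    have um: "u \<in> borel_measurable borel" using u(1) by (rule borel_measurable_continuous_onI)
    define N where "N = (LINT x|lborel. norm (h x))"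
    have N0: "N \<ge> 0" by (simp add: N_def)
    have le: "norm (LINT x|lborel. h x * complex_of_real (?E x) * complex_of_real (u x)) \<le> e * N" if e: "e > 0" for e
    proof -
      define P where "P q \<longleftrightarrow> continuous_on UNIV q \<and> (\<forall>g. sine_span R g \<longrightarrow> sine_span R (\<lambda>x. q x * g x))" for q :: "real^'n \<Rightarrow> real"
      have "\<exists>q. P q \<and> (\<forall>x\<in>cube R. \<bar>u x - q x\<bar> < e)"
      proof (rule Stone_Weierstrass_HOL)
        show "compact (cube R :: (real^'n) set)" by (simp add: cube_def)
        show "P (\<lambda>x. c)" for c by (simp add: P_def sine_span.scale)
        show "P q \<Longrightarrow> continuous_on (cube R) q" for q by (auto simp: P_def intro: continuous_on_subset)
        show "P (\<lambda>x. f x + g x)" if fg: "P f \<and> P g" for f g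
          unfolding P_def
        proof (intro conjI allI impI)
          show "continuous_on UNIV (\<lambda>x. f x + g x)" using fg by (auto simp: P_def intro: continuous_on_add)
          fix s :: "real^'n \<Rightarrow> real" assume "sine_span R s"
          then have "sine_span R (\<lambda>x. f x * s x + g x * s x)" using fg by (intro sine_span.add) (auto simp: P_def)
          then show "sine_span R (\<lambda>x. (f x + g x) * s x)" by (simp add: distrib_right)
        qed
        show "P (\<lambda>x. f x * g x)" if fg: "P f \<and> P g" for f g
          unfolding P_def
        proof (intro conjI allI impI)
          show "continuous_on UNIV (\<lambda>x. f x * g x)" using fg by (auto simp: P_def intro: continuous_on_mult)
          fix s :: "real^'n \<Rightarrow> real" assume "sine_span R s"
          then have "sine_span R (\<lambda>x. g x * s x)" using fg by (auto simp: P_def)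
          then have "sine_span R (\<lambda>x. f x * (g x * s x))" using fg by (auto simp: P_def)
          then show "sine_span R (\<lambda>x. (f x * g x) * s x)" by (simp add: mult.assoc)
        qed
        show "continuous_on (cube R) u" by (rule continuous_on_subset[OF u(1)]) simp
        fix x y :: "real^'n" assume xy: "x \<in> cube R \<and> y \<in> cube R \<and> x \<noteq> y"
        then obtain i where i: "x $ i \<noteq> y $ i" by (auto simp: vec_eq_iff)
        let ?c = "\<lambda>x::real^'n. cos (pi * (x $ i + R) / (2 * R))"
        have "P ?c" unfolding P_def
          using sine_span_cos_mult R by (auto intro!: continuous_intros)
        moreover have "?c x \<noteq> ?c y"
        proof
          assume c: "?c x = ?c y"
          have r: "0 \<le> pi * (z $ i + R) / (2 * R) \<and> pi * (z $ i + R) / (2 * R) \<le> pi" if "z \<in> cube R" for z :: "real^'n"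
          proof -
            have "0 \<le> z $ i + R" "z $ i + R \<le> 2 * R" using that by (auto simp: mem_cube abs_le_iff) (smt (verit))+
            then show ?thesis using R by (simp add: pos_divide_le_eq)
          qed
          have "pi * (x $ i + R) / (2 * R) = pi * (y $ i + R) / (2 * R)"
            by (rule cos_inj_pi) (use r[of x] r[of y] xy c in auto)
          then show False using i R by simp
        qed
        ultimately show "\<exists>q. P q \<and> q x \<noteq> q y" by blast
      qed (use e in auto)
      then obtain q where q: "P q" "\<And>x. x \<in> cube R \<Longrightarrow> \<bar>u x - q x\<bar> < e" by blast
      have qs: "sine_span R (\<lambda>x. q x * ?E x)" by (rule conjunct2[OF q(1)[unfolded P_def], rule_format, OF sine_span.mode])
      have "(LINT x|lborel. h x * complex_of_real (?E x) * complex_of_real (u x))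
          = (LINT x|lborel. h x * complex_of_real (?E x) * complex_of_real (u x)) - (LINT x|lborel. h x * complex_of_real (q x * ?E x))"
        using span0[OF qs] by simp
      also have "\<dots> = (LINT x|lborel. h x * complex_of_real (?E x) * complex_of_real (u x) - h x * complex_of_real (q x * ?E x))"
        by (rule Bochner_Integration.integral_diff[symmetric]) (intro hq qs integrable_mult_bounded[OF hE um u(2)])+
      also have "norm \<dots> \<le> (LINT x|lborel. e * norm (h x))"
      proof (rule Bochner_Integration.integral_norm_bound_integral)
        show "integrable lborel (\<lambda>x. h x * complex_of_real (?E x) * complex_of_real (u x) - h x * complex_of_real (q x * ?E x))"
          by (intro Bochner_Integration.integrable_diff hq qs integrable_mult_bounded[OF hE um u(2)])
        show "integrable lborel (\<lambda>x. e * norm (h x))" using hi by simp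
        fix x
        show "norm (h x * complex_of_real (?E x) * complex_of_real (u x) - h x * complex_of_real (q x * ?E x)) \<le> e * norm (h x)"
        proof (cases "x \<in> U")
          case True
          then have "x \<in> cube R" using interior_subset unfolding U_def by blast
          then have "\<bar>u x - q x\<bar> \<le> e" using q(2)[of x] by simp
          moreover have "\<bar>?E x\<bar> \<le> 1" by (intro prod_abs_le_one sine_mode_abs_le)
          ultimately have "\<bar>?E x\<bar> * \<bar>u x - q x\<bar> \<le> 1 * e" by (intro mult_mono) auto
          moreover have "h x * complex_of_real (?E x) * complex_of_real (u x) - h x * complex_of_real (q x * ?E x) = h x * complex_of_real (?E x * (u x - q x))"
            unfolding of_real_mult of_real_diff by (simp add: algebra_simps)
          ultimately show ?thesis
            using mult_left_mono[of "\<bar>?E x\<bar> * \<bar>u x - q x\<bar>" "1 * e" "norm (h x)"] by (simp only: norm_mult norm_of_real abs_mult) (simp add: mult.commute)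
        qed (simp add: h_def)
      qed
      also have "\<dots> = e * N" by (simp add: N_def)
      finally show ?thesis .
    qed
    have "norm (LINT x|lborel. h x * complex_of_real (?E x) * complex_of_real (u x)) \<le> 0"
    proof (rule field_le_epsilon)
      fix e :: real assume e: "e > 0"
      have "norm (LINT x|lborel. h x * complex_of_real (?E x) * complex_of_real (u x)) \<le> e / (N + 1) * N"
        by (rule le) (use e N0 in simp)
      also have "\<dots> \<le> e" using e N0 by (simp add: field_simps)
      finally show "norm (LINT x|lborel. h x * complex_of_real (?E x) * complex_of_real (u x)) \<le> 0 + e" by simp
    qed
    then show ?thesis by simp
  qed
  have "AE x in lborel. h x * complex_of_real (?E x) = 0"
  proof (rule AE_zero_of_box_integrals_complex[OF hE])
    fix a b :: "real^'n"
    define u where "u m x = (\<Prod>i\<in>UNIV. flat_step (real (Suc m) * (x $ i - a $ i)) * flat_step (real (Suc m) * (b $ i - x $ i)))" for m and x :: "real^'n"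
    have fc: "continuous_on UNIV flat_step"
      by (intro continuous_at_imp_continuous_on ballI DERIV_isCont[OF flat_step_has_derivative])
    have uc: "continuous_on UNIV (u m)" for m
      unfolding u_def[abs_def] by (intro continuous_on_prod continuous_intros continuous_on_compose2[OF fc]) auto
    have ub: "\<bar>u m x\<bar> \<le> 1" for m x
      unfolding u_def using flat_step_bounds by (intro prod_abs_le_one) (simp add: abs_mult mult_le_one)
    (* Smoothed indicator functions of the box. *)
    have ulim: "(\<lambda>m. u m x) \<longlonglongrightarrow> indicator (box a b) x" for x
    proof (cases "x \<in> box a b")
      case True
      then have p: "x $ i - a $ i > 0" "b $ i - x $ i > 0" for i by (auto simp: mem_box_cart)
      have "(\<lambda>m. u m x) \<longlonglongrightarrow> (\<Prod>i\<in>(UNIV::'n set). 1 * 1)"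
        unfolding u_def by (intro tendsto_intros LIMSEQ_Suc[OF flat_step_scaled_tendsto(2)[OF p(1)]] LIMSEQ_Suc[OF flat_step_scaled_tendsto(2)[OF p(2)]])
      then show ?thesis using True by simp
    next
      case False
      then obtain i where "x $ i - a $ i \<le> 0 \<or> b $ i - x $ i \<le> 0" by (auto simp: mem_box_cart not_less)
      then have d: "real (Suc m) * (x $ i - a $ i) \<le> 0 \<or> real (Suc m) * (b $ i - x $ i) \<le> 0" for m
        by (auto intro: mult_nonneg_nonpos)
      have fz: "flat_step s = 0" if "s \<le> 0" for s using that by (simp add: flat_step_def)
      have "flat_step (real (Suc m) * (x $ i - a $ i)) * flat_step (real (Suc m) * (b $ i - x $ i)) = 0" for m
        by (rule disjE[OF d[of m]]) (simp_all only: fz mult_zero_left mult_zero_right)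
      then have "u m x = 0" for m unfolding u_def by (intro prod_zero) auto
      then show ?thesis using False by simp
    qed
    have "(\<lambda>m. LINT x|lborel. h x * complex_of_real (?E x) * complex_of_real (u m x)) \<longlonglongrightarrow> (LINT x|lborel. h x * complex_of_real (?E x) * complex_of_real (indicator (box a b) x))"
    proof (rule integral_dominated_convergence[OF _ _ integrable_norm[OF hE]])
      have [measurable]: "(\<lambda>x. h x * complex_of_real (?E x)) \<in> borel_measurable borel" using hE by (auto dest: borel_measurable_integrable)
      have [measurable]: "u m \<in> borel_measurable borel" for m using uc by (rule borel_measurable_continuous_onI)
      show "(\<lambda>x. h x * complex_of_real (?E x) * complex_of_real (indicator (box a b) x)) \<in> borel_measurable lborel"
        "\<And>m. (\<lambda>x. h x * complex_of_real (?E x) * complex_of_real (u m x)) \<in> borel_measurable lborel" by measurable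
      show "AE x in lborel. norm (h x * complex_of_real (?E x) * complex_of_real (u m x)) \<le> norm (h x * complex_of_real (?E x))" for m
        using ub by (intro AE_I2) (simp only: norm_mult norm_of_real, intro mult_left_le, auto)
      show "AE x in lborel. (\<lambda>m. h x * complex_of_real (?E x) * complex_of_real (u m x)) \<longlonglongrightarrow> h x * complex_of_real (?E x) * complex_of_real (indicator (box a b) x)"
        by (intro AE_I2 tendsto_intros ulim)
    qed
    then have "(LINT x|lborel. h x * complex_of_real (?E x) * complex_of_real (indicator (box a b) x)) = 0"
      unfolding cont0[OF uc ub] by (simp add: LIMSEQ_const_iff)
    moreover have "indicator (box a b) x *\<^sub>R z = z * complex_of_real (indicator (box a b) x)" for z :: complex and x :: "real^'n"
      by (simp split: split_indicator)
    ultimately show "(LINT x:box a b|lborel. h x * complex_of_real (?E x)) = 0"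
      unfolding set_lebesgue_integral_def by (simp only:)
  qed
  then show ?thesis
  proof eventually_elim
    case (elim x)
    show ?case
    proof
      assume x: "x \<in> U"
      then have "?E x > 0" unfolding U_def by (intro prod_pos ballI sine_mode_one_pos) (auto simp: mem_interior_cube)
      moreover have "h x = 0 \<or> ?E x = 0" using elim by (simp only: mult_eq_0_iff of_real_eq_0_iff)
      ultimately have "h x = 0" by (metis less_irrefl)
      then show "f x = 0" using x by (simp add: h_def)
    qed
  qed
qed

section \<open>Weak solutions are image flows\<close>

definition image_flow :: "real \<Rightarrow> (real^'n \<Rightarrow> complex) \<Rightarrow> real \<Rightarrow> real^'n \<Rightarrow> complex" where
  "image_flow R F t x = (LINT y:interior (cube R)|lborel. (\<Prod>i\<in>UNIV. image_kernel R t (x $ i) (y $ i)) *\<^sub>R F y)"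

lemma measurable_image_kernel_comp:
  assumes "f \<in> borel_measurable M" "g \<in> borel_measurable M" "h \<in> borel_measurable M"
  shows "(\<lambda>x. image_kernel R (f x) (g x) (h x)) \<in> borel_measurable M"
  using measurable_compose[OF borel_measurable_Pair[OF assms(1) borel_measurable_Pair[OF assms(2,3)]] image_kernel_measurable[of R]] by simp

lemma image_flow_measurable:
  fixes F :: "real^'n \<Rightarrow> complex"
  assumes F: "F \<in> borel_measurable borel"
  shows "(\<lambda>p. image_flow R F (fst p) (snd p)) \<in> borel_measurable borel"
proof -
  have ms: "(\<lambda>q::(real \<times> (real^'n)) \<times> (real^'n). fst (fst q)) \<in> borel_measurable borel"
    "\<And>i. (\<lambda>q::(real \<times> (real^'n)) \<times> (real^'n). snd (fst q) $ i) \<in> borel_measurable borel"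
    "\<And>i. (\<lambda>q::(real \<times> (real^'n)) \<times> (real^'n). snd q $ i) \<in> borel_measurable borel"
    "(\<lambda>q::(real \<times> (real^'n)) \<times> (real^'n). snd q) \<in> borel_measurable borel"
    by (intro borel_measurable_continuous_onI continuous_intros)+
  have "(\<lambda>y::real^'n. indicator (interior (cube R)) y :: real) \<in> borel_measurable borel" by simp
  note im = measurable_compose[OF ms(4) this] measurable_compose[OF ms(4) F]
  have "(\<lambda>p. LINT y|lborel. indicator (interior (cube R)) y *\<^sub>R ((\<Prod>i\<in>UNIV. image_kernel R (fst p) (snd p $ i) (y $ i)) *\<^sub>R F y)) \<in> borel_measurable (lborel :: (real \<times> (real^'n)) measure)"
    by (rule lborel.borel_measurable_lebesgue_integral)
      (simp add: lborel_prod case_prod_beta', intro borel_measurable_scaleR borel_measurable_times borel_measurable_prod measurable_image_kernel_comp ms im)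
  then show ?thesis by (simp add: image_flow_def set_lebesgue_integral_def)
qed

text \<open>The coefficient of the image flow is computed by applying the product kernel to the mode, one coordinate at a time.\<close>

lemma
  fixes F :: "real^'n \<Rightarrow> complex"
  defines "U R \<equiv> interior (cube R)"
  assumes R: "R > 0" and t: "t > 0" and F: "L2_on UNIV F"
  shows image_flow_integrable: "set_integrable lborel (U R) (image_flow R F t)"
    and image_flow_coefficient: "(LINT x:U R|lborel. image_flow R F t x * complex_of_real (tensor_mode R k x))
      = complex_of_real (exp (- (\<Sum>i\<in>UNIV. (real (k i) * pi / (2 * R))\<^sup>2) * t)) * (LINT x:U R|lborel. F x * complex_of_real (tensor_mode R k x))"
proof -
  have [measurable]: "F \<in> borel_measurable borel" by (rule L2_on_UNIV_measurable[OF F])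
  have Us: "U R \<in> sets borel" "emeasure lborel (U R) < \<infinity>" using cube_emeasure_finite[of R] by (auto simp: U_def)
  note Us(1)[measurable]
  define f where "f y = indicator (U R) y *\<^sub>R F y" for y
  have fi: "integrable lborel f"
    using L2_on_set_integrable[OF L2_on_restrict[OF F Us(1)] Us] by (simp add: set_integrable_def f_def[abs_def])
  have [measurable]: "f \<in> borel_measurable borel" using fi by (auto dest: borel_measurable_integrable)
  define p where "p x y = (\<Prod>i\<in>UNIV. indicator {-R<..<R} (x $ i) * image_kernel R t (x $ i) (y $ i))" for x y :: "real^'n"
  have ind: "(\<Prod>i\<in>UNIV. indicator {-R<..<R} (x $ i)) = (indicator (U R) x :: real)" for x :: "real^'n"
  proof (cases "x \<in> U R")
    case True
    then show ?thesis by (simp add: U_def mem_interior_cube abs_less_iff minus_less_iff indicator_def)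
  next
    case False
    then obtain i where "x $ i \<notin> {-R<..<R}" by (auto simp: U_def mem_interior_cube abs_less_iff minus_less_iff)
    then have "(\<Prod>i\<in>UNIV. indicator {-R<..<R} (x $ i)) = (0::real)" by (intro prod_zero bexI[of _ i]) auto
    then show ?thesis using False by simp
  qed
  have p: "p x y = indicator (U R) x * (\<Prod>i\<in>UNIV. image_kernel R t (x $ i) (y $ i))" for x y
    by (simp add: p_def prod.distrib ind)
  have pm: "(\<lambda>q. p (fst q) (snd q)) \<in> borel_measurable borel"
  proof -
    have ms: "\<And>i. (\<lambda>q::(real^'n) \<times> (real^'n). fst q $ i) \<in> borel_measurable borel"
      "\<And>i. (\<lambda>q::(real^'n) \<times> (real^'n). snd q $ i) \<in> borel_measurable borel"
      by (intro borel_measurable_continuous_onI continuous_intros)+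
    have im: "(indicator {-R<..<R} :: real \<Rightarrow> real) \<in> borel_measurable borel" by simp
    show ?thesis unfolding p_def
      by (intro borel_measurable_prod borel_measurable_times measurable_image_kernel_comp ms measurable_compose[OF ms(1) im] borel_measurable_const)
  qed
  have pmy: "(\<lambda>x. p x y) \<in> borel_measurable borel" for y
    using measurable_compose[OF _ pm, of "\<lambda>x. (x, y)" borel] by simp
  have mass: "(\<integral>\<^sup>+x. ennreal \<bar>p x y\<bar> \<partial>lborel) \<le> 1" for y
  proof -
    have m: "(\<lambda>a. ennreal (indicator {-R<..<R} a * \<bar>image_kernel R t a b\<bar>)) \<in> borel_measurable borel" for b
      using measurable_image_kernel_comp[of "\<lambda>_. t" borel "\<lambda>a. a" "\<lambda>_. b" R] by measurable
    have "(\<integral>\<^sup>+x. ennreal \<bar>p x y\<bar> \<partial>lborel) = (\<integral>\<^sup>+x. (\<Prod>i\<in>UNIV. ennreal (indicator {-R<..<R} (x $ i) * \<bar>image_kernel R t (x $ i) (y $ i)\<bar>)) \<partial>lborel)"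
      unfolding p_def abs_prod by (intro nn_integral_cong) (subst prod_ennreal, auto simp: abs_mult)
    also have "\<dots> = (\<Prod>i\<in>UNIV. \<integral>\<^sup>+a. ennreal (indicator {-R<..<R} a * \<bar>image_kernel R t a (y $ i)\<bar>) \<partial>lborel)"
      by (rule nn_integral_prod_vec[OF m])
    also have "\<dots> \<le> 1"
    proof (rule prod_le_1)
      fix i
      have "(\<integral>\<^sup>+a. ennreal (indicator {-R<..<R} a * \<bar>image_kernel R t a (y $ i)\<bar>) \<partial>lborel) = (\<integral>\<^sup>+a\<in>{-R<..<R}. ennreal \<bar>image_kernel R t a (y $ i)\<bar> \<partial>lborel)"
        by (intro nn_integral_cong) (auto split: split_indicator)
      also have "\<dots> \<le> 1" by (rule image_kernel_mass[OF R t])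
      finally show "0 \<le> (\<integral>\<^sup>+a. ennreal (indicator {-R<..<R} a * \<bar>image_kernel R t a (y $ i)\<bar>) \<partial>lborel) \<and> (\<integral>\<^sup>+a. ennreal (indicator {-R<..<R} a * \<bar>image_kernel R t a (y $ i)\<bar>) \<partial>lborel) \<le> 1" by simp
    qed
    finally show ?thesis .
  qed
  have full: "integrable (lborel \<Otimes>\<^sub>M lborel) (\<lambda>q. p (fst q) (snd q) *\<^sub>R f (snd q))"
  proof (rule integrableI_bounded)
    have "(\<lambda>q::(real^'n) \<times> (real^'n). snd q) \<in> borel_measurable borel" by (intro borel_measurable_continuous_onI continuous_intros)
    from measurable_compose[OF this, of f borel]
    show m: "(\<lambda>q. p (fst q) (snd q) *\<^sub>R f (snd q)) \<in> borel_measurable (lborel \<Otimes>\<^sub>M lborel)"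
      using pm by (simp add: lborel_prod)
    have "(\<integral>\<^sup>+q. ennreal (norm (p (fst q) (snd q) *\<^sub>R f (snd q))) \<partial>(lborel \<Otimes>\<^sub>M lborel))
        = (\<integral>\<^sup>+y. (\<integral>\<^sup>+x. ennreal (norm (p x y *\<^sub>R f y)) \<partial>lborel) \<partial>lborel)"
      using lborel_pair.nn_integral_snd[OF measurable_compose[OF measurable_compose[OF m borel_measurable_norm] measurable_ennreal]] by simp
    also have "\<dots> \<le> (\<integral>\<^sup>+y. ennreal (norm (f y)) \<partial>lborel)"
    proof (rule nn_integral_mono)
      fix y
      have "(\<integral>\<^sup>+x. ennreal (norm (p x y *\<^sub>R f y)) \<partial>lborel) = (\<integral>\<^sup>+x. ennreal \<bar>p x y\<bar> \<partial>lborel) * ennreal (norm (f y))"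
        using pmy by (subst nn_integral_multc[symmetric]) (auto simp: ennreal_mult)
      also have "\<dots> \<le> 1 * ennreal (norm (f y))" by (intro mult_right_mono mass) auto
      finally show "(\<integral>\<^sup>+x. ennreal (norm (p x y *\<^sub>R f y)) \<partial>lborel) \<le> ennreal (norm (f y))" by simp
    qed
    also have "\<dots> < \<infinity>" using fi by (simp add: integrable_iff_bounded)
    finally show "(\<integral>\<^sup>+q. ennreal (norm (p (fst q) (snd q) *\<^sub>R f (snd q))) \<partial>(lborel \<Otimes>\<^sub>M lborel)) < \<infinity>" .
  qed
  have flow: "(LINT y|lborel. p x y *\<^sub>R f y) = indicator (U R) x *\<^sub>R image_flow R F t x" for x
    unfolding p f_def image_flow_def set_lebesgue_integral_def U_def
    by (cases "x \<in> interior (cube R)") (auto simp: mult.commute intro!: Bochner_Integration.integral_cong)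
  show "set_integrable lborel (U R) (image_flow R F t)"
    using lborel_pair.integrable_fst'[OF full] by (simp add: set_integrable_def flow)
  let ?E = "tensor_mode R k"
  have Em: "(\<lambda>q::(real^'n) \<times> (real^'n). ?E (fst q)) \<in> borel_measurable borel"
    by (rule measurable_compose[OF _ tensor_mode_measurable(1)]) (intro borel_measurable_continuous_onI continuous_intros)
  have fullE: "integrable (lborel \<Otimes>\<^sub>M lborel) (\<lambda>q. (p (fst q) (snd q) *\<^sub>R f (snd q)) * complex_of_real (?E (fst q)))"
    using integrable_mult_bounded[OF full[unfolded lborel_prod] Em, of 1] unfolding lborel_prod
    by (simp only: prod_abs_le_one sine_mode_abs_le)
  have "(LINT x:U R|lborel. image_flow R F t x * complex_of_real (?E x)) = (LINT x|lborel. (LINT y|lborel. (p x y *\<^sub>R f y) * complex_of_real (?E x)))"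
    unfolding set_lebesgue_integral_def integral_mult_left_zero flow by simp
  also have "\<dots> = (LINT y|lborel. (LINT x|lborel. (p x y *\<^sub>R f y) * complex_of_real (?E x)))"
    using lborel_pair.Fubini_integral[of "\<lambda>x y. (p x y *\<^sub>R f y) * complex_of_real (?E x)"] fullE by (simp add: case_prod_beta')
  also have "\<dots> = (LINT y|lborel. complex_of_real (exp (- (\<Sum>i\<in>UNIV. (real (k i) * pi / (2 * R))\<^sup>2) * t)) * (f y * complex_of_real (?E y)))"
  proof (rule Bochner_Integration.integral_cong[OF refl])
    fix y
    let ?g = "\<lambda>i a. indicator {-R<..<R} a * (image_kernel R t a (y $ i) * sine_mode R (k i) a)"
    have gi: "integrable lborel (?g i)" "(LINT a|lborel. ?g i a) = exp (- (real (k i) * pi / (2 * R))\<^sup>2 * t) * sine_mode R (k i) (y $ i)" for i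
      using image_kernel_sine_integrable[OF R t, of "y $ i" "k i"] image_kernel_sine_integral[OF R t, of "y $ i" "k i"]
      by (simp_all add: integrable_restrict_space integral_restrict_space)
    have "(LINT x|lborel. p x y * ?E x) = (LINT x|lborel. (\<Prod>i\<in>UNIV. ?g i (x $ i)))"
      unfolding p_def prod.distrib[symmetric] mult.assoc ..
    also have "\<dots> = (\<Prod>i\<in>UNIV. (LINT a|lborel. ?g i a))" by (rule integral_prod_vec[OF gi(1)])
    also have "\<dots> = exp (- (\<Sum>i\<in>UNIV. (real (k i) * pi / (2 * R))\<^sup>2) * t) * ?E y"
      unfolding gi(2) prod.distrib exp_sum[OF finite, symmetric] by (simp add: sum_negf[symmetric] sum_distrib_right)
    finally have e: "(LINT x|lborel. p x y * ?E x) = exp (- (\<Sum>i\<in>UNIV. (real (k i) * pi / (2 * R))\<^sup>2) * t) * ?E y" .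
    have "(p x y *\<^sub>R f y) * complex_of_real (?E x) = f y * complex_of_real (p x y * ?E x)" for x
      unfolding of_real_mult scaleR_conv_of_real by (simp add: mult_ac)
    then have "(LINT x|lborel. (p x y *\<^sub>R f y) * complex_of_real (?E x)) = f y * complex_of_real (LINT x|lborel. p x y * ?E x)"
      by (simp only: integral_mult_right_zero integral_complex_of_real)
    then show "(LINT x|lborel. (p x y *\<^sub>R f y) * complex_of_real (?E x)) = complex_of_real (exp (- (\<Sum>i\<in>UNIV. (real (k i) * pi / (2 * R))\<^sup>2) * t)) * (f y * complex_of_real (?E y))"
      unfolding e of_real_mult[of "exp _"] by (simp only: mult_ac)
  qed
  also have "\<dots> = complex_of_real (exp (- (\<Sum>i\<in>UNIV. (real (k i) * pi / (2 * R))\<^sup>2) * t)) * (LINT x:U R|lborel. F x * complex_of_real (?E x))"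
    unfolding integral_mult_right_zero set_lebesgue_integral_def f_def by simp
  finally show "(LINT x:U R|lborel. image_flow R F t x * complex_of_real (?E x))
      = complex_of_real (exp (- (\<Sum>i\<in>UNIV. (real (k i) * pi / (2 * R))\<^sup>2) * t)) * (LINT x:U R|lborel. F x * complex_of_real (?E x))" .
qed

text \<open>There are countably many modes, so for almost every time all coefficients of the difference vanish at once.\<close>

lemma dirichlet_solution_eq_image_flow:
  fixes F :: "real^'n \<Rightarrow> complex"
  assumes sol: "dirichlet_heat_solution T (interior (cube R)) F v" and R: "R > 0" and F: "L2_on UNIV F"
  shows "AE t in lborel. t \<in> {0<..<T} \<longrightarrow> (AE x in lborel. x \<in> interior (cube R) \<longrightarrow> v t x = image_flow R F t x)"
proof -
  let ?U = "interior (cube R) :: (real^'n) set"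
  obtain g where H01: "AE t in lborel. t \<in> {0<..<T} \<longrightarrow> H01_with_gradient ?U (v t) (g t)"
    using sol unfolding dirichlet_heat_solution_def by blast
  have "AE t in lborel. \<forall>k :: 'n \<Rightarrow> nat. t \<in> {0<..<T} \<longrightarrow>
     (LINT x:?U|lborel. v t x * complex_of_real (tensor_mode R k x))
      = complex_of_real (exp (- (\<Sum>i\<in>UNIV. (real (k i) * pi / (2 * R))\<^sup>2) * t)) * (LINT x:?U|lborel. F x * complex_of_real (tensor_mode R k x))"
    unfolding AE_all_countable using dirichlet_solution_coefficient[OF sol R F] by blast
  with H01 show ?thesis
  proof eventually_elim
    case (elim t)
    show ?case
    proof
      assume t: "t \<in> {0<..<T}"
      have vi: "set_integrable lborel ?U (v t)"
        using elim(1) t by (intro L2_on_set_integrable cube_emeasure_finite) (auto simp: H01_with_gradient_def)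
      have wi: "set_integrable lborel ?U (image_flow R F t)" using t by (intro image_flow_integrable R F) auto
      have bd: "integrable lborel (\<lambda>x. (indicator ?U x *\<^sub>R f x) * complex_of_real (tensor_mode R k x))" if "set_integrable lborel ?U f" for f k
        using that integrable_mult_bounded[OF _ tensor_mode_measurable(1), of _ R k 1]
        by (simp only: set_integrable_def prod_abs_le_one sine_mode_abs_le)
      have "AE x in lborel. x \<in> ?U \<longrightarrow> v t x - image_flow R F t x = 0"
      proof (rule sine_system_complete[OF R])
        show "set_integrable lborel ?U (\<lambda>x. v t x - image_flow R F t x)" using vi wi by (rule set_integral_diff)
        fix k :: "'n \<Rightarrow> nat"
        have "(LINT x:?U|lborel. (v t x - image_flow R F t x) * complex_of_real (tensor_mode R k x))
          = (LINT x:?U|lborel. v t x * complex_of_real (tensor_mode R k x)) - (LINT x:?U|lborel. image_flow R F t x * complex_of_real (tensor_mode R k x))"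
          using bd[OF vi, of k] bd[OF wi, of k] unfolding left_diff_distrib
          by (intro set_integral_diff) (simp_all only: set_integrable_def mult_scaleR_left)
        also have "\<dots> = 0" using elim(2) t image_flow_coefficient[OF R _ F, of t k] by simp
        finally show "(LINT x:?U|lborel. (v t x - image_flow R F t x) * complex_of_real (tensor_mode R k x)) = 0" .
      qed
      then show "AE x in lborel. x \<in> ?U \<longrightarrow> v t x = image_flow R F t x" by eventually_elim simp
    qed
  qed
qed

section \<open>Comparison of the two flows on the unit cube\<close>

lemma emeasure_cube:
  assumes R: "R \<ge> 0"
  shows "emeasure lborel (interior (cube R :: (real^'n) set)) = ennreal ((2 * R) ^ CARD('n))"
    and "emeasure lborel (cube R :: (real^'n) set) = ennreal ((2 * R) ^ CARD('n))"
proof -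
  have b: "((\<chi> i. R) - (\<chi> i. - R) :: real^'n) \<bullet> b = 2 * R \<and> ((\<chi> i. - R) :: real^'n) \<bullet> b \<le> (\<chi> i. R) \<bullet> b" if "b \<in> Basis" for b
    using that R by (auto simp: Basis_vec_def inner_axis)
  have p: "(\<Prod>b\<in>Basis. ((\<chi> i. R) - (\<chi> i. - R) :: real^'n) \<bullet> b) = (\<Prod>b\<in>(Basis :: (real^'n) set). 2 * R)"
    using b by (intro prod.cong) auto
  have "emeasure lborel (box (\<chi> i. - R) (\<chi> i. R) :: (real^'n) set) = (\<Prod>b\<in>Basis. ((\<chi> i. R) - (\<chi> i. - R) :: real^'n) \<bullet> b)"
    by (rule emeasure_lborel_box) (use b in blast)
  then show "emeasure lborel (interior (cube R :: (real^'n) set)) = ennreal ((2 * R) ^ CARD('n))"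
    unfolding interior_cube p by simp
  have "emeasure lborel (cbox (\<chi> i. - R) (\<chi> i. R) :: (real^'n) set) = (\<Prod>b\<in>Basis. ((\<chi> i. R) - (\<chi> i. - R) :: real^'n) \<bullet> b)"
    by (rule emeasure_lborel_cbox) (use b in blast)
  then show "emeasure lborel (cube R :: (real^'n) set) = ennreal ((2 * R) ^ CARD('n))"
    unfolding cube_def p by simp
qed

text \<open>Both kernels are products of one-dimensional ones; the difference of the products is estimated factor by factor.\<close>

lemma image_kernel_product_near_heat_kernel:
  fixes x y :: "real^'n"
  assumes R: "R > 1" and t: "0 < t" "t < (R - 1)\<^sup>2" and x: "x \<in> cube (1/2)" and y: "y \<in> interior (cube R)"
  shows "\<bar>heat_kernel t (x - y) - (\<Prod>i\<in>UNIV. image_kernel R t (x $ i) (y $ i))\<bar>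
      \<le> real CARD('n) * (10 / sqrt (4 * pi * t)) ^ CARD('n) * exp (- (R - 1)\<^sup>2 / (8 * t))"
proof -
  define s where "s = sqrt (4 * pi * t)"
  have s: "s > 0" using t by (simp add: s_def)
  define e where "e = exp (- (R - 1)\<^sup>2 / (8 * t))"
  have e: "0 \<le> e" "e \<le> 1" using t by (auto simp: e_def)
  let ?h = "\<lambda>i. heat_kernel1 t (x $ i - y $ i)" and ?p = "\<lambda>i. image_kernel R t (x $ i) (y $ i)"
  have near: "\<bar>?p i - ?h i\<bar> \<le> 9 / s * e" for i
    using image_kernel_near_heat_kernel[OF R t, of "x $ i" "y $ i"] x y
    by (auto simp: s_def e_def mem_cube mem_interior_cube intro: less_imp_le)
  have h: "\<bar>?h i\<bar> \<le> 1 / s" for i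
    using s t by (simp add: heat_kernel1_def s_def[symmetric] divide_right_mono)
  have p: "\<bar>?p i\<bar> \<le> 10 / s" for i
  proof -
    have "9 / s * e \<le> 9 / s * 1" using e s by (intro mult_left_mono) auto
    then have "\<bar>?p i\<bar> \<le> 1 / s + 9 / s" using near[of i] h[of i] by linarith
    then show ?thesis using s by (simp add: add_divide_distrib[symmetric])
  qed
  (* The factor s / 10 brings all factors into the unit ball, as norm_prod_diff requires. *)
  have "norm ((\<Prod>i\<in>UNIV. s / 10 * ?h i) - (\<Prod>i\<in>UNIV. s / 10 * ?p i)) \<le> (\<Sum>i\<in>(UNIV::'n set). norm (s / 10 * ?h i - s / 10 * ?p i))"
  proof (rule norm_prod_diff)
    fix i
    have "s / 10 * \<bar>?h i\<bar> \<le> s / 10 * (1 / s)" using h s by (intro mult_left_mono) auto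
    then show "norm (s / 10 * ?h i) \<le> 1" using s by (simp add: abs_mult)
    have "s / 10 * \<bar>?p i\<bar> \<le> s / 10 * (10 / s)" using p s by (intro mult_left_mono) auto
    then show "norm (s / 10 * ?p i) \<le> 1" using s by (simp add: abs_mult)
  qed
  also have "\<dots> \<le> (\<Sum>i\<in>(UNIV::'n set). e)"
  proof (rule sum_mono)
    fix i
    have "norm (s / 10 * ?h i - s / 10 * ?p i) = s / 10 * \<bar>?p i - ?h i\<bar>"
      unfolding right_diff_distrib[symmetric] real_norm_def abs_mult using s by (simp add: abs_minus_commute)
    also have "\<dots> \<le> s / 10 * (9 / s * e)" using near s by (intro mult_left_mono) auto
    also have "\<dots> \<le> e" using s e by simp
    finally show "norm (s / 10 * ?h i - s / 10 * ?p i) \<le> e" .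
  qed
  also have "(\<Prod>i\<in>UNIV. s / 10 * ?h i) - (\<Prod>i\<in>UNIV. s / 10 * ?p i) = (s / 10) ^ CARD('n) * (heat_kernel t (x - y) - (\<Prod>i\<in>UNIV. ?p i))"
    unfolding heat_kernel_prod[OF t(1)] prod.distrib right_diff_distrib by simp
  finally have "(s / 10) ^ CARD('n) * \<bar>heat_kernel t (x - y) - (\<Prod>i\<in>UNIV. ?p i)\<bar> \<le> real CARD('n) * e"
    using s by (simp add: abs_mult)
  then have le: "(10 / s) ^ CARD('n) * ((s / 10) ^ CARD('n) * \<bar>heat_kernel t (x - y) - (\<Prod>i\<in>UNIV. ?p i)\<bar>) \<le> (10 / s) ^ CARD('n) * (real CARD('n) * e)"
    using s by (intro mult_left_mono) auto
  have "(10 / s) ^ CARD('n) * (s / 10) ^ CARD('n) = 1"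
    using s by (simp add: power_mult_distrib[symmetric])
  then have c: "(10 / s) ^ CARD('n) * ((s / 10) ^ CARD('n) * z) = z" for z
    unfolding mult.assoc[symmetric] by simp
  show ?thesis unfolding s_def[symmetric] e_def[symmetric] using le[unfolded c] by (simp only: mult_ac)
qed

lemma heat_kernel_far:
  fixes x y :: "real^'n"
  assumes R: "R > 1" and t: "0 < t" and x: "x \<in> cube (1/2)" and y: "y \<notin> interior (cube R)"
  shows "heat_kernel t (x - y) \<le> (1 / sqrt (4 * pi * t)) ^ CARD('n) * exp (- (R - 1)\<^sup>2 / (4 * t))"
proof -
  obtain i where i: "\<bar>y $ i\<bar> \<ge> R" using y by (auto simp: mem_interior_cube not_less)
  have "\<bar>x $ i\<bar> \<le> 1/2" using x by (auto simp: mem_cube)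
  then have "R - 1 \<le> \<bar>(x - y) $ i\<bar>" using i by simp
  also have "\<dots> \<le> norm (x - y)" by (rule component_le_norm_cart)
  finally have "(R - 1)\<^sup>2 \<le> (norm (x - y))\<^sup>2" using R by (intro power_mono) auto
  then have "exp (- (norm (x - y))\<^sup>2 / (4 * t)) \<le> exp (- (R - 1)\<^sup>2 / (4 * t))" using t by (simp add: divide_right_mono)
  moreover have "(4 * pi * t) powr (- real CARD('n) / 2) = (1 / sqrt (4 * pi * t)) ^ CARD('n)"
    using t by (simp add: powr_half_sqrt[symmetric] powr_realpow[symmetric] powr_powr powr_minus_divide power_divide flip: powr_realpow)
  ultimately show ?thesis unfolding heat_kernel_def using t by (simp add: mult_left_mono)
qed

text \<open>The two flows differ by the integral operator with kernel \<open>Q\<close>, which is the difference of the kernels inside the cube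
  and the heat kernel outside of it. Both parts of \<open>Q\<close> are small on the unit cube, and Cauchy-Schwarz reduces
  the claim to a bound for the square integral of \<open>Q\<close>.\<close>

lemma image_flow_near_heat_flow:
  fixes F :: "real^'n \<Rightarrow> complex"
  assumes R: "R > 1" and t: "0 < t" "t < (R - 1)\<^sup>2" and x: "x \<in> cube (1/2)" and F: "L2_on UNIV F"
  defines "c \<equiv> sqrt ((real CARD('n))\<^sup>2 * 200 ^ CARD('n) + 4 ^ CARD('n))"
  shows "norm (heat_flow F t x - image_flow R F t x)
     \<le> c * (1 / sqrt t) ^ CARD('n) * sqrt R ^ CARD('n) * exp (- (R - 1)\<^sup>2 / (8 * t)) * L2_norm UNIV F"
proof -
  let ?U = "interior (cube R) :: (real^'n) set" and ?d = "CARD('n)"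
  define s where "s = sqrt (4 * pi * t)"
  have s: "s > 0" using t by (simp add: s_def)
  define N where "N = L2_norm UNIV F"
  have N0: "N \<ge> 0" by (simp add: N_def L2_norm_nonneg)
  define e where "e = exp (- (R - 1)\<^sup>2 / (8 * t))"
  have e2: "exp (- (R - 1)\<^sup>2 / (4 * t)) = e\<^sup>2" unfolding e_def by (simp add: exp_double[symmetric])
  have e0: "e > 0" by (simp add: e_def)
  define A where "A = real ?d * (10 / s) ^ ?d * e"
  have A0: "A \<ge> 0" using s e0 by (simp add: A_def)
  note Fm[measurable] = L2_on_UNIV_measurable[OF F]
  have Us[measurable]: "?U \<in> sets borel" by simp
  define P where "P y = (\<Prod>i\<in>UNIV. image_kernel R t (x $ i) (y $ i))" for y :: "real^'n"
  define Q where "Q y = heat_kernel t (x - y) - indicator ?U y * P y" for y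
  have Pm[measurable]: "P \<in> borel_measurable borel"
    unfolding P_def by (intro borel_measurable_prod measurable_image_kernel_comp) measurable
  have Qm[measurable]: "Q \<in> borel_measurable borel" unfolding Q_def by measurable
  have HK: "heat_kernel t (x - y) \<le> (1 / s) ^ ?d" for y
    using heat_kernel_le[OF t(1), of "x - y"] t(1) unfolding s_def
    by (simp add: powr_half_sqrt[symmetric] powr_realpow[symmetric] powr_powr powr_minus_divide power_divide flip: powr_realpow)
  have PB: "\<bar>indicator ?U y * P y\<bar> \<le> A + (1 / s) ^ ?d" for y
  proof (cases "y \<in> ?U")
    case True
    have "\<bar>heat_kernel t (x - y) - P y\<bar> \<le> A"
      using image_kernel_product_near_heat_kernel[OF R t x True] by (simp add: P_def A_def s_def e_def)
    then show ?thesis using HK[of y] heat_kernel_nonneg[of t "x - y"] True by (simp add: abs_le_iff)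
  qed (use A0 s in simp)
  have fi: "integrable lborel (\<lambda>y. indicator ?U y *\<^sub>R F y)"
    using L2_on_set_integrable[OF L2_on_restrict[OF F Us] Us cube_emeasure_finite] by (simp add: set_integrable_def)
  have PFi: "integrable lborel (\<lambda>y. (indicator ?U y * P y) *\<^sub>R F y)"
  proof -
    have "integrable lborel (\<lambda>y. (indicator ?U y *\<^sub>R F y) * complex_of_real (indicator ?U y * P y))"
      by (rule integrable_mult_bounded[OF fi _ PB]) measurable
    moreover have "(\<lambda>y. (indicator ?U y *\<^sub>R F y) * complex_of_real (indicator ?U y * P y)) = (\<lambda>y. (indicator ?U y * P y) *\<^sub>R F y)"
      by (auto simp: fun_eq_iff scaleR_conv_of_real split: split_indicator)
    ultimately show ?thesis by simp
  qed
  have "heat_flow F t x - image_flow R F t x = (LINT y|lborel. heat_kernel t (x - y) *\<^sub>R F y - (indicator ?U y * P y) *\<^sub>R F y)"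
    unfolding heat_flow_def image_flow_def set_lebesgue_integral_def P_def[symmetric] scaleR_scaleR
    by (rule Bochner_Integration.integral_diff[symmetric, OF heat_flow_integrand_integrable[OF F t(1)] PFi])
  also have "\<dots> = (LINT y|lborel. Q y *\<^sub>R F y)" by (simp add: Q_def scaleR_diff_left)
  finally have diff: "heat_flow F t x - image_flow R F t x = (LINT y|lborel. Q y *\<^sub>R F y)" .
  have Q2: "(\<integral>\<^sup>+y. ennreal ((Q y)\<^sup>2) \<partial>lborel) \<le> ennreal (A\<^sup>2 * (2 * R) ^ ?d + (1 / s) ^ ?d * e\<^sup>2)"
  proof -
    have "ennreal ((Q y)\<^sup>2) \<le> ennreal (A\<^sup>2) * indicator ?U y + ennreal ((1 / s) ^ ?d * e\<^sup>2) * ennreal (heat_kernel t (x - y))" for y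
    proof (cases "y \<in> ?U")
      case True
      have "\<bar>Q y\<bar> \<le> A"
        using image_kernel_product_near_heat_kernel[OF R t x True] True by (simp add: Q_def P_def A_def s_def e_def)
      then have "(Q y)\<^sup>2 \<le> A\<^sup>2" using A0 by (metis abs_ge_zero power2_abs power_mono)
      then show ?thesis using True by (simp add: ennreal_leI add_increasing2)
    next
      case False
      have "(Q y)\<^sup>2 = heat_kernel t (x - y) * heat_kernel t (x - y)" using False by (simp add: Q_def power2_eq_square)
      also have "\<dots> \<le> ((1 / s) ^ ?d * e\<^sup>2) * heat_kernel t (x - y)"
        using heat_kernel_far[OF R t(1) x False] unfolding s_def e2 by (intro mult_right_mono heat_kernel_nonneg)
      finally show ?thesis using False s by (simp add: ennreal_leI heat_kernel_nonneg flip: ennreal_mult)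
    qed
    then have "(\<integral>\<^sup>+y. ennreal ((Q y)\<^sup>2) \<partial>lborel) \<le> (\<integral>\<^sup>+y. ennreal (A\<^sup>2) * indicator ?U y + ennreal ((1 / s) ^ ?d * e\<^sup>2) * ennreal (heat_kernel t (x - y)) \<partial>lborel)"
      by (rule nn_integral_mono)
    also have "\<dots> = ennreal (A\<^sup>2) * emeasure lborel ?U + ennreal ((1 / s) ^ ?d * e\<^sup>2) * 1"
      using heat_kernel_integral(4)[OF t(1), of x] by (subst nn_integral_add) (auto simp: nn_integral_cmult)
    also have "\<dots> = ennreal (A\<^sup>2 * (2 * R) ^ ?d + (1 / s) ^ ?d * e\<^sup>2)"
      using R s by (simp add: emeasure_cube flip: ennreal_mult ennreal_plus)
    finally show ?thesis .
  qed
  define B where "B = c * (1 / sqrt t) ^ ?d * sqrt R ^ ?d * e"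
  have c0: "c \<ge> 0" by (simp add: c_def)
  have B0: "B \<ge> 0" using c0 t R e0 by (simp add: B_def)
  have QB: "A\<^sup>2 * (2 * R) ^ ?d + (1 / s) ^ ?d * e\<^sup>2 \<le> B\<^sup>2"
  proof -
    have "s\<^sup>2 \<le> (4 * R)\<^sup>2"
    proof -
      have "4 * pi * t \<le> 16 * (R - 1)\<^sup>2" using pi_less_4 t by (intro mult_mono) auto
      also have "(R - 1)\<^sup>2 \<le> R\<^sup>2" using R by (intro power_mono) auto
      finally show ?thesis using t by (simp add: s_def power_mult_distrib)
    qed
    then have s4: "s \<le> 4 * R" using R by (intro power2_le_imp_le[of s "4 * R"]) auto
    have ss: "1 / s \<le> 1 / sqrt t"
    proof -
      have "1 * t \<le> 4 * pi * t" using t pi_gt3 by (intro mult_right_mono) auto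
      then have "sqrt t \<le> s" by (simp add: s_def)
      then show ?thesis using t by (simp add: frac_le)
    qed
    (* The contribution from outside the cube carries only half of the power of 1/s; the other half costs s^d <= (4 R)^d. *)
    have p1: "(1 / s) ^ ?d = ((1 / s) ^ ?d)\<^sup>2 * s ^ ?d" using s by (simp add: power_divide power2_eq_square)
    also have "\<dots> \<le> ((1 / s) ^ ?d)\<^sup>2 * (4 * R) ^ ?d" using s s4 by (intro mult_left_mono power_mono) auto
    finally have p2: "(1 / s) ^ ?d * e\<^sup>2 \<le> ((1 / s) ^ ?d)\<^sup>2 * (4 * R) ^ ?d * e\<^sup>2" by (rule mult_right_mono) simp
    have "(10 / s) ^ ?d = 10 ^ ?d * (1 / s) ^ ?d" by (simp add: power_divide)
    then have "A\<^sup>2 * (2 * R) ^ ?d = (real ?d)\<^sup>2 * (10 ^ ?d * 10 ^ ?d * 2 ^ ?d) * R ^ ?d * ((1 / s) ^ ?d)\<^sup>2 * e\<^sup>2"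
      unfolding A_def by (simp add: power_mult_distrib power2_eq_square mult_ac)
    also have "10 ^ ?d * 10 ^ ?d * 2 ^ ?d = (200::real) ^ ?d" by (simp flip: power_mult_distrib)
    finally have "A\<^sup>2 * (2 * R) ^ ?d + (1 / s) ^ ?d * e\<^sup>2 \<le> (real ?d)\<^sup>2 * 200 ^ ?d * R ^ ?d * ((1 / s) ^ ?d)\<^sup>2 * e\<^sup>2 + ((1 / s) ^ ?d)\<^sup>2 * (4 * R) ^ ?d * e\<^sup>2"
      by (rule add_mono[OF eq_refl p2])
    also have "\<dots> = c\<^sup>2 * R ^ ?d * ((1 / s) ^ ?d)\<^sup>2 * e\<^sup>2"
      by (simp add: c_def power_mult_distrib algebra_simps)
    also have "\<dots> \<le> c\<^sup>2 * R ^ ?d * ((1 / sqrt t) ^ ?d)\<^sup>2 * e\<^sup>2"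
      using ss s R by (intro mult_right_mono mult_left_mono power_mono) auto
    also have "\<dots> = B\<^sup>2"
    proof -
      have "R ^ ?d = (sqrt R ^ ?d)\<^sup>2" using R by (simp add: power_mult[symmetric] mult.commute[of ?d]) (simp add: power_mult)
      then show ?thesis unfolding B_def by (simp add: power_mult_distrib mult_ac)
    qed
    finally show ?thesis .
  qed
  have "ennreal (norm (heat_flow F t x - image_flow R F t x)) \<le> (\<integral>\<^sup>+y. ennreal \<bar>Q y\<bar> * ennreal (norm (F y)) \<partial>lborel)"
    unfolding diff by (rule order_trans[OF norm_integral_le_nn]) (simp add: ennreal_mult)
  then have "(ennreal (norm (heat_flow F t x - image_flow R F t x)))\<^sup>2 \<le> (\<integral>\<^sup>+y. ennreal \<bar>Q y\<bar> * ennreal (norm (F y)) \<partial>lborel)\<^sup>2"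
    by (rule power_mono) simp
  also have "\<dots> \<le> (\<integral>\<^sup>+y. (ennreal \<bar>Q y\<bar>)\<^sup>2 \<partial>lborel) * (\<integral>\<^sup>+y. (ennreal (norm (F y)))\<^sup>2 \<partial>lborel)"
    by (rule Cauchy_Schwarz_nn_integral) measurable
  also have "(\<integral>\<^sup>+y. (ennreal (norm (F y)))\<^sup>2 \<partial>lborel) = ennreal (N\<^sup>2)"
    using L2_norm_sq_nn[OF F] by (simp add: ennreal_power N_def)
  also have "(\<integral>\<^sup>+y. (ennreal \<bar>Q y\<bar>)\<^sup>2 \<partial>lborel) * ennreal (N\<^sup>2) \<le> ennreal (B\<^sup>2) * ennreal (N\<^sup>2)"
    using order_trans[OF Q2 ennreal_leI[OF QB]] by (intro mult_right_mono) (simp_all add: ennreal_power)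
  finally have "(norm (heat_flow F t x - image_flow R F t x))\<^sup>2 \<le> (B * N)\<^sup>2"
    by (simp add: ennreal_power power_mult_distrib flip: ennreal_mult)
  then have "norm (heat_flow F t x - image_flow R F t x) \<le> B * N"
    by (rule power2_le_imp_le) (use B0 N0 in simp)
  then show ?thesis by (simp add: B_def N_def e_def)
qed

section \<open>Absorbing the powers of time and radius\<close>

lemma power_exp_bound:
  assumes "u \<ge> 0" "d > 0"
  shows "(1 + u) ^ d \<le> (16 * real d) ^ d * exp (u / 16)"
proof -
  have "1 + u \<le> 16 * real d * (1 + u / (16 * real d))" using assms by (simp add: distrib_left)
  also have "\<dots> \<le> 16 * real d * exp (u / (16 * real d))"
    using assms by (intro mult_left_mono exp_ge_add_one_self) auto
  finally have "(1 + u) ^ d \<le> (16 * real d * exp (u / (16 * real d))) ^ d" using assms by (intro power_mono) auto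
  also have "\<dots> = (16 * real d) ^ d * exp (real d * (u / (16 * real d)))"
    by (simp add: power_mult_distrib exp_of_nat_mult[symmetric])
  finally show ?thesis using assms by simp
qed

text \<open>One half of the exponent pays for the singular power of \<open>t\<close>, which is then replaced by the same power of \<open>T\<close>; the
  other half is monotone in \<open>t\<close>.\<close>

lemma gaussian_factor_monotone:
  assumes t: "0 < t" "t < T" and T: "T < r\<^sup>2" and d: "d > 0"
  shows "(1 / sqrt t) ^ d * exp (- r\<^sup>2 / (8 * t)) \<le> (16 * real d) ^ d * (1 / sqrt T) ^ d * exp (- r\<^sup>2 / (16 * T))"
proof -
  define u where "u = r\<^sup>2 / t"
  have u: "u \<ge> 0" using t by (simp add: u_def)
  have "sqrt (T / t) \<le> 1 + u"
  proof -
    have "T / t \<le> u" using t T by (simp add: u_def divide_right_mono)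
    moreover have "u \<le> (1 + u)\<^sup>2"
      using u mult_nonneg_nonneg[OF u u] by (simp add: power2_eq_square distrib_left distrib_right)
    ultimately have "sqrt (T / t) \<le> sqrt ((1 + u)\<^sup>2)" by (intro real_sqrt_le_mono) simp
    then show ?thesis using u by simp
  qed
  then have "sqrt (T / t) ^ d \<le> (1 + u) ^ d" using t by (intro power_mono) auto
  also have "\<dots> \<le> (16 * real d) ^ d * exp (u / 16)" by (rule power_exp_bound[OF u d])
  finally have 1: "sqrt (T / t) ^ d * exp (- u / 16) \<le> (16 * real d) ^ d"
    by (simp add: exp_minus field_simps)
  have "1 / sqrt t = (1 / sqrt T) * sqrt (T / t)" using t by (simp add: real_sqrt_divide)
  then have "(1 / sqrt t) ^ d = (1 / sqrt T) ^ d * sqrt (T / t) ^ d" by (simp only: power_mult_distrib)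
  moreover have "exp (- r\<^sup>2 / (8 * t)) = exp (- u / 16) * exp (- u / 16)"
    using t by (simp add: u_def exp_add[symmetric] field_simps)
  ultimately have "(1 / sqrt t) ^ d * exp (- r\<^sup>2 / (8 * t)) = (1 / sqrt T) ^ d * (sqrt (T / t) ^ d * exp (- u / 16)) * exp (- u / 16)"
    by (simp only: mult_ac)
  also have "\<dots> \<le> (1 / sqrt T) ^ d * (16 * real d) ^ d * exp (- r\<^sup>2 / (16 * T))"
  proof (intro mult_mono mult_left_mono 1)
    have "r\<^sup>2 / T \<le> u" unfolding u_def using t by (intro divide_left_mono) auto
    then show "exp (- u / 16) \<le> exp (- r\<^sup>2 / (16 * T))" by (simp add: field_simps)
  qed (use t in auto)
  finally show ?thesis by (simp only: mult_ac)
qed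

text \<open>For \<open>T\<close> of the order of \<open>R\<^sup>2\<close> the factor \<open>1 + T\<close> compensates the root, for smaller \<open>T\<close> half of the exponential does.\<close>

lemma sqrt_radius_absorbed:
  assumes R: "R > 1" and T: "T > 0"
  shows "sqrt R * exp (- (R - 1)\<^sup>2 / (16 * T)) \<le> 64 * (1 + T) * exp (- (R - 1)\<^sup>2 / (32 * T))"
proof -
  define w where "w = (R - 1)\<^sup>2 / (32 * T)"
  have w: "w \<ge> 0" using T by (simp add: w_def)
  have "sqrt R \<le> R" using R by (simp add: real_le_lsqrt power2_eq_square)
  also have "\<dots> \<le> 64 * (1 + (R - 1)\<^sup>2 / 32)"
  proof -
    have "0 \<le> (R - 3/2)\<^sup>2" by simp
    then show ?thesis using R by (simp add: power2_eq_square field_simps)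
  qed
  also have "1 + (R - 1)\<^sup>2 / 32 \<le> (1 + T) * (1 + w)"
    using T by (simp add: w_def field_simps)
  also have "(1 + T) * (1 + w) \<le> (1 + T) * exp w" using T by (intro mult_left_mono exp_ge_add_one_self) auto
  finally have "sqrt R \<le> 64 * (1 + T) * exp w" by (simp add: mult.assoc del: distrib_right_numeral distrib_left_numeral)
  then have "sqrt R * exp (- (2 * w)) \<le> 64 * (1 + T) * exp w * exp (- (2 * w))" by (rule mult_right_mono) simp
  also have "\<dots> = 64 * (1 + T) * exp (- w)" by (simp add: exp_add[symmetric] mult.assoc)
  finally show ?thesis by (simp add: w_def)
qed

section \<open>The error estimate\<close>

text \<open>Minkowski's inequality on a set of measure \<open>1\<close>, for a function dominated by the sum of a square integrable function
  and a constant.\<close>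

lemma L2_bound_of_split:
  fixes D :: "'a::euclidean_space \<Rightarrow> 'b::euclidean_space"
  assumes K: "K \<in> sets borel" "emeasure lborel K = 1"
    and Dm: "set_borel_measurable lborel K D" and [measurable]: "I \<in> borel_measurable borel"
    and I: "(\<integral>\<^sup>+x. (I x)\<^sup>2 \<partial>lborel) \<le> ennreal (a\<^sup>2)" and ab: "a \<ge> 0" "b \<ge> 0"
    and le: "AE x in lborel. x \<in> K \<longrightarrow> ennreal (norm (D x)) \<le> I x + ennreal b"
  shows "L2_on K D" "L2_norm K D \<le> a + b"
proof -
  note K(1)[measurable]
  have IK: "(\<integral>\<^sup>+x. I x * indicator K x \<partial>lborel) \<le> ennreal a"
  proof -
    have "(\<integral>\<^sup>+x. I x * indicator K x \<partial>lborel)\<^sup>2 \<le> (\<integral>\<^sup>+x. (I x)\<^sup>2 \<partial>lborel) * (\<integral>\<^sup>+x. (indicator K x)\<^sup>2 \<partial>lborel)"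
      by (rule Cauchy_Schwarz_nn_integral) measurable
    also have "(\<integral>\<^sup>+x. (indicator K x :: ennreal)\<^sup>2 \<partial>lborel) = (\<integral>\<^sup>+x. indicator K x \<partial>lborel)"
      by (intro nn_integral_cong) (auto split: split_indicator)
    also have "\<dots> = 1" using K by simp
    also have "(\<integral>\<^sup>+x. (I x)\<^sup>2 \<partial>lborel) * 1 \<le> ennreal (a\<^sup>2)" using I by simp
    finally have sq: "(\<integral>\<^sup>+x. I x * indicator K x \<partial>lborel)\<^sup>2 \<le> (ennreal a)\<^sup>2" using ab by (simp add: ennreal_power)
    show ?thesis
    proof (cases "\<integral>\<^sup>+x. I x * indicator K x \<partial>lborel")
      case (real r)
      then have "ennreal (r\<^sup>2) \<le> ennreal (a\<^sup>2)" using sq ab by (simp add: ennreal_power)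
      then have "r\<^sup>2 \<le> a\<^sup>2" by (simp add: ennreal_le_iff)
      then have "r \<le> a" using ab(1) by (rule power2_le_imp_le)
      then show ?thesis unfolding real(2) by (rule ennreal_leI)
    next
      case top
      then show ?thesis using sq ab by (simp add: ennreal_power top_unique)
    qed
  qed
  have nn: "(\<integral>\<^sup>+x\<in>K. ennreal ((norm (D x))\<^sup>2) \<partial>lborel) \<le> ennreal ((a + b)\<^sup>2)"
  proof -
    have "(\<integral>\<^sup>+x\<in>K. ennreal ((norm (D x))\<^sup>2) \<partial>lborel) \<le> (\<integral>\<^sup>+x. (I x)\<^sup>2 + (ennreal (2 * b) * (I x * indicator K x) + ennreal (b\<^sup>2) * indicator K x) \<partial>lborel)"
    proof (rule nn_integral_mono_AE)
      show "AE x in lborel. ennreal ((norm (D x))\<^sup>2) * indicator K x \<le> (I x)\<^sup>2 + (ennreal (2 * b) * (I x * indicator K x) + ennreal (b\<^sup>2) * indicator K x)"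
        using le
      proof eventually_elim
        case (elim x)
        show ?case
        proof (cases "x \<in> K")
          case True
          then have "(ennreal (norm (D x)))\<^sup>2 \<le> (I x + ennreal b)\<^sup>2" using elim by (intro power_mono) auto
          also have "\<dots> = (I x)\<^sup>2 + (ennreal (2 * b) * I x + ennreal (b\<^sup>2))"
          proof -
            have "ennreal (2 * b) = ennreal b + ennreal b" "ennreal (b\<^sup>2) = ennreal b * ennreal b"
              using ab by (simp_all add: power2_eq_square flip: ennreal_plus ennreal_mult)
            then show ?thesis by (simp add: power2_eq_square algebra_simps)
          qed
          finally show ?thesis using True by (simp add: ennreal_power)
        qed simp
      qed
    qed
    also have "\<dots> = (\<integral>\<^sup>+x. (I x)\<^sup>2 \<partial>lborel) + (ennreal (2 * b) * (\<integral>\<^sup>+x. I x * indicator K x \<partial>lborel) + ennreal (b\<^sup>2) * 1)"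
      using K by (simp add: nn_integral_add nn_integral_cmult)
    also have "\<dots> \<le> ennreal (a\<^sup>2) + (ennreal (2 * b) * ennreal a + ennreal (b\<^sup>2) * 1)"
      by (intro add_mono mult_left_mono I IK) auto
    also have "\<dots> = ennreal ((a + b)\<^sup>2)"
      using ab by (simp add: power2_sum mult_ac flip: ennreal_mult ennreal_plus)
    finally show ?thesis .
  qed
  have Dm': "(\<lambda>x. indicator K x *\<^sub>R D x) \<in> borel_measurable lborel" using Dm by (simp add: set_borel_measurable_def)
  show L2: "L2_on K D"
    unfolding L2_on_def set_integrable_def
  proof (intro conjI Dm integrableI_bounded)
    have "(\<lambda>x. (norm (indicator K x *\<^sub>R D x))\<^sup>2) \<in> borel_measurable lborel" using Dm' by measurable
    moreover have "(\<lambda>x. (norm (indicator K x *\<^sub>R D x))\<^sup>2) = (\<lambda>x. indicator K x *\<^sub>R (norm (D x))\<^sup>2)"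
      by (auto simp: fun_eq_iff split: split_indicator)
    ultimately show "(\<lambda>x. indicator K x *\<^sub>R (norm (D x))\<^sup>2) \<in> borel_measurable lborel" by simp
    have "(\<integral>\<^sup>+x. ennreal (norm (indicator K x *\<^sub>R (norm (D x))\<^sup>2)) \<partial>lborel) = (\<integral>\<^sup>+x\<in>K. ennreal ((norm (D x))\<^sup>2) \<partial>lborel)"
      by (intro nn_integral_cong) (auto split: split_indicator)
    also have "\<dots> < \<infinity>" using nn by (rule order.strict_trans1) simp
    finally show "(\<integral>\<^sup>+x. ennreal (norm (indicator K x *\<^sub>R (norm (D x))\<^sup>2)) \<partial>lborel) < \<infinity>" .
  qed
  have "(L2_norm K D)\<^sup>2 \<le> (a + b)\<^sup>2"
    using nn unfolding L2_norm_sq_nn[OF L2] by simp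
  then show "L2_norm K D \<le> a + b" by (rule power2_le_imp_le) (use ab in simp)
qed

lemma sqrt_power_eq_powr: "x > 0 \<Longrightarrow> x powr (real m / 2) = sqrt x ^ m"
  by (simp add: powr_half_sqrt[symmetric] powr_realpow[symmetric] powr_powr)

text \<open>For almost every \<open>x\<close> the error is the time integral of \<open>w\<close> after \<open>T\<close> plus that of \<open>w - v\<close> before \<open>T\<close>. The first is
  handled by \<open>heat_flow_tail\<close>; in the second \<open>v\<close> is the image flow, and the pointwise bound \<open>M\<close> does not depend on
  time.\<close>

lemma resonance_error_estimate:
  fixes F :: "real^'n \<Rightarrow> complex"
  assumes R: "R > 1" and w0: "\<omega>0 > 0" and F: "F \<in> spectral_gap_space \<omega>0"
    and T: "0 < T" "T < (R - 1)\<^sup>2" and sol: "dirichlet_heat_solution T (interior (cube R)) F v"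
  defines "C \<equiv> sqrt ((real CARD('n))\<^sup>2 * 200 ^ CARD('n) + 4 ^ CARD('n)) * (16 * real CARD('n)) ^ CARD('n) * 64"
  defines "D \<equiv> \<lambda>x. w_infinity F x - v_integrated T v x"
  shows "L2_on (cube (1/2)) D"
    and "L2_norm (cube (1/2)) D \<le> 1 / \<omega>0\<^sup>2 * exp (- \<omega>0\<^sup>2 * T) * L2_norm UNIV F
      + C * (R powr ((real CARD('n) - 1) / 2) / T powr (real CARD('n) / 2)) * (T + T\<^sup>2) * exp (- (R - 1)\<^sup>2 / (32 * T)) * L2_norm UNIV F"
proof -
  let ?K = "cube (1/2) :: (real^'n) set" and ?U = "interior (cube R) :: (real^'n) set" and ?d = "CARD('n)"
  let ?D = "{0<..<T} \<times> ?U"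
  have FL: "L2_on UNIV F" using F by (simp add: spectral_gap_space_def)
  note Fm[measurable] = L2_on_UNIV_measurable[OF FL]
  have KU: "?K \<subseteq> ?U"
  proof
    fix x :: "real^'n" assume "x \<in> ?K"
    then have "\<bar>x $ i\<bar> \<le> 1/2" for i by (simp add: mem_cube)
    then have "\<bar>x $ i\<bar> < R" for i by (rule le_less_trans) (use R in simp)
    then show "x \<in> ?U" by (simp add: mem_interior_cube)
  qed
  have Ks: "?K \<in> sets borel" by (simp add: cube_def)
  have K1: "emeasure lborel ?K = 1" using emeasure_cube(2)[of "1/2"] by simp
  define N where "N = L2_norm UNIV F"
  have N0: "N \<ge> 0" by (simp add: N_def L2_norm_nonneg)
  define c where "c = sqrt ((real ?d)\<^sup>2 * 200 ^ ?d + 4 ^ ?d)"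
  have c0: "c \<ge> 0" by (simp add: c_def)
  define M where "M = C * (sqrt R ^ (?d - 1) / sqrt T ^ ?d) * (1 + T) * exp (- (R - 1)\<^sup>2 / (32 * T)) * N"
  have C: "C = c * (16 * real ?d) ^ ?d * 64" by (simp add: C_def c_def)
  have M0: "M \<ge> 0" using c0 R T N0 by (simp add: M_def C)
  have bound: "norm (heat_flow F t x - image_flow R F t x) \<le> M" if t: "t \<in> {0<..<T}" and x: "x \<in> ?K" for t x
  proof -
    have t': "0 < t" "t < T" "t < (R - 1)\<^sup>2" using t T by auto
    have Rd: "sqrt R ^ ?d = sqrt R ^ (?d - 1) * sqrt R" by (simp add: power_eq_if mult.commute)
    have "norm (heat_flow F t x - image_flow R F t x)
        \<le> c * (1 / sqrt t) ^ ?d * sqrt R ^ ?d * exp (- (R - 1)\<^sup>2 / (8 * t)) * N"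
      unfolding c_def N_def by (rule image_flow_near_heat_flow[OF R t'(1,3) x FL])
    also have "\<dots> = c * sqrt R ^ ?d * ((1 / sqrt t) ^ ?d * exp (- (R - 1)\<^sup>2 / (8 * t))) * N" by (simp only: mult_ac)
    also have "\<dots> \<le> c * sqrt R ^ ?d * ((16 * real ?d) ^ ?d * (1 / sqrt T) ^ ?d * exp (- (R - 1)\<^sup>2 / (16 * T))) * N"
      using c0 R N0 by (intro mult_right_mono mult_left_mono gaussian_factor_monotone[OF t'(1,2) T(2)]) auto
    also have "\<dots> = c * (16 * real ?d) ^ ?d * sqrt R ^ (?d - 1) * (1 / sqrt T) ^ ?d * (sqrt R * exp (- (R - 1)\<^sup>2 / (16 * T))) * N"
      unfolding Rd by (simp only: mult_ac)
    also have "\<dots> \<le> c * (16 * real ?d) ^ ?d * sqrt R ^ (?d - 1) * (1 / sqrt T) ^ ?d * (64 * (1 + T) * exp (- (R - 1)\<^sup>2 / (32 * T))) * N"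
      using c0 R N0 T by (intro mult_right_mono mult_left_mono sqrt_radius_absorbed) auto
    also have "\<dots> = M"
    proof -
      have "(1 / sqrt T) ^ ?d = inverse (sqrt T ^ ?d)" by (simp add: power_divide divide_inverse power_inverse)
      then show ?thesis unfolding M_def C divide_inverse by (simp only: mult_ac mult_1_left)
    qed
    finally show ?thesis .
  qed
  obtain g where vL: "L2_on ?D (\<lambda>(t, x). v t x)"
    using sol unfolding dirichlet_heat_solution_def by blast
  define V where "V p = indicator ?D p *\<^sub>R v (fst p) (snd p)" for p
  have ind: "indicator ?D (t, x) = (indicator {0<..<T} t * indicator ?U x :: real)" for t x
    by (simp add: indicator_times)
  have Vi: "integrable (lborel \<Otimes>\<^sub>M lborel) V"
    using L2_on_set_integrable[OF vL cylinder_sets cylinder_emeasure_finite] unfolding lborel_prod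
    by (simp add: set_integrable_def V_def[abs_def] case_prod_beta')
  have Vm: "V \<in> borel_measurable (lborel \<Otimes>\<^sub>M lborel)" using Vi by (rule borel_measurable_integrable)
  define W where "W p = indicator ?D p *\<^sub>R image_flow R F (fst p) (snd p)" for p
  have Wm: "W \<in> borel_measurable (lborel \<Otimes>\<^sub>M lborel)"
    unfolding W_def lborel_prod
    by (intro borel_measurable_scaleR borel_measurable_indicator) (simp_all add: cylinder_sets image_flow_measurable[OF Fm])
  have "AE t in lborel. AE x in lborel. V (t, x) = W (t, x)"
    using dirichlet_solution_eq_image_flow[OF sol order.strict_trans[OF zero_less_one R] FL]
  proof (rule AE_mp)
    show "AE t in lborel. (t \<in> {0<..<T} \<longrightarrow> (AE x in lborel. x \<in> ?U \<longrightarrow> v t x = image_flow R F t x)) \<longrightarrow> (AE x in lborel. V (t, x) = W (t, x))"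
    proof (rule AE_I2, rule impI)
      fix t assume a: "t \<in> {0<..<T} \<longrightarrow> (AE x in lborel. x \<in> ?U \<longrightarrow> v t x = image_flow R F t x)"
      show "AE x in lborel. V (t, x) = W (t, x)"
      proof (cases "t \<in> {0<..<T}")
        case True
        with a have "AE x in lborel. x \<in> ?U \<longrightarrow> v t x = image_flow R F t x" by blast
        then show ?thesis by eventually_elim (auto simp: V_def W_def split: split_indicator)
      qed (simp add: V_def W_def ind)
    qed
  qed
  moreover have "{q \<in> space (lborel \<Otimes>\<^sub>M lborel). V (fst q, snd q) = W (fst q, snd q)} \<in> sets (lborel \<Otimes>\<^sub>M lborel)"
    using borel_measurable_diff[OF Vm Wm, THEN measurable_sets, of "{0}"] by (simp add: vimage_def Int_def conj_commute)
  ultimately have eqx: "AE x in lborel. AE t in lborel. V (t, x) = W (t, x)"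
    by (subst (asm) lborel_pair.AE_commute) auto
  have Vx: "AE x in lborel. integrable lborel (\<lambda>t. V (t, x))"
    using lborel_pair.AE_integrable_snd[of "\<lambda>t x. V (t, x)"] Vi by (simp add: case_prod_eta)
  define I where "I x = (\<integral>\<^sup>+t\<in>{T<..}. ennreal (norm (heat_flow F t x)) \<partial>lborel)" for x
  have Im: "I \<in> borel_measurable borel" unfolding I_def by measurable
  have "AE x in lborel. x \<in> ?K \<longrightarrow> ennreal (norm (D x)) \<le> I x + ennreal (T * M)"
    using heat_flow_time_integrable[OF F w0] Vx eqx
  proof eventually_elim
    case (elim x)
    show ?case
    proof
      assume x: "x \<in> ?K"
      then have xU: "x \<in> ?U" using KU by blast
      let ?w = "\<lambda>t. heat_flow F t x"
      have Vt: "V (t, x) = indicator {0<..<T} t *\<^sub>R v t x" "W (t, x) = indicator {0<..<T} t *\<^sub>R image_flow R F t x" for t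
        using xU by (simp_all add: V_def W_def ind)
      have wi: "integrable lborel (\<lambda>t. indicator {0<..} t *\<^sub>R ?w t)" using elim(1) by (simp add: set_integrable_def)
      have w1: "integrable lborel (\<lambda>t. indicator {0<..<T} t *\<^sub>R ?w t)" and w2: "integrable lborel (\<lambda>t. indicator {T<..} t *\<^sub>R ?w t)"
        using elim(1) T by (auto intro: set_integrable_subset simp: set_integrable_def[symmetric])
      have vi: "integrable lborel (\<lambda>t. indicator {0<..<T} t *\<^sub>R v t x)" using elim(2) unfolding Vt .
      have "w_infinity F x = (LINT t|lborel. indicator {0<..<T} t *\<^sub>R ?w t + indicator {T<..} t *\<^sub>R ?w t)"
        unfolding w_infinity_def set_lebesgue_integral_def
      proof (rule integral_cong_AE)
        show "AE t in lborel. indicator {0<..} t *\<^sub>R ?w t = indicator {0<..<T} t *\<^sub>R ?w t + indicator {T<..} t *\<^sub>R ?w t"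
          using AE_lborel_singleton[of T] by eventually_elim (use T in \<open>auto split: split_indicator\<close>)
      qed (use wi w1 w2 in \<open>auto dest: borel_measurable_integrable\<close>)
      then have "D x = (LINT t|lborel. indicator {T<..} t *\<^sub>R ?w t) + (LINT t|lborel. indicator {0<..<T} t *\<^sub>R ?w t - indicator {0<..<T} t *\<^sub>R v t x)"
        unfolding D_def v_integrated_def set_lebesgue_integral_def using w1 w2 vi by simp
      then have "norm (D x) \<le> norm (LINT t|lborel. indicator {T<..} t *\<^sub>R ?w t) + norm (LINT t|lborel. indicator {0<..<T} t *\<^sub>R ?w t - indicator {0<..<T} t *\<^sub>R v t x)"
        by (simp add: norm_triangle_ineq)
      moreover have "norm (LINT t|lborel. indicator {0<..<T} t *\<^sub>R ?w t - indicator {0<..<T} t *\<^sub>R v t x) \<le> (LINT t|lborel. indicator {0<..<T} t * M)"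
      proof (rule order_trans[OF integral_norm_bound integral_mono_AE])
        show "integrable lborel (\<lambda>t. indicator {0<..<T} t * M)" using T by simp
        show "integrable lborel (\<lambda>t. norm (indicator {0<..<T} t *\<^sub>R ?w t - indicator {0<..<T} t *\<^sub>R v t x))" using w1 vi by simp
        show "AE t in lborel. norm (indicator {0<..<T} t *\<^sub>R ?w t - indicator {0<..<T} t *\<^sub>R v t x) \<le> indicator {0<..<T} t * M"
          using elim(3) unfolding Vt
        proof eventually_elim
          case (elim t)
          show ?case unfolding elim using bound[of t x] x by (simp split: split_indicator)
        qed
      qed
      moreover have "(LINT t|lborel. indicator {0<..<T} t * M) = T * M" using T by simp
      ultimately have "norm (D x) \<le> norm (LINT t|lborel. indicator {T<..} t *\<^sub>R ?w t) + T * M" by linarith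
      then have "ennreal (norm (D x)) \<le> ennreal (norm (LINT t|lborel. indicator {T<..} t *\<^sub>R ?w t) + T * M)" by (rule ennreal_leI)
      also have "\<dots> = ennreal (norm (LINT t|lborel. indicator {T<..} t *\<^sub>R ?w t)) + ennreal (T * M)"
        using T M0 by (simp add: ennreal_plus)
      also have "ennreal (norm (LINT t|lborel. indicator {T<..} t *\<^sub>R ?w t)) \<le> I x"
        unfolding I_def by (rule order_trans[OF norm_integral_le_nn]) (auto intro!: nn_integral_mono split: split_indicator)
      finally show "ennreal (norm (D x)) \<le> I x + ennreal (T * M)" by (simp add: add_right_mono)
    qed
  qed
  note main = L2_bound_of_split[OF Ks K1 _ Im heat_flow_tail[OF F w0, of T, folded I_def] _ _ this]
  have Dm: "set_borel_measurable lborel ?K D"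
  proof -
    have "(\<lambda>x. LINT t|lborel. V (t, x)) \<in> borel_measurable lborel"
      using Vm by (intro lborel.borel_measurable_lebesgue_integral) (subst measurable_pair_swap_iff, simp)
    moreover have "(\<lambda>x. w_infinity F x) \<in> borel_measurable lborel"
      unfolding w_infinity_def set_lebesgue_integral_def by measurable
    ultimately have "(\<lambda>x. indicator ?K x *\<^sub>R (w_infinity F x - (LINT t|lborel. V (t, x)))) \<in> borel_measurable lborel"
      using Ks by measurable
    moreover have "indicator ?K x *\<^sub>R (w_infinity F x - (LINT t|lborel. V (t, x))) = indicator ?K x *\<^sub>R D x" for x
      using KU by (auto simp: D_def v_integrated_def set_lebesgue_integral_def V_def ind split: split_indicator)
    ultimately show ?thesis by (simp add: set_borel_measurable_def)
  qed
  have a0: "0 \<le> 1 / \<omega>0\<^sup>2 * exp (- \<omega>0\<^sup>2 * T) * L2_norm UNIV F" by (simp add: L2_norm_nonneg)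
  have b0: "0 \<le> T * M" using T M0 by simp
  show "L2_on ?K D" by (rule main(1)[OF Dm _ a0 b0]) (use T in simp)
  have "L2_norm ?K D \<le> 1 / \<omega>0\<^sup>2 * exp (- \<omega>0\<^sup>2 * T) * L2_norm UNIV F + T * M"
    by (rule main(2)[OF Dm _ a0 b0]) (use T in simp)
  moreover have "T * M = C * (R powr ((real ?d - 1) / 2) / T powr (real ?d / 2)) * (T + T\<^sup>2) * exp (- (R - 1)\<^sup>2 / (32 * T)) * L2_norm UNIV F"
  proof -
    have "R powr ((real ?d - 1) / 2) = sqrt R ^ (?d - 1)"
      using sqrt_power_eq_powr[of R "?d - 1"] R by (simp add: of_nat_diff)
    moreover have "T powr (real ?d / 2) = sqrt T ^ ?d" using sqrt_power_eq_powr[of T ?d] T by simp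
    ultimately show ?thesis unfolding M_def N_def by (simp add: power2_eq_square algebra_simps)
  qed
  ultimately show "L2_norm ?K D \<le> 1 / \<omega>0\<^sup>2 * exp (- \<omega>0\<^sup>2 * T) * L2_norm UNIV F
      + C * (R powr ((real ?d - 1) / 2) / T powr (real ?d / 2)) * (T + T\<^sup>2) * exp (- (R - 1)\<^sup>2 / (32 * T)) * L2_norm UNIV F" by simp
qed

theorem theorem3:
  shows "\<exists>c > 0. \<exists>C > 0. \<forall>R T \<omega>0. \<forall>(F :: real^'n \<Rightarrow> complex) DF v.
    R > 1 \<and> \<omega>0 > 0 \<and>
    F \<in> spectral_gap_space \<omega>0 \<and> has_weak_gradient UNIV F DF \<and> L2_on UNIV DF \<and>
    0 < T \<and> T < \<bar>R - 1\<bar>\<^sup>2 \<and>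
    dirichlet_heat_solution T (interior (cube R)) F v \<longrightarrow>
      L2_on (cube (1/2)) (\<lambda>x. w_infinity F x - v_integrated T v x) \<and>
      L2_norm (cube (1/2)) (\<lambda>x. w_infinity F x - v_integrated T v x)
        \<le> 1 / \<omega>0\<^sup>2 * exp (- \<omega>0\<^sup>2 * T) * L2_norm UNIV F
          + resonance_const C CARD('n) R T \<omega>0 * exp (- c * \<bar>R - 1\<bar>\<^sup>2 / T)
            * (L2_norm UNIV F + L2_norm UNIV DF) \<and>
      (T = \<bar>R - 1\<bar> * sqrt c / \<omega>0 \<longrightarrow>
        L2_norm (cube (1/2)) (\<lambda>x. w_infinity F x - v_integrated T v x)
          \<le> (1 / \<omega>0\<^sup>2 + resonance_const C CARD('n) R T \<omega>0)
            * exp (- \<omega>0 * sqrt c * \<bar>R - 1\<bar>)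
            * (L2_norm UNIV F + L2_norm UNIV DF))"
proof -
  define C where "C = sqrt ((real CARD('n))\<^sup>2 * 200 ^ CARD('n) + 4 ^ CARD('n)) * (16 * real CARD('n)) ^ CARD('n) * 64"
  have C: "C > 0" by (simp add: C_def add_nonneg_pos)
  show ?thesis
  proof (rule exI[of _ "1/32"], rule conjI, simp, rule exI[of _ C], rule conjI, rule C, intro allI impI, elim conjE)
    fix R T \<omega>0 :: real and F :: "real^'n \<Rightarrow> complex" and DF :: "real^'n \<Rightarrow> complex^'n" and v
    assume R: "R > 1" and w0: "\<omega>0 > 0" and F: "F \<in> spectral_gap_space \<omega>0" and T: "0 < T" "T < \<bar>R - 1\<bar>\<^sup>2"
      and sol: "dirichlet_heat_solution T (interior (cube R)) F v"
    let ?D = "\<lambda>x. w_infinity F x - v_integrated T v x"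
    define N where "N = L2_norm UNIV F" define G where "G = L2_norm UNIV DF"
    have N: "N \<ge> 0" "G \<ge> 0" by (simp_all add: N_def G_def L2_norm_nonneg)
    have r: "\<bar>R - 1\<bar> = R - 1" using R by simp
    define X where "X = C * (R powr ((real CARD('n) - 1) / 2) / T powr (real CARD('n) / 2)) * (T + T\<^sup>2)"
    define \<rho> where "\<rho> = resonance_const C CARD('n) R T \<omega>0"
    have X0: "X \<ge> 0" using C T R by (simp add: X_def)
    have "X * 1 \<le> X * (1 / (\<bar>R - 1\<bar> * \<omega>0\<^sup>2) + 1)" using X0 R by (intro mult_left_mono) auto
    then have X\<rho>: "X \<le> \<rho>" by (simp add: \<rho>_def resonance_const_def X_def)
    define E where "E = exp (- (1/32) * \<bar>R - 1\<bar>\<^sup>2 / T)"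
    have E0: "E > 0" by (simp add: E_def)
    note est = resonance_error_estimate[OF R w0 F T(1) T(2)[unfolded r] sol]
    have "L2_norm (cube (1/2)) ?D \<le> 1 / \<omega>0\<^sup>2 * exp (- \<omega>0\<^sup>2 * T) * N + X * E * N"
      using est(2) unfolding X_def N_def E_def r C_def by simp
    also have "X * E * N \<le> \<rho> * E * (N + G)"
      using X\<rho> X0 E0 N by (intro mult_mono) auto
    finally have main: "L2_norm (cube (1/2)) ?D \<le> 1 / \<omega>0\<^sup>2 * exp (- \<omega>0\<^sup>2 * T) * N + \<rho> * E * (N + G)" by simp
    have special: "L2_norm (cube (1/2)) ?D \<le> (1 / \<omega>0\<^sup>2 + \<rho>) * exp (- \<omega>0 * sqrt (1/32) * \<bar>R - 1\<bar>) * (N + G)"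
      if T_eq: "T = \<bar>R - 1\<bar> * sqrt (1/32) / \<omega>0"
    proof -
      define q :: real where "q = sqrt (1/32)"
      have q: "q > 0" "q * q = 1/32" by (simp_all add: q_def)
      have e1: "- \<omega>0\<^sup>2 * T = - \<omega>0 * q * \<bar>R - 1\<bar>"
        unfolding T_eq q_def[symmetric] using w0 by (simp add: power2_eq_square)
      have "- (1/32) * \<bar>R - 1\<bar>\<^sup>2 / T = - \<omega>0 * q * \<bar>R - 1\<bar>"
        unfolding T_eq q_def[symmetric] q(2)[symmetric] using w0 q(1) R by (simp add: power2_eq_square)
      then have E_eq: "E = exp (- \<omega>0 * q * \<bar>R - 1\<bar>)" by (simp add: E_def)
      then have "L2_norm (cube (1/2)) ?D \<le> 1 / \<omega>0\<^sup>2 * E * N + \<rho> * E * (N + G)" using main unfolding e1 by simp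
      also have "1 / \<omega>0\<^sup>2 * E * N \<le> 1 / \<omega>0\<^sup>2 * E * (N + G)" using N E0 by (intro mult_left_mono) auto
      finally have "L2_norm (cube (1/2)) ?D \<le> (1 / \<omega>0\<^sup>2 + \<rho>) * E * (N + G)" by (simp add: distrib_right)
      then show ?thesis unfolding E_eq q_def .
    qed
    show "L2_on (cube (1/2)) ?D \<and>
      L2_norm (cube (1/2)) ?D
        \<le> 1 / \<omega>0\<^sup>2 * exp (- \<omega>0\<^sup>2 * T) * L2_norm UNIV F
          + resonance_const C CARD('n) R T \<omega>0 * exp (- (1/32) * \<bar>R - 1\<bar>\<^sup>2 / T)
            * (L2_norm UNIV F + L2_norm UNIV DF) \<and>
      (T = \<bar>R - 1\<bar> * sqrt (1/32) / \<omega>0 \<longrightarrow>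
        L2_norm (cube (1/2)) ?D
          \<le> (1 / \<omega>0\<^sup>2 + resonance_const C CARD('n) R T \<omega>0)
            * exp (- \<omega>0 * sqrt (1/32) * \<bar>R - 1\<bar>)
            * (L2_norm UNIV F + L2_norm UNIV DF))"
      using est(1) main special unfolding N_def G_def \<rho>_def E_def by blast
  qed
qed

end
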